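(* Let $s$ be a unitarily invariant CNP kernel on $\mathbb{B}_d$ and let $\boldsymbol T=(T_1,\dots,T_d)$ be a $1/s$-contraction on a Hilbert space $\mathcal{H}$, with characteristic function $$\theta_{\boldsymbol T}(\boldsymbol z)=\big(-\tilde{\boldsymbol T}+\Delta_{\boldsymbol T}(I_{\mathcal{H}}-\boldsymbol Z\tilde{\boldsymbol T}^* )^{-1}\boldsymbol Z D_{\tilde{\boldsymbol T}}\big)\big|_{\mathcal{D}_{\tilde{\boldsymbol T}}},\qquad \boldsymbol z\in\mathbb{B}_d.$$ Then $\theta_{\boldsymbol T}$ is a multiplier from $H_s\otimes\mathcal{D}_{\tilde{\boldsymbol T}}$ to $H_s\otimes\overline{\mathrm{Ran}}\,\Delta_{\boldsymbol T}$ with $\|M_{\theta_{\boldsymbol T}}\|\le1$. Moreover, $$V_{\boldsymbol T}V_{\boldsymbol T}^*+M_{\theta_{\boldsymbol T}}M_{\theta_{\boldsymbol T}}^*=I.$$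
   Context: All Hilbert spaces are complex; $d\ge1$; $\mathbb{B}_d$ is the open Euclidean unit ball of $\mathbb{C}^d$. Unitarily invariant CNP kernel: a reproducing kernel $s(\boldsymbol z,\boldsymbol w)=\sum_{n\ge0}a_n\langle\boldsymbol z,\boldsymbol w\rangle^n$ on $\mathbb{B}_d$ with $a_0=1$, $a_n>0$ for all $n$, whose reproducing kernel Hilbert space $H_s$ is an irreducible complete Nevanlinna-Pick space. By a known result this is equivalent to: the real numbers $b_n$ defined by $\sum_{n\ge1}b_nt^n=1-\frac1{\sum_{n\ge0}a_nt^n}$ (as power series near $t=0$) satisfy $b_n\ge0$ for all $n\ge1$; in that case $\sum_{n\ge1}b_n\langle\boldsymbol z,\boldsymbol w\rangle^n=1-1/s(\boldsymbol z,\boldsymbol w)$ for all $\boldsymbol z,\boldsymbol w\in\mathbb{B}_d$. Put $a_\alpha=a_{|\alpha|}\frac{|\alpha|!}{\alpha!}$ for $\alpha\in\mathbb{Z}_+^d$, $b_\alpha=b_{|\alpha|}\frac{|\alpha|!}{\alpha!}$ for $\alpha\in\mathbb{Z}_+^d\setminus\{0\}$. For a Hilbert space $\mathcal{E}$, $H_s\otimes\mathcal{E}$ is identified with the space of $\mathcal{E}$-valued holomorphic functions $\sum_\alpha c_\alpha\boldsymbol z^\alpha$ on $\mathbb{B}_d$ with $\sum_\alpha\|c_\alpha\|^2/a_\alpha<\infty$. A multiplier from $H_s\otimes\mathcal{E}$ to $H_s\otimes\mathcal{F}$ is a $\mathcal{B}(\mathcal{E},\mathcal{F})$-valued function $\varphi$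 on $\mathbb{B}_d$ with $\varphi f\in H_s\otimes\mathcal{F}$ for all $f\in H_s\otimes\mathcal{E}$; $M_\varphi f=\varphi f$ is then bounded. $1/s$-contraction: a commuting $d$-tuple $\boldsymbol T$ of bounded operators on $\mathcal{H}$ such that $\sum_{\alpha\neq0}b_\alpha\boldsymbol T^\alpha(\boldsymbol T^\alpha)^*$ converges strongly and $I-\sum_{\alpha\ne0}b_\alpha\boldsymbol T^\alpha(\boldsymbol T^\alpha)^*\ge0$; $\Delta_{\boldsymbol T}$ is the positive square root of the latter operator. $V_{\boldsymbol T}:\mathcal{H}\to H_s\otimes\overline{\mathrm{Ran}}\,\Delta_{\boldsymbol T}$ is the (well-defined) contraction $V_{\boldsymbol T}h=\sum_{\alpha\in\mathbb{Z}_+^d}a_\alpha\boldsymbol z^\alpha\otimes\Delta_{\boldsymbol T}(\boldsymbol T^\alpha)^*h$. Let $\tilde{\mathcal{H}}=\bigoplus_{\alpha\in\mathbb{Z}_+^d\setminus\{0\}}\mathcal{H}$. For $\boldsymbol z\in\mathbb{B}_d$, $\boldsymbol Z:\tilde{\mathcal{H}}\to\mathcal{H}$ is the operator $(h_\alpha)\mapsto\sum_{\alpha\neq0}b_\alpha^{1/2}\boldsymbol z^\alpha h_\alpha$ (a strict contraction, $\|\boldsymbol Z\|^2=1-1/s(\boldsymbol z,\boldsymbol z)$ for $\mathcal{H}\neq 0$), and $\tilde{\boldsymbol T}:\tilde{\mathcal{H}}\to\mathcal{H}$ is the contraction $(h_\alpha)\mapsto\sum_{\alpha\ne0}b_\alpha^{1/2}\boldsymbol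 T^\alpha h_\alpha$, so $\tilde{\boldsymbol T}\tilde{\boldsymbol T}^*=I-\Delta_{\boldsymbol T}^2$. $D_{\tilde{\boldsymbol T}}=(I_{\tilde{\mathcal{H}}}-\tilde{\boldsymbol T}^*\tilde{\boldsymbol T})^{1/2}$ and $\mathcal{D}_{\tilde{\boldsymbol T}}=\overline{\mathrm{Ran}}\,D_{\tilde{\boldsymbol T}}$. Since $\tilde{\boldsymbol T}D_{\tilde{\boldsymbol T}}=\Delta_{\boldsymbol T}\tilde{\boldsymbol T}$, $\theta_{\boldsymbol T}(\boldsymbol z)\in\mathcal{B}(\mathcal{D}_{\tilde{\boldsymbol T}},\overline{\mathrm{Ran}}\,\Delta_{\boldsymbol T})$. *)

theory Defs
  imports "HOL-Analysis.Analysis" "HOL-Computational_Algebra.Formal_Power_Series"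
begin

section \<open>Complex Hilbert spaces\<close>

text \<open>The inner product is linear in the first argument and conjugate linear in the second.\<close>

class chilbert_space = banach +
  fixes scaleC :: "complex \<Rightarrow> 'a \<Rightarrow> 'a"  (infixr \<open>*\<^sub>C\<close> 75)
    and cinner :: "'a \<Rightarrow> 'a \<Rightarrow> complex"
  assumes scaleC_add_right: "c *\<^sub>C (x + y) = c *\<^sub>C x + c *\<^sub>C y"
    and scaleC_add_left: "(c + e) *\<^sub>C x = c *\<^sub>C x + e *\<^sub>C x"
    and scaleC_scaleC: "c *\<^sub>C e *\<^sub>C x = (c * e) *\<^sub>C x"
    and scaleC_of_real: "complex_of_real r *\<^sub>C x = r *\<^sub>R x"
    and cinner_commute: "cinner y x = cnj (cinner x y)"
    and cinner_add_left: "cinner (x + y) z = cinner x z + cinner y z"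
    and cinner_scaleC_left: "cinner (c *\<^sub>C x) y = c * cinner x y"
    and cinner_self: "cinner x x = complex_of_real ((norm x)\<^sup>2)"

lemma cinner_add_right: "cinner x (y + z) = cinner x y + cinner x z"
  for x :: "'a::chilbert_space"
  by (metis cinner_add_left cinner_commute complex_cnj_add)

lemma cinner_scaleC_right: "cinner x (c *\<^sub>C y) = cnj c * cinner x y"
  for x :: "'a::chilbert_space"
  by (metis cinner_scaleC_left cinner_commute complex_cnj_mult)

lemma norm_scaleC: "norm (c *\<^sub>C x) = cmod c * norm x"
  for x :: "'a::chilbert_space"
proof -
  have "complex_of_real ((norm (c *\<^sub>C x))\<^sup>2) = complex_of_real ((cmod c * norm x)\<^sup>2)"
    by (simp only: cinner_self[symmetric] cinner_scaleC_left cinner_scaleC_right)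
      (simp add: cinner_self power_mult_distrib complex_norm_square[of c, unfolded of_real_power])
  then show ?thesis
    by (metis mult_nonneg_nonneg norm_ge_zero of_real_eq_iff power2_eq_imp_eq)
qed

lemma cinner_bound: "2 * cmod (cinner x y) \<le> (norm x)\<^sup>2 + (norm y)\<^sup>2"
  for x :: "'a::chilbert_space"
proof -
  define c where "c = - sgn (cinner x y)"
  have c1: "cmod c \<le> 1"
    by (simp add: c_def norm_sgn)
  have ci: "cnj c * cinner x y = - cmod (cinner x y)"
  proof (cases "cinner x y = 0")
    case False
    then show ?thesis
      by (simp add: c_def sgn_div_norm scaleR_conv_of_real divide_simps power2_eq_square
          mult.commute flip: complex_norm_square)
  qed simp
  have "complex_of_real ((norm (x + c *\<^sub>C y))\<^sup>2)
      = cinner x x + cnj c * cinner x y + cnj (cnj c * cinner x y) + c * cnj c * cinner y y"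
    unfolding cinner_self[symmetric] cinner_add_left cinner_add_right
      cinner_scaleC_left cinner_scaleC_right
    by (simp add: cinner_commute[of x y] algebra_simps)
  also have "\<dots> = complex_of_real ((norm x)\<^sup>2 - 2 * cmod (cinner x y) + (cmod c)\<^sup>2 * (norm y)\<^sup>2)"
    unfolding ci by (simp add: cinner_self complex_norm_square[of c, unfolded of_real_power])
  finally have "(norm (x + c *\<^sub>C y))\<^sup>2 = (norm x)\<^sup>2 - 2 * cmod (cinner x y) + (cmod c)\<^sup>2 * (norm y)\<^sup>2"
    using of_real_eq_iff by blast
  moreover have "(cmod c)\<^sup>2 * (norm y)\<^sup>2 \<le> 1 * (norm y)\<^sup>2"
    by (intro mult_right_mono) (use c1 in \<open>auto simp: power_le_one\<close>)
  ultimately show ?thesis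
    using zero_le_power2[of "norm (x + c *\<^sub>C y)"] by linarith
qed

instantiation complex :: chilbert_space
begin
definition scaleC_complex :: "complex \<Rightarrow> complex \<Rightarrow> complex" where "scaleC_complex c x = c * x"
definition cinner_complex :: "complex \<Rightarrow> complex \<Rightarrow> complex" where "cinner_complex x y = x * cnj y"
instance
  by standard (simp_all add: scaleC_complex_def cinner_complex_def algebra_simps scaleR_conv_of_real
      flip: complex_norm_square of_real_power)
end

subsection \<open>Hilbert space direct sums\<close>

typedef (overloaded) ('i, 'a::chilbert_space) hsum =
  "{x :: 'i \<Rightarrow> 'a. (\<lambda>i. (norm (x i))\<^sup>2) summable_on UNIV}"
  morphisms hsum_nth Abs_hsum
  by (rule exI[of _ "\<lambda>_. 0"]) simp

lemma hsum_eqI: "(\<And>i. hsum_nth x i = hsum_nth y i) \<Longrightarrow> x = y"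
  by (metis hsum_nth_inject ext)

lemma hsum_summable: "(\<lambda>i. (norm (hsum_nth x i))\<^sup>2) summable_on UNIV"
  using hsum_nth by blast

lemma square_summableI:
  assumes "\<And>F. finite F \<Longrightarrow> (\<Sum>i\<in>F. (norm (f i))\<^sup>2) \<le> B"
  shows "(\<lambda>i. (norm (f i))\<^sup>2) summable_on UNIV" "(\<Sum>\<^sub>\<infinity>i. (norm (f i))\<^sup>2) \<le> B"
proof -
  show *: "(\<lambda>i. (norm (f i))\<^sup>2) summable_on UNIV"
    by (rule nonneg_bdd_above_summable_on) (auto intro!: bdd_aboveI2 assms)
  show "(\<Sum>\<^sub>\<infinity>i. (norm (f i))\<^sup>2) \<le> B"
    by (rule infsum_le_finite_sums[OF *]) (auto intro: assms)
qed

lemma L2_set_le_infsum: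
  assumes "(\<lambda>i. (norm (f i))\<^sup>2) summable_on UNIV" "finite F"
  shows "L2_set (\<lambda>i. norm (f i)) F \<le> sqrt (\<Sum>\<^sub>\<infinity>i. (norm (f i))\<^sup>2)"
  unfolding L2_set_def
  by (intro real_sqrt_le_mono finite_sum_le_infsum) (use assms in auto)

lemma square_summable_add:
  fixes f g :: "'i \<Rightarrow> 'a::chilbert_space"
  assumes "(\<lambda>i. (norm (f i))\<^sup>2) summable_on UNIV" "(\<lambda>i. (norm (g i))\<^sup>2) summable_on UNIV"
  shows "(\<lambda>i. (norm (f i + g i))\<^sup>2) summable_on UNIV"
    and "sqrt (\<Sum>\<^sub>\<infinity>i. (norm (f i + g i))\<^sup>2)
          \<le> sqrt (\<Sum>\<^sub>\<infinity>i. (norm (f i))\<^sup>2) + sqrt (\<Sum>\<^sub>\<infinity>i. (norm (g i))\<^sup>2)" (is "_ \<le> ?B")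
proof -
  have B0: "0 \<le> ?B"
    by (intro add_nonneg_nonneg real_sqrt_ge_zero infsum_nonneg) auto
  have fin: "(\<Sum>i\<in>F. (norm (f i + g i))\<^sup>2) \<le> ?B\<^sup>2" if F: "finite F" for F
  proof -
    have "L2_set (\<lambda>i. norm (f i + g i)) F \<le> L2_set (\<lambda>i. norm (f i) + norm (g i)) F"
      by (intro L2_set_mono) (auto intro: norm_triangle_ineq)
    also have "\<dots> \<le> L2_set (\<lambda>i. norm (f i)) F + L2_set (\<lambda>i. norm (g i)) F"
      by (rule L2_set_triangle_ineq)
    also have "\<dots> \<le> ?B"
      by (intro add_mono L2_set_le_infsum assms F)
    finally have "(L2_set (\<lambda>i. norm (f i + g i)) F)\<^sup>2 \<le> ?B\<^sup>2"
      by (intro power_mono) auto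
    then show ?thesis
      by (simp add: L2_set_def sum_nonneg)
  qed
  show "(\<lambda>i. (norm (f i + g i))\<^sup>2) summable_on UNIV"
    by (rule square_summableI(1)[OF fin])
  have "(\<Sum>\<^sub>\<infinity>i. (norm (f i + g i))\<^sup>2) \<le> ?B\<^sup>2"
    by (rule square_summableI(2)[OF fin])
  then show "sqrt (\<Sum>\<^sub>\<infinity>i. (norm (f i + g i))\<^sup>2) \<le> ?B"
    using B0 by (simp add: real_le_lsqrt real_sqrt_le_iff)
qed

lemma square_summable_scaleC:
  fixes f :: "'i \<Rightarrow> 'a::chilbert_space"
  assumes "(\<lambda>i. (norm (f i))\<^sup>2) summable_on UNIV"
  shows "(\<lambda>i. (norm (c *\<^sub>C f i))\<^sup>2) summable_on UNIV"
  using summable_on_cmult_right[OF assms, of "(cmod c)\<^sup>2"]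
  by (simp add: norm_scaleC power_mult_distrib)

lemma square_summable_scaleR:
  fixes f :: "'i \<Rightarrow> 'a::chilbert_space"
  assumes "(\<lambda>i. (norm (f i))\<^sup>2) summable_on UNIV"
  shows "(\<lambda>i. (norm (r *\<^sub>R f i))\<^sup>2) summable_on UNIV"
  using square_summable_scaleC[OF assms, of "complex_of_real r"] by (simp add: scaleC_of_real)

instantiation hsum :: (type, chilbert_space) "{zero, plus, uminus, minus}"
begin
definition zero_hsum :: "('a, 'b) hsum" where
  "zero_hsum = Abs_hsum (\<lambda>_. 0)"
definition plus_hsum :: "('a, 'b) hsum \<Rightarrow> ('a, 'b) hsum \<Rightarrow> ('a, 'b) hsum" where
  "plus_hsum x y = Abs_hsum (\<lambda>i. hsum_nth x i + hsum_nth y i)"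
definition uminus_hsum :: "('a, 'b) hsum \<Rightarrow> ('a, 'b) hsum" where
  "uminus_hsum x = Abs_hsum (\<lambda>i. - hsum_nth x i)"
definition minus_hsum :: "('a, 'b) hsum \<Rightarrow> ('a, 'b) hsum \<Rightarrow> ('a, 'b) hsum" where
  "minus_hsum x y = Abs_hsum (\<lambda>i. hsum_nth x i - hsum_nth y i)"
instance ..
end

instantiation hsum :: (type, chilbert_space) scaleR
begin
definition scaleR_hsum :: "real \<Rightarrow> ('a, 'b) hsum \<Rightarrow> ('a, 'b) hsum" where
  "scaleR_hsum r x = Abs_hsum (\<lambda>i. r *\<^sub>R hsum_nth x i)"
instance ..
end

definition hsum_norm :: "('i, 'a::chilbert_space) hsum \<Rightarrow> real" where
  "hsum_norm x = sqrt (\<Sum>\<^sub>\<infinity>i. (norm (hsum_nth x i))\<^sup>2)"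

definition hsum_uniformity :: "(('i, 'a) hsum \<times> ('i, 'a::chilbert_space) hsum) filter" where
  "hsum_uniformity = (INF e\<in>{0 <..}. principal {(x, y). hsum_norm (x - y) < e})"

instantiation hsum :: (type, chilbert_space) real_normed_vector
begin

definition norm_hsum :: "('a, 'b) hsum \<Rightarrow> real" where
  "norm_hsum = hsum_norm"
definition sgn_hsum :: "('a, 'b) hsum \<Rightarrow> ('a, 'b) hsum" where
  "sgn_hsum x = inverse (hsum_norm x) *\<^sub>R x"
definition dist_hsum :: "('a, 'b) hsum \<Rightarrow> ('a, 'b) hsum \<Rightarrow> real" where
  "dist_hsum x y = hsum_norm (x - y)"
definition uniformity_hsum :: "(('a, 'b) hsum \<times> ('a, 'b) hsum) filter" where
  "uniformity_hsum = hsum_uniformity"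
definition open_hsum :: "('a, 'b) hsum set \<Rightarrow> bool" where
  "open_hsum U \<longleftrightarrow> (\<forall>x\<in>U. eventually (\<lambda>(x', y). x' = x \<longrightarrow> y \<in> U) hsum_uniformity)"

lemma hsum_nth_zero: "hsum_nth (0 :: ('a, 'b::chilbert_space) hsum) i = 0"
  by (simp add: zero_hsum_def Abs_hsum_inverse)

lemma hsum_nth_add: "hsum_nth (x + y) i = hsum_nth x i + hsum_nth y i" for x :: "('a, 'b::chilbert_space) hsum"
  by (simp add: plus_hsum_def Abs_hsum_inverse square_summable_add hsum_summable)

lemma hsum_nth_uminus: "hsum_nth (- x) i = - hsum_nth x i" for x :: "('a, 'b::chilbert_space) hsum"
  by (simp add: uminus_hsum_def Abs_hsum_inverse hsum_summable)

lemma hsum_nth_diff: "hsum_nth (x - y) i = hsum_nth x i - hsum_nth y i" for x :: "('a, 'b::chilbert_space) hsum"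
  using square_summable_add(1)[OF hsum_summable[of x] hsum_summable[of "- y"]]
  by (simp add: minus_hsum_def Abs_hsum_inverse hsum_nth_uminus)

lemma hsum_nth_scaleR: "hsum_nth (r *\<^sub>R x) i = r *\<^sub>R hsum_nth x i" for x :: "('a, 'b::chilbert_space) hsum"
  unfolding scaleR_hsum_def
  by (subst Abs_hsum_inverse) (simp_all only: mem_Collect_eq square_summable_scaleR hsum_summable)

lemmas hsum_nth_simps = hsum_nth_zero hsum_nth_add hsum_nth_uminus hsum_nth_diff hsum_nth_scaleR

lemma norm_hsum_nth_le: "norm (hsum_nth x i) \<le> hsum_norm x" for x :: "('a, 'b::chilbert_space) hsum"
  using L2_set_le_infsum[OF hsum_summable, of "{i}" x] by (simp add: hsum_norm_def)

instance
proof
  fix x y z :: "('a, 'b) hsum" and r q :: real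
  show "x + y + z = x + (y + z)" "x + y = y + x" "0 + x = x" "- x + x = 0" "x - y = x + - y"
    by (auto intro!: hsum_eqI simp: hsum_nth_simps)
  show "r *\<^sub>R (x + y) = r *\<^sub>R x + r *\<^sub>R y" "(r + q) *\<^sub>R x = r *\<^sub>R x + q *\<^sub>R x"
    "r *\<^sub>R q *\<^sub>R x = (r * q) *\<^sub>R x" "1 *\<^sub>R x = x"
    by (auto intro!: hsum_eqI simp: hsum_nth_simps algebra_simps)
  show "sgn x = x /\<^sub>R norm x" by (simp add: sgn_hsum_def norm_hsum_def)
  show "dist x y = norm (x - y)" by (simp add: dist_hsum_def norm_hsum_def)
  show "uniformity = (INF e\<in>{0 <..}. principal {(x :: ('a, 'b) hsum, y). dist x y < e})"
    by (simp add: uniformity_hsum_def hsum_uniformity_def dist_hsum_def)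
  show "open U \<longleftrightarrow> (\<forall>x\<in>U. eventually (\<lambda>(x', y). x' = x \<longrightarrow> y \<in> U) uniformity)"
    for U :: "('a, 'b) hsum set"
    by (simp add: open_hsum_def uniformity_hsum_def)
  show "norm x = 0 \<longleftrightarrow> x = 0"
  proof
    assume "norm x = 0"
    then have "norm (hsum_nth x i) \<le> 0" for i
      using norm_hsum_nth_le[of x i] by (simp add: norm_hsum_def)
    then show "x = 0"
      by (auto intro!: hsum_eqI simp: hsum_nth_simps)
  qed (simp add: norm_hsum_def hsum_norm_def hsum_nth_simps)
  show "norm (x + y) \<le> norm x + norm y"
    unfolding norm_hsum_def hsum_norm_def hsum_nth_add by (intro square_summable_add hsum_summable)
  show "norm (r *\<^sub>R x) = \<bar>r\<bar> * norm x"
    by (simp add: norm_hsum_def hsum_norm_def hsum_nth_scaleR power_mult_distrib infsum_cmult_right' real_sqrt_mult)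
qed

end

instance hsum :: (type, chilbert_space) banach
proof
  fix X :: "nat \<Rightarrow> ('a, 'b) hsum"
  assume X: "Cauchy X"
  have small: "\<exists>M. \<forall>m\<ge>M. \<forall>n\<ge>M. hsum_norm (X m - X n) < e" if "e > 0" for e
    using X that unfolding Cauchy_def dist_hsum_def by blast
  have "Cauchy (\<lambda>n. hsum_nth (X n) i)" for i
  proof (rule metric_CauchyI)
    fix e :: real assume "e > 0"
    then obtain M where M: "\<forall>m\<ge>M. \<forall>n\<ge>M. hsum_norm (X m - X n) < e"
      using small by blast
    have "dist (hsum_nth (X m) i) (hsum_nth (X n) i) < e" if "m \<ge> M" "n \<ge> M" for m n
      using norm_hsum_nth_le[of "X m - X n" i] M that
      by (fastforce simp: hsum_nth_diff dist_norm)
    then show "\<exists>M. \<forall>m\<ge>M. \<forall>n\<ge>M. dist (hsum_nth (X m) i) (hsum_nth (X n) i) < e"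
      by blast
  qed
  then have "\<exists>l. (\<lambda>n. hsum_nth (X n) i) \<longlonglongrightarrow> l" for i
    using Cauchy_convergent_iff convergent_def by blast
  then obtain l where l: "\<And>i. (\<lambda>n. hsum_nth (X n) i) \<longlonglongrightarrow> l i"
    by metis
  have tail: "(\<Sum>i\<in>F. (norm (hsum_nth (X m) i - l i))\<^sup>2) \<le> e\<^sup>2"
    if M: "\<forall>m\<ge>M. \<forall>n\<ge>M. hsum_norm (X m - X n) < e" and m: "m \<ge> M" and F: "finite F" and e: "e > 0" for e M m F
  proof (rule tendsto_upperbound)
    show "(\<lambda>n. \<Sum>i\<in>F. (norm (hsum_nth (X m) i - hsum_nth (X n) i))\<^sup>2)
        \<longlonglongrightarrow> (\<Sum>i\<in>F. (norm (hsum_nth (X m) i - l i))\<^sup>2)"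
      by (intro tendsto_intros l)
    have "(\<Sum>i\<in>F. (norm (hsum_nth (X m) i - hsum_nth (X n) i))\<^sup>2) \<le> e\<^sup>2" if "n \<ge> M" for n
    proof -
      have "(\<Sum>i\<in>F. (norm (hsum_nth (X m - X n) i))\<^sup>2)
          \<le> (\<Sum>\<^sub>\<infinity>i. (norm (hsum_nth (X m - X n) i))\<^sup>2)"
        by (intro finite_sum_le_infsum hsum_summable F) auto
      also have "\<dots> = (hsum_norm (X m - X n))\<^sup>2"
        by (simp add: hsum_norm_def infsum_nonneg)
      also have "\<dots> \<le> e\<^sup>2"
        using M m that by (intro power_mono) (auto simp: hsum_norm_def infsum_nonneg less_imp_le)
      finally show ?thesis
        by (simp add: hsum_nth_diff)
    qed
    then show "\<forall>\<^sub>F n in sequentially. (\<Sum>i\<in>F. (norm (hsum_nth (X m) i - hsum_nth (X n) i))\<^sup>2) \<le> e\<^sup>2"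
      using eventually_at_top_linorder by blast
  qed simp
  obtain M1 where M1: "\<forall>m\<ge>M1. \<forall>n\<ge>M1. hsum_norm (X m - X n) < 1"
    using small[of 1] by auto
  have "(\<lambda>i. (norm (l i - hsum_nth (X M1) i))\<^sup>2) summable_on UNIV"
    by (rule square_summableI(1)[where B = 1])
      (use tail[OF M1 order_refl] in \<open>simp add: norm_minus_commute\<close>)
  then have "(\<lambda>i. (norm (l i - hsum_nth (X M1) i + hsum_nth (X M1) i))\<^sup>2) summable_on UNIV"
    by (rule square_summable_add) (rule hsum_summable)
  then have "(\<lambda>i. (norm (l i))\<^sup>2) summable_on UNIV"
    by simp
  then obtain L where L: "hsum_nth L = l"
    by (metis Abs_hsum_inverse mem_Collect_eq)
  have "X \<longlonglongrightarrow> L"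
  proof (rule metric_LIMSEQ_I)
    fix e :: real assume e: "e > 0"
    then obtain M where M: "\<forall>m\<ge>M. \<forall>n\<ge>M. hsum_norm (X m - X n) < e/2"
      using small[of "e/2"] by auto
    have "dist (X m) L < e" if "m \<ge> M" for m
    proof -
      have "(\<Sum>\<^sub>\<infinity>i. (norm (hsum_nth (X m - L) i))\<^sup>2) \<le> (e/2)\<^sup>2"
        by (rule square_summableI(2)) (use tail[OF M that] e in \<open>simp add: hsum_nth_diff L\<close>)
      then have "hsum_norm (X m - L) \<le> e/2"
        unfolding hsum_norm_def using e by (intro real_le_lsqrt) (auto simp: infsum_nonneg)
      then show ?thesis
        using e by (simp add: dist_hsum_def)
    qed
    then show "\<exists>M. \<forall>m\<ge>M. dist (X m) L < e"
      by blast
  qed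
  then show "convergent X"
    by (auto simp: convergent_def)
qed

instantiation hsum :: (type, chilbert_space) chilbert_space
begin

definition scaleC_hsum :: "complex \<Rightarrow> ('a, 'b) hsum \<Rightarrow> ('a, 'b) hsum" where
  "scaleC_hsum c x = Abs_hsum (\<lambda>i. c *\<^sub>C hsum_nth x i)"
definition cinner_hsum :: "('a, 'b) hsum \<Rightarrow> ('a, 'b) hsum \<Rightarrow> complex" where
  "cinner_hsum x y = (\<Sum>\<^sub>\<infinity>i. cinner (hsum_nth x i) (hsum_nth y i))"

lemma hsum_nth_scaleC: "hsum_nth (c *\<^sub>C x) i = c *\<^sub>C hsum_nth x i" for x :: "('a, 'b) hsum"
  by (simp add: scaleC_hsum_def Abs_hsum_inverse square_summable_scaleC hsum_summable)

lemma hsum_cinner_summable: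
  "(\<lambda>i. cinner (hsum_nth x i) (hsum_nth y i)) summable_on UNIV" for x y :: "('a, 'b) hsum"
proof (rule Infinite_Sum.abs_summable_summable)
  have s: "(\<lambda>i. (norm (hsum_nth x i))\<^sup>2 + (norm (hsum_nth y i))\<^sup>2) summable_on UNIV"
    by (intro summable_on_add hsum_summable)
  show "(\<lambda>i. cmod (cinner (hsum_nth x i) (hsum_nth y i))) summable_on UNIV"
  proof (rule Infinite_Sum.abs_summable_on_comparison_test)
    show "(\<lambda>i. norm ((norm (hsum_nth x i))\<^sup>2 + (norm (hsum_nth y i))\<^sup>2)) summable_on UNIV"
      using s by simp
    show "cmod (cinner (hsum_nth x i) (hsum_nth y i))
        \<le> norm ((norm (hsum_nth x i))\<^sup>2 + (norm (hsum_nth y i))\<^sup>2)" for i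
      using cinner_bound[of "hsum_nth x i" "hsum_nth y i"]
        norm_ge_zero[of "cinner (hsum_nth x i) (hsum_nth y i)"]
      unfolding real_norm_def by linarith
  qed
qed

instance
proof
  fix x y z :: "('a, 'b) hsum" and r :: real and c e :: complex
  show "c *\<^sub>C (x + y) = c *\<^sub>C x + c *\<^sub>C y" "(c + e) *\<^sub>C x = c *\<^sub>C x + e *\<^sub>C x"
    "c *\<^sub>C e *\<^sub>C x = (c * e) *\<^sub>C x" "complex_of_real r *\<^sub>C x = r *\<^sub>R x"
    by (auto intro!: hsum_eqI simp: hsum_nth_simps hsum_nth_scaleC scaleC_add_right scaleC_add_left
        scaleC_scaleC scaleC_of_real)
  show "cinner y x = cnj (cinner x y)"
    unfolding cinner_hsum_def infsum_cnj[symmetric]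
    by (rule infsum_cong) (rule cinner_commute)
  show "cinner (x + y) z = cinner x z + cinner y z"
    by (simp add: cinner_hsum_def hsum_nth_add cinner_add_left infsum_add hsum_cinner_summable)
  show "cinner (c *\<^sub>C x) y = c * cinner x y"
    by (simp add: cinner_hsum_def hsum_nth_scaleC cinner_scaleC_left infsum_cmult_right')
  show "cinner x x = complex_of_real ((norm x)\<^sup>2)"
    using infsumI[OF has_sum_bounded_linear[OF bounded_linear_of_real has_sum_infsum[OF hsum_summable[of x]]]]
    by (simp add: cinner_hsum_def norm_hsum_def hsum_norm_def cinner_self infsum_nonneg)
qed

end

subsection \<open>Operators\<close>

text \<open>Closed subspaces are sets in an ambient Hilbert space, so an operator between two of them is
  a function whose values outside the domain are irrelevant.\<close>

definition bounded_op :: "'a::chilbert_space set \<Rightarrow> 'b::chilbert_space set \<Rightarrow> ('a \<Rightarrow> 'b) \<Rightarrow> bool" where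
  "bounded_op E F A \<longleftrightarrow>
     (\<forall>x\<in>E. A x \<in> F) \<and>
     (\<forall>x\<in>E. \<forall>y\<in>E. A (x + y) = A x + A y) \<and>
     (\<forall>c. \<forall>x\<in>E. A (c *\<^sub>C x) = c *\<^sub>C A x) \<and>
     (\<exists>K. \<forall>x\<in>E. norm (A x) \<le> K * norm x)"

text \<open>Adjoint of an operator from the Hilbert space on the carrier \<open>X\<close> with inner product
  \<open>ip\<^sub>X\<close> to a Hilbert space with inner product \<open>ip\<^sub>Y\<close>.\<close>

definition adjoint_on ::
    "'a set \<Rightarrow> ('a \<Rightarrow> 'a \<Rightarrow> complex) \<Rightarrow> ('b \<Rightarrow> 'b \<Rightarrow> complex) \<Rightarrow> ('a \<Rightarrow> 'b) \<Rightarrow> 'b \<Rightarrow> 'a" where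
  "adjoint_on X ip\<^sub>X ip\<^sub>Y A y = (THE x. x \<in> X \<and> (\<forall>u\<in>X. ip\<^sub>Y (A u) y = ip\<^sub>X u x))"

abbreviation cadjoint :: "('a::chilbert_space \<Rightarrow> 'b::chilbert_space) \<Rightarrow> 'b \<Rightarrow> 'a" where
  "cadjoint \<equiv> adjoint_on UNIV cinner cinner"

definition positive_op :: "('a::chilbert_space \<Rightarrow> 'a) \<Rightarrow> bool" where
  "positive_op A \<longleftrightarrow> bounded_op UNIV UNIV A \<and> (\<forall>h. cinner (A h) h \<in> \<real>\<^sub>\<ge>\<^sub>0)"

definition positive_sqrt :: "('a::chilbert_space \<Rightarrow> 'a) \<Rightarrow> 'a \<Rightarrow> 'a" where
  "positive_sqrt A = (THE S. positive_op S \<and> S \<circ> S = A)"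

section \<open>Multi-indices\<close>

type_synonym 'd multi_index = "'d \<Rightarrow> nat"

typedef 'd nonzero_index = "{\<alpha> :: 'd multi_index. \<alpha> \<noteq> (\<lambda>_. 0)}"
  morphisms index_of Abs_nonzero_index
  by (rule exI[of _ "\<lambda>_. 1"]) (simp add: fun_eq_iff)

definition multi_coeff :: "(nat \<Rightarrow> real) \<Rightarrow> 'd::finite multi_index \<Rightarrow> real" where
  "multi_coeff a \<alpha> = a (sum \<alpha> UNIV) * fact (sum \<alpha> UNIV) / (\<Prod>i\<in>UNIV. fact (\<alpha> i))"

definition monomial :: "complex ^ 'd::finite \<Rightarrow> 'd multi_index \<Rightarrow> complex" where
  "monomial z \<alpha> = (\<Prod>i\<in>UNIV. (z $ i) ^ \<alpha> i)"

text \<open>The composition of the \<open>T i ^^ \<alpha> i\<close>, meaningful for commuting tuples.\<close>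

definition op_monomial :: "('d::finite \<Rightarrow> 'a \<Rightarrow> 'a) \<Rightarrow> 'd multi_index \<Rightarrow> 'a \<Rightarrow> 'a" where
  "op_monomial T \<alpha> = Finite_Set.fold (\<lambda>i A. (T i ^^ \<alpha> i) \<circ> A) id UNIV"

section \<open>The spaces $H_s \otimes E$ and their multipliers\<close>

text \<open>\<open>a\<close> is the coefficient sequence of the kernel \<open>s\<close>. Elements of $H_s \otimes E$ are functions on
  the unit ball, represented as functions on the whole space that vanish off the ball.\<close>

definition hs_expansion ::
    "(nat \<Rightarrow> real) \<Rightarrow> (complex ^ 'd::finite \<Rightarrow> 'e::chilbert_space) \<Rightarrow> ('d multi_index \<Rightarrow> 'e) \<Rightarrow> bool" where
  "hs_expansion a f c \<longleftrightarrow>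
     (\<lambda>\<alpha>. (norm (c \<alpha>))\<^sup>2 / multi_coeff a \<alpha>) summable_on UNIV \<and>
     (\<forall>z\<in>ball 0 1. ((\<lambda>\<alpha>. monomial z \<alpha> *\<^sub>C c \<alpha>) has_sum f z) UNIV) \<and>
     (\<forall>z. z \<notin> ball 0 1 \<longrightarrow> f z = 0)"

definition hs_space ::
    "(nat \<Rightarrow> real) \<Rightarrow> 'e::chilbert_space set \<Rightarrow> (complex ^ 'd::finite \<Rightarrow> 'e) set" where
  "hs_space a E = {f. \<exists>c. range c \<subseteq> E \<and> hs_expansion a f c}"

definition hs_coeff ::
    "(nat \<Rightarrow> real) \<Rightarrow> (complex ^ 'd::finite \<Rightarrow> 'e::chilbert_space) \<Rightarrow> 'd multi_index \<Rightarrow> 'e" where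
  "hs_coeff a f = (THE c. hs_expansion a f c)"

definition hs_inner ::
    "(nat \<Rightarrow> real) \<Rightarrow> (complex ^ 'd::finite \<Rightarrow> 'e::chilbert_space) \<Rightarrow> (complex ^ 'd \<Rightarrow> 'e) \<Rightarrow> complex" where
  "hs_inner a f g = (\<Sum>\<^sub>\<infinity>\<alpha>. cinner (hs_coeff a f \<alpha>) (hs_coeff a g \<alpha>) / complex_of_real (multi_coeff a \<alpha>))"

definition hs_norm :: "(nat \<Rightarrow> real) \<Rightarrow> (complex ^ 'd::finite \<Rightarrow> 'e::chilbert_space) \<Rightarrow> real" where
  "hs_norm a f = sqrt (Re (hs_inner a f f))"

definition mult_op ::
    "(complex ^ 'd::finite \<Rightarrow> 'e \<Rightarrow> 'f::zero) \<Rightarrow> (complex ^ 'd \<Rightarrow> 'e) \<Rightarrow> complex ^ 'd \<Rightarrow> 'f" where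
  "mult_op \<phi> f z = (if z \<in> ball 0 1 then \<phi> z (f z) else 0)"

definition multiplier ::
    "(nat \<Rightarrow> real) \<Rightarrow> 'e::chilbert_space set \<Rightarrow> 'f::chilbert_space set
      \<Rightarrow> (complex ^ 'd::finite \<Rightarrow> 'e \<Rightarrow> 'f) \<Rightarrow> bool" where
  "multiplier a E F \<phi> \<longleftrightarrow>
     (\<forall>z\<in>ball 0 1. bounded_op E F (\<phi> z)) \<and>
     (\<forall>f\<in>hs_space a E. mult_op \<phi> f \<in> hs_space a F)"

text \<open>$\|M_\varphi\| \le 1$ as an operator on $H_s \otimes E$.\<close>

definition mult_contractive ::
    "(nat \<Rightarrow> real) \<Rightarrow> 'e::chilbert_space set \<Rightarrow> (complex ^ 'd::finite \<Rightarrow> 'e \<Rightarrow> 'f::chilbert_space) \<Rightarrow> bool" where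
  "mult_contractive a E \<phi> \<longleftrightarrow> (\<forall>f\<in>hs_space a E. hs_norm a (mult_op \<phi> f) \<le> hs_norm a f)"

section \<open>Unitarily invariant complete Nevanlinna-Pick kernels\<close>

text \<open>A copy of $\mathbb{C}^n$ in $\ell^2(\mathbb{N})$, so that $n$ can be quantified over.\<close>

definition coord_space :: "nat \<Rightarrow> (nat, complex) hsum set" where
  "coord_space n = {x. \<forall>i\<ge>n. hsum_nth x i = 0}"

text \<open>Every matrix-valued Nevanlinna-Pick problem $\varphi(x_i) = W_i \in \mathcal{B}(\mathbb{C}^n, \mathbb{C}^m)$
  whose Pick matrix $[s(x_i, x_j)(I - W_i W_j^*)]$ is positive semidefinite has a solution in the
  closed unit ball of the multipliers.\<close>

definition complete_pick ::
    "(complex ^ 'd::finite \<Rightarrow> complex ^ 'd \<Rightarrow> complex) \<Rightarrow> (nat \<Rightarrow> real) \<Rightarrow> bool" where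
  "complete_pick s a \<longleftrightarrow>
     (\<forall>(N::nat) m n (x :: nat \<Rightarrow> complex ^ 'd) (W :: nat \<Rightarrow> (nat, complex) hsum \<Rightarrow> (nat, complex) hsum).
        x ` {..<N} \<subseteq> ball 0 1 \<longrightarrow> inj_on x {..<N} \<longrightarrow>
        (\<forall>i<N. bounded_op (coord_space n) (coord_space m) (W i)) \<longrightarrow>
        (\<forall>v. (\<forall>i<N. v i \<in> coord_space m) \<longrightarrow>
           (\<Sum>i<N. \<Sum>j<N. s (x i) (x j) *
              cinner (v j - W i (adjoint_on (coord_space n) cinner cinner (W j) (v j))) (v i)) \<in> \<real>\<^sub>\<ge>\<^sub>0) \<longrightarrow>
        (\<exists>\<phi>. multiplier a (coord_space n) (coord_space m) \<phi> \<and>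
             mult_contractive a (coord_space n) \<phi> \<and>
             (\<forall>i<N. \<forall>e\<in>coord_space n. \<phi> (x i) e = W i e)))"

definition irreducible_kernel :: "(complex ^ 'd::finite \<Rightarrow> complex ^ 'd \<Rightarrow> complex) \<Rightarrow> bool" where
  "irreducible_kernel s \<longleftrightarrow>
     (\<forall>z\<in>ball 0 1. \<forall>w\<in>ball 0 1. s z w \<noteq> 0) \<and>
     (\<forall>z\<in>ball 0 1. \<forall>w\<in>ball 0 1. z \<noteq> w \<longrightarrow>
        (\<forall>p q. (\<forall>x\<in>ball 0 1. p * s x z + q * s x w = 0) \<longrightarrow> p = 0 \<and> q = 0))"

definition unitarily_invariant_CNP ::
    "(complex ^ 'd::finite \<Rightarrow> complex ^ 'd \<Rightarrow> complex) \<Rightarrow> (nat \<Rightarrow> real) \<Rightarrow> bool" where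
  "unitarily_invariant_CNP s a \<longleftrightarrow>
     a 0 = 1 \<and> (\<forall>n. a n > 0) \<and>
     (\<forall>z\<in>ball 0 1. \<forall>w\<in>ball 0 1.
        (\<lambda>n. complex_of_real (a n) * (\<Sum>i\<in>UNIV. z $ i * cnj (w $ i)) ^ n) sums s z w) \<and>
     irreducible_kernel s \<and> complete_pick s a"

definition cnp_coeff :: "(nat \<Rightarrow> real) \<Rightarrow> nat \<Rightarrow> real" where
  "cnp_coeff a n = fps_nth (1 - inverse (Abs_fps a)) n"

section \<open>$1/s$-contractions and the characteristic function\<close>

abbreviation b_coeff :: "(nat \<Rightarrow> real) \<Rightarrow> 'd::finite multi_index \<Rightarrow> real" where
  "b_coeff a \<equiv> multi_coeff (cnp_coeff a)"

text \<open>Series over non-zero multi-indices are unordered sums in the norm of the Hilbert space; for a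
  series of operators, applied to each vector, this is strong convergence.\<close>

definition row_term ::
    "(nat \<Rightarrow> real) \<Rightarrow> ('d::finite \<Rightarrow> 'h::chilbert_space \<Rightarrow> 'h) \<Rightarrow> 'h \<Rightarrow> 'd nonzero_index \<Rightarrow> 'h" where
  "row_term a T h \<alpha> = b_coeff a (index_of \<alpha>) *\<^sub>R
     op_monomial T (index_of \<alpha>) (cadjoint (op_monomial T (index_of \<alpha>)) h)"

definition one_minus_row :: "(nat \<Rightarrow> real) \<Rightarrow> ('d::finite \<Rightarrow> 'h::chilbert_space \<Rightarrow> 'h) \<Rightarrow> 'h \<Rightarrow> 'h" where
  "one_minus_row a T h = h - (\<Sum>\<^sub>\<infinity>\<alpha>. row_term a T h \<alpha>)"

definition s_contraction :: "(nat \<Rightarrow> real) \<Rightarrow> ('d::finite \<Rightarrow> 'h::chilbert_space \<Rightarrow> 'h) \<Rightarrow> bool" where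
  "s_contraction a T \<longleftrightarrow>
     (\<forall>i. bounded_op UNIV UNIV (T i)) \<and> (\<forall>i j. T i \<circ> T j = T j \<circ> T i) \<and>
     (\<forall>h. row_term a T h summable_on UNIV) \<and> positive_op (one_minus_row a T)"

definition defect :: "(nat \<Rightarrow> real) \<Rightarrow> ('d::finite \<Rightarrow> 'h::chilbert_space \<Rightarrow> 'h) \<Rightarrow> 'h \<Rightarrow> 'h" where
  "defect a T = positive_sqrt (one_minus_row a T)"

definition defect_space :: "(nat \<Rightarrow> real) \<Rightarrow> ('d::finite \<Rightarrow> 'h::chilbert_space \<Rightarrow> 'h) \<Rightarrow> 'h set" where
  "defect_space a T = closure (range (defect a T))"

definition V_op ::
    "(nat \<Rightarrow> real) \<Rightarrow> ('d::finite \<Rightarrow> 'h::chilbert_space \<Rightarrow> 'h) \<Rightarrow> 'h \<Rightarrow> complex ^ 'd \<Rightarrow> 'h" where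
  "V_op a T h z = (if z \<in> ball 0 1
     then \<Sum>\<^sub>\<infinity>\<alpha>. (complex_of_real (multi_coeff a \<alpha>) * monomial z \<alpha>) *\<^sub>C
            defect a T (cadjoint (op_monomial T \<alpha>) h)
     else 0)"

definition Z_op ::
    "(nat \<Rightarrow> real) \<Rightarrow> complex ^ 'd::finite \<Rightarrow> ('d nonzero_index, 'h::chilbert_space) hsum \<Rightarrow> 'h" where
  "Z_op a z h = (\<Sum>\<^sub>\<infinity>\<alpha>. (complex_of_real (sqrt (b_coeff a (index_of \<alpha>))) * monomial z (index_of \<alpha>)) *\<^sub>C
     hsum_nth h \<alpha>)"

definition T_tilde ::
    "(nat \<Rightarrow> real) \<Rightarrow> ('d::finite \<Rightarrow> 'h::chilbert_space \<Rightarrow> 'h) \<Rightarrow> ('d nonzero_index, 'h) hsum \<Rightarrow> 'h" where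
  "T_tilde a T h = (\<Sum>\<^sub>\<infinity>\<alpha>. sqrt (b_coeff a (index_of \<alpha>)) *\<^sub>R op_monomial T (index_of \<alpha>) (hsum_nth h \<alpha>))"

definition D_tilde ::
    "(nat \<Rightarrow> real) \<Rightarrow> ('d::finite \<Rightarrow> 'h::chilbert_space \<Rightarrow> 'h)
      \<Rightarrow> ('d nonzero_index, 'h) hsum \<Rightarrow> ('d nonzero_index, 'h) hsum" where
  "D_tilde a T = positive_sqrt (\<lambda>h. h - cadjoint (T_tilde a T) (T_tilde a T h))"

definition D_tilde_space ::
    "(nat \<Rightarrow> real) \<Rightarrow> ('d::finite \<Rightarrow> 'h::chilbert_space \<Rightarrow> 'h) \<Rightarrow> ('d nonzero_index, 'h) hsum set" where
  "D_tilde_space a T = closure (range (D_tilde a T))"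

definition char_fun ::
    "(nat \<Rightarrow> real) \<Rightarrow> ('d::finite \<Rightarrow> 'h::chilbert_space \<Rightarrow> 'h) \<Rightarrow> complex ^ 'd
      \<Rightarrow> ('d nonzero_index, 'h) hsum \<Rightarrow> 'h" where
  "char_fun a T z x = - T_tilde a T x +
     defect a T (inv (\<lambda>h. h - Z_op a z (cadjoint (T_tilde a T) h)) (Z_op a z (D_tilde a T x)))"

end

theory Submission
  imports Defs "HOL-Library.Function_Algebras"
begin

text \<open>Write $R$ for $\tilde T$ and $D$ for its defect operator. The theorem says that the row operator
  $(h, f) \mapsto V_T h + \theta_T f$ is a contraction and a coisometry. Both parts come from one fact: the operator
  matrix with rows $(R^*, D)$ and $(\Delta, -R)$ is unitary (\<open>colligation_isometry\<close>), and $V_T h + \theta_T f$ is the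
  output $g$ of the linear system
  $$u = h + Z x, \qquad x = R^* u + D f, \qquad g = \Delta u - R f$$
  that it defines, where $Z$ is multiplication by the row of the functions $b_\beta^{1/2} z^\beta$.

  Contractivity is an energy balance: $\|g\|^2 + \|x\|^2 = \|u\|^2 + \|f\|^2$ and $\|u\|^2 \le \|h\|^2 + \|x\|^2$, because
  $Z$ is a row contraction on $H_s$. In terms of coefficients the latter is the Cauchy-Schwarz inequality combined with the
  renewal equation $a_\alpha = \sum_{0 \ne \beta \le \alpha} b_\beta a_{\alpha - \beta}$, which is $s = 1 + (1 - 1/s) s$.
  Since $Z$ raises the degree, the balance can be drawn up for the terms of degree at most $n$, where all sums are finite,
  and $\|x\|$ can be cancelled before anything is known about convergence (\<open>system_energy\<close>). With weights
  $\rho^{2|\alpha|}$ the same balance bounds $x$ itself, so that the coefficientwise solution converges in the ball to the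
  solution at each point (\<open>system_point\<close>).

  For the coisometry, fix a point $z$ and a vector $e$. The inverse of the unitary matrix turns $e$ into vectors
  $y = (I - R Z^*)^{-1} \Delta e$ and $p = \theta_T(z)^* e$. Running the system with initial vector $y$ and input
  $s(\cdot, z) p$ returns the kernel function: $V_T y + \theta_T\, s(\cdot, z) p = s(\cdot, z) e$
  (\<open>kernel_decomposition\<close>). Pairing an arbitrary $f$ with both sides gives
  $\langle f(z), e\rangle = \langle (V_T V_T^* f + M_\theta M_\theta^* f)(z), e\rangle$.

  All of this presupposes $b_n \ge 0$, which is the theorem of McCullough and Quiggin that a complete Pick kernel has a
  positive $1 - 1/s$ (\<open>cnp_coeff_nonneg\<close>). Here only row-valued interpolation at the vertices of small regular polygons
  enters; the proof is by induction on $n$, with $(b_k^{1/2} z^k)_{k \le n}$ as the row to be interpolated.\<close>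

section \<open>Unordered sums\<close>

lemma abs_summable_has_sum:
  fixes f :: "'i \<Rightarrow> 'a::banach"
  shows "(\<lambda>i. norm (f i)) summable_on I \<Longrightarrow> (f has_sum infsum f I) I"
  by (rule has_sum_infsum, rule Infinite_Sum.abs_summable_summable)

text \<open>Sums may be grouped along the finite fibres of any map; Cauchy products are the fibres of addition.\<close>

lemma has_sum_finite_fibres:
  fixes f :: "'a \<Rightarrow> 'b::banach"
  assumes f: "(f has_sum S) UNIV" and fin: "\<And>k. finite {i. p i = k}"
  shows "((\<lambda>k. \<Sum>i | p i = k. f i) has_sum S) UNIV"
proof (rule has_sum_SigmaD)
  have "bij_betw (\<lambda>i. (p i, i)) UNIV (Sigma UNIV (\<lambda>k. {i. p i = k}))"
    by (auto simp: bij_betw_def inj_on_def)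
  from has_sum_reindex_bij_betw[OF this, of "\<lambda>(k, i). f i" S] f
  show "((\<lambda>(k, i). f i) has_sum S) (Sigma UNIV (\<lambda>k. {i. p i = k}))"
    by simp
  show "((\<lambda>i. case (k, i) of (k, i) \<Rightarrow> f i) has_sum (\<Sum>i | p i = k. f i)) {i. p i = k}" for k
    using fin by (auto intro: has_sum_finiteI)
qed

lemma summable_on_times:
  fixes f :: "'a \<Rightarrow> real" and g :: "'b \<Rightarrow> real"
  assumes "f summable_on UNIV" "g summable_on UNIV" "\<And>x. f x \<ge> 0" "\<And>y. g y \<ge> 0"
  shows "(\<lambda>(x, y). f x * g y) summable_on UNIV"
proof -
  have "(\<lambda>(x, y). f x * g y) summable_on Sigma UNIV (\<lambda>_. UNIV)"
    by (rule summable_on_SigmaI[where g = "\<lambda>x. f x * infsum g UNIV"])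
      (use assms in \<open>auto intro!: has_sum_cmult_right summable_on_cmult_left has_sum_infsum\<close>)
  then show ?thesis by simp
qed

lemma has_sum_diff:
  fixes f g :: "'a \<Rightarrow> 'b::real_normed_vector"
  shows "(f has_sum S) A \<Longrightarrow> (g has_sum S') A \<Longrightarrow> ((\<lambda>x. f x - g x) has_sum (S - S')) A"
  using has_sum_add[of f A S "\<lambda>x. - g x" "- S'"] by (simp add: has_sum_uminus)

section \<open>Complex Hilbert spaces\<close>

abbreviation bounded_clinear :: "('a::chilbert_space \<Rightarrow> 'b::chilbert_space) \<Rightarrow> bool" where
  "bounded_clinear \<equiv> bounded_op UNIV UNIV"

lemma scaleC_one [simp]: "1 *\<^sub>C x = x"
  using scaleC_of_real[of 1 x] by simp

lemma scaleC_zero_left [simp]: "0 *\<^sub>C x = 0"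
  using scaleC_of_real[of 0 x] by simp

lemma scaleC_minus_one: "(-1) *\<^sub>C x = - x"
  using scaleC_of_real[of "-1" x] by simp

lemma scaleC_scaleR: "c *\<^sub>C (r *\<^sub>R x) = r *\<^sub>R (c *\<^sub>C x)"
  by (simp add: scaleC_of_real[symmetric] scaleC_scaleC mult.commute)

lemma scaleR_scaleC: "r *\<^sub>R (c *\<^sub>C x) = (of_real r * c) *\<^sub>C x"
  by (simp add: scaleC_of_real[symmetric] scaleC_scaleC)

lemma cinner_zero_left [simp]: "cinner 0 y = 0"
  using cinner_scaleC_left[of 0 0 y] by simp

lemma cinner_zero_right [simp]: "cinner x 0 = 0"
  using cinner_scaleC_right[of x 0 0] by simp

lemma cinner_scaleR_left: "cinner (r *\<^sub>R x) y = of_real r * cinner x y"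
  by (simp add: scaleC_of_real[symmetric] cinner_scaleC_left)

lemma cinner_scaleR_right: "cinner x (r *\<^sub>R y) = of_real r * cinner x y"
  by (simp add: scaleC_of_real[symmetric] cinner_scaleC_right)

lemma norm_add_sq:
  "(norm (x + y))\<^sup>2 = (norm x)\<^sup>2 + (norm y)\<^sup>2 + 2 * Re (cinner x y)" for x y :: "'a::chilbert_space"
proof -
  have "complex_of_real ((norm (x + y))\<^sup>2) = cinner (x + y) (x + y)"
    by (rule cinner_self[symmetric])
  also have "\<dots> = cinner x x + cinner y y + (cinner x y + cnj (cinner x y))"
    by (simp add: cinner_add_left cinner_add_right cinner_commute[of x y])
  also have "\<dots> = complex_of_real ((norm x)\<^sup>2 + (norm y)\<^sup>2 + 2 * Re (cinner x y))"
    by (simp add: cinner_self complex_add_cnj)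
  finally show ?thesis
    by (simp only: of_real_eq_iff)
qed

lemma cauchy_schwarz: "cmod (cinner x y) \<le> norm x * norm y" for x y :: "'a::chilbert_space"
proof (cases "x = 0 \<or> y = 0")
  case False
  \<comment> \<open>rescaling by \<open>t\<close> makes the two squares in \<open>cinner_bound\<close> equal\<close>
  define t where "t = sqrt (norm y / norm x)"
  have t: "t > 0" "t\<^sup>2 = norm y / norm x"
    using False by (auto simp: t_def)
  have "cinner (t *\<^sub>R x) ((1 / t) *\<^sub>R y) = cinner x y"
    using t by (simp add: cinner_scaleR_left cinner_scaleR_right)
  then have "2 * cmod (cinner x y) \<le> (norm (t *\<^sub>R x))\<^sup>2 + (norm ((1 / t) *\<^sub>R y))\<^sup>2"
    using cinner_bound[of "t *\<^sub>R x" "(1 / t) *\<^sub>R y"] by simp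
  also have "\<dots> = t\<^sup>2 * (norm x)\<^sup>2 + (norm y)\<^sup>2 / t\<^sup>2"
    using t by (simp add: power_mult_distrib power_divide)
  also have "\<dots> = 2 * (norm x * norm y)"
    unfolding t(2) using False by (simp add: power2_eq_square)
  finally show ?thesis by simp
qed auto

lemma bounded_bilinear_cinner: "bounded_bilinear (cinner :: 'a::chilbert_space \<Rightarrow> 'a \<Rightarrow> complex)"
  by standard (auto simp: cinner_add_left cinner_add_right cinner_scaleR_left cinner_scaleR_right
      scaleR_conv_of_real intro!: exI[of _ 1] cauchy_schwarz)

interpretation cinner: bounded_bilinear "cinner :: 'a::chilbert_space \<Rightarrow> 'a \<Rightarrow> complex"
  by (rule bounded_bilinear_cinner)

lemma bounded_bilinear_scaleC: "bounded_bilinear (scaleC :: complex \<Rightarrow> 'a::chilbert_space \<Rightarrow> 'a)"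
proof
  show "\<exists>K. \<forall>a b. norm (a *\<^sub>C b :: 'a) \<le> norm a * norm b * K"
    by (intro exI[of _ 1]) (simp add: norm_scaleC)
qed (auto simp: scaleC_add_right scaleC_add_left scaleC_scaleR scaleR_scaleC scaleR_conv_of_real)

interpretation scaleC: bounded_bilinear "scaleC :: complex \<Rightarrow> 'a::chilbert_space \<Rightarrow> 'a"
  by (rule bounded_bilinear_scaleC)

lemma Re_cinner_self [simp]: "Re (cinner x x) = (norm x)\<^sup>2"
  by (simp add: cinner_self)

lemma norm_diff_sq:
  "(norm (x - y))\<^sup>2 = (norm x)\<^sup>2 + (norm y)\<^sup>2 - 2 * Re (cinner x y)" for x y :: "'a::chilbert_space"
  using norm_add_sq[of x "- y"] by (simp add: cinner.minus_right)

lemma cinner_eq_0_all: "(\<And>u. cinner u x = 0) \<Longrightarrow> x = 0"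
  by (metis Re_cinner_self norm_eq_zero power_eq_0_iff zero_complex.sel(1))

subsection \<open>Bounded linear operators\<close>

text \<open>Continuity and interchange with infinite sums are thereby reduced to \<open>bounded_linear\<close>.\<close>

lemma bounded_clinear_iff:
  "bounded_clinear A \<longleftrightarrow> bounded_linear A \<and> (\<forall>c x. A (c *\<^sub>C x) = c *\<^sub>C A x)"
proof
  assume A: "bounded_clinear A"
  then obtain K where K: "\<forall>x. norm (A x) \<le> K * norm x"
    unfolding bounded_op_def by blast
  have "A (r *\<^sub>R x) = r *\<^sub>R A x" for r x
    using A by (simp add: bounded_op_def flip: scaleC_of_real)
  then have "bounded_linear A"
    by (intro bounded_linear_intro[where K = K])
      (use A K in \<open>auto simp: bounded_op_def mult.commute\<close>)
  then show "bounded_linear A \<and> (\<forall>c x. A (c *\<^sub>C x) = c *\<^sub>C A x)"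
    using A by (simp add: bounded_op_def)
next
  assume A: "bounded_linear A \<and> (\<forall>c x. A (c *\<^sub>C x) = c *\<^sub>C A x)"
  then obtain K where "\<forall>x. norm (A x) \<le> norm x * K"
    using bounded_linear.bounded by blast
  then show "bounded_clinear A"
    using A by (auto simp: bounded_op_def linear_simps mult.commute intro!: exI[of _ K])
qed

lemma bounded_clinear_linear: "bounded_clinear A \<Longrightarrow> bounded_linear A"
  by (simp add: bounded_clinear_iff)

lemma bounded_clinear_scaleC: "bounded_clinear A \<Longrightarrow> A (c *\<^sub>C x) = c *\<^sub>C A x"
  by (simp add: bounded_clinear_iff)

lemma clinear:
  assumes "bounded_clinear A"
  shows "A (x + y) = A x + A y" "A (x - y) = A x - A y" "A 0 = 0" "A (- x) = - A x"
    "A (r *\<^sub>R x) = r *\<^sub>R A x" "A (c *\<^sub>C x) = c *\<^sub>C A x"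
  using linear_simps[OF bounded_clinear_linear[OF assms]] bounded_clinear_scaleC[OF assms] by auto

lemma has_sum_clinear:
  "bounded_clinear A \<Longrightarrow> (f has_sum S) I \<Longrightarrow> ((\<lambda>i. A (f i)) has_sum A S) I"
  by (rule has_sum_bounded_linear[OF bounded_clinear_linear])

lemma bounded_clinear_id: "bounded_clinear id" "bounded_clinear (\<lambda>x. x)"
  by (auto simp: bounded_clinear_iff id_def)

lemma bounded_clinear_comp:
  "bounded_clinear A \<Longrightarrow> bounded_clinear B \<Longrightarrow> bounded_clinear (\<lambda>x. A (B x))"
  by (auto simp: bounded_clinear_iff intro: bounded_linear_compose)

lemma bounded_clinear_diff:
  "bounded_clinear A \<Longrightarrow> bounded_clinear B \<Longrightarrow> bounded_clinear (\<lambda>x. A x - B x)"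
  by (auto simp: bounded_clinear_iff scaleC.diff_right intro: bounded_linear_sub)

lemma bounded_clinear_funpow:
  fixes A :: "'a::chilbert_space \<Rightarrow> 'a"
  assumes "bounded_clinear A" shows "bounded_clinear (A ^^ n)"
proof (induction n)
  case (Suc n)
  then show ?case using bounded_clinear_comp[OF assms Suc.IH] by (simp add: comp_def)
qed (use bounded_clinear_id in simp)

subsection \<open>The Riesz representation theorem and adjoints\<close>

definition closed_csubspace :: "'a::chilbert_space set \<Rightarrow> bool" where
  "closed_csubspace E \<longleftrightarrow> closed E \<and> 0 \<in> E \<and> (\<forall>x\<in>E. \<forall>y\<in>E. x + y \<in> E) \<and> (\<forall>c. \<forall>x\<in>E. c *\<^sub>C x \<in> E)"

lemma closed_csubspaceD:
  assumes "closed_csubspace E"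
  shows "closed E" "0 \<in> E" "x \<in> E \<Longrightarrow> y \<in> E \<Longrightarrow> x + y \<in> E" "x \<in> E \<Longrightarrow> c *\<^sub>C x \<in> E"
    "x \<in> E \<Longrightarrow> r *\<^sub>R x \<in> E" "x \<in> E \<Longrightarrow> - x \<in> E" "x \<in> E \<Longrightarrow> y \<in> E \<Longrightarrow> x - y \<in> E"
proof -
  show *: "closed E" "0 \<in> E" "\<And>x y. x \<in> E \<Longrightarrow> y \<in> E \<Longrightarrow> x + y \<in> E" "\<And>c x. x \<in> E \<Longrightarrow> c *\<^sub>C x \<in> E"
    using assms by (auto simp: closed_csubspace_def)
  show "x \<in> E \<Longrightarrow> r *\<^sub>R x \<in> E" using *(4)[of x "of_real r"] by (simp add: scaleC_of_real)
  show **: "\<And>x. x \<in> E \<Longrightarrow> - x \<in> E" using *(4)[of _ "-1"] by (simp add: scaleC_minus_one)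
  show "x \<in> E \<Longrightarrow> y \<in> E \<Longrightarrow> x - y \<in> E" using *(3)[of x "- y"] **[of y] by simp
qed

lemma closed_csubspace_UNIV: "closed_csubspace UNIV"
  by (simp add: closed_csubspace_def)

lemma closed_csubspace_sum:
  "closed_csubspace E \<Longrightarrow> (\<And>i. i \<in> I \<Longrightarrow> f i \<in> E) \<Longrightarrow> sum f I \<in> E"
  by (induction I rule: infinite_finite_induct) (auto simp: closed_csubspaceD)

lemma closed_csubspace_has_sum:
  assumes E: "closed_csubspace E" and "\<And>i. i \<in> I \<Longrightarrow> f i \<in> E" and s: "(f has_sum S) I"
  shows "S \<in> E"
proof (rule Lim_in_closed_set)
  show "closed E" by (rule closed_csubspaceD[OF E])
  show "(sum f \<longlongrightarrow> S) (finite_subsets_at_top I)"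
    using s by (simp add: has_sum_def)
  show "\<forall>\<^sub>F F in finite_subsets_at_top I. sum f F \<in> E"
    by (rule eventually_finite_subsets_at_top_weakI) (use assms in \<open>auto intro!: closed_csubspace_sum\<close>)
qed simp

lemma closure_range_subspace:
  assumes A: "bounded_clinear A"
  shows "closed_csubspace (closure (range A))"
  unfolding closed_csubspace_def
proof (intro conjI ballI allI)
  note lin = clinear[OF A]
  show "0 \<in> closure (range A)" using lin(3) closure_subset by (metis rangeI subsetD)
  fix x y assume x: "x \<in> closure (range A)"
  then obtain X where X: "\<And>n. X n \<in> range A" "X \<longlonglongrightarrow> x" by (auto simp: closure_sequential)
  show "x + y \<in> closure (range A)" if y: "y \<in> closure (range A)"
  proof -
    obtain Y where Y: "\<And>n. Y n \<in> range A" "Y \<longlonglongrightarrow> y" using y by (auto simp: closure_sequential)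
    have "X n + Y n \<in> range A" for n
    proof -
      obtain u v where "X n = A u" "Y n = A v" using X(1) Y(1) by blast
      then show ?thesis by (metis lin(1) rangeI)
    qed
    then show ?thesis using tendsto_add[OF X(2) Y(2)] unfolding closure_sequential
      by (intro exI[of _ "\<lambda>n. X n + Y n"] conjI allI)
  qed
  show "c *\<^sub>C x \<in> closure (range A)" for c
  proof -
    have "c *\<^sub>C X n \<in> range A" for n
    proof -
      obtain u where "X n = A u" using X(1) by blast
      then show ?thesis by (metis bounded_clinear_scaleC[OF A] rangeI)
    qed
    moreover have "(\<lambda>n. c *\<^sub>C X n) \<longlonglongrightarrow> c *\<^sub>C x"
      by (rule bounded_linear.tendsto[OF scaleC.bounded_linear_right X(2)])
    ultimately show ?thesis unfolding closure_sequential
      by (intro exI[of _ "\<lambda>n. c *\<^sub>C X n"] conjI allI)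
  qed
qed simp

lemma bounded_linear_closure_range:
  assumes B: "bounded_linear B" and "\<And>h. B (A h) \<in> F" and F: "closed F" and x: "x \<in> closure (range A)"
  shows "B x \<in> F"
proof -
  obtain X where X: "\<And>n. X n \<in> range A" "X \<longlonglongrightarrow> x" using x by (auto simp: closure_sequential)
  then have "B (X n) \<in> F" for n using assms(2) by (metis rangeE)
  then show ?thesis using closed_sequentially[OF F _ bounded_linear.tendsto[OF B X(2)]] by blast
qed

text \<open>A linear functional \<open>\<phi>\<close> is represented by the minimizer of \<open>\<parallel>x\<parallel>\<^sup>2 - 2 Re \<phi> x\<close>, which exists since
  the parallelogram law makes minimizing sequences Cauchy.\<close>

theorem riesz_representation:
  fixes \<phi> :: "'a::chilbert_space \<Rightarrow> complex"
  assumes E: "closed_csubspace E"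
    and add: "\<And>x y. x \<in> E \<Longrightarrow> y \<in> E \<Longrightarrow> \<phi> (x + y) = \<phi> x + \<phi> y"
    and scale: "\<And>c x. x \<in> E \<Longrightarrow> \<phi> (c *\<^sub>C x) = c * \<phi> x"
    and bound: "\<And>x. x \<in> E \<Longrightarrow> cmod (\<phi> x) \<le> K * norm x"
  obtains y where "y \<in> E" "\<And>x. x \<in> E \<Longrightarrow> \<phi> x = cinner x y"
proof -
  note E' = closed_csubspaceD[OF E]
  define J where "J x = (norm x)\<^sup>2 - 2 * Re (\<phi> x)" for x
  define m where "m = Inf (J ` E)"
  have sR: "\<phi> (r *\<^sub>R x) = of_real r * \<phi> x" if "x \<in> E" for r x
    using scale[OF that, of "of_real r"] by (simp add: scaleC_of_real)
  have diff: "\<phi> (x - y) = \<phi> x - \<phi> y" if "x \<in> E" "y \<in> E" for x y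
    using add[of "x - y" y] that E' by simp
  have lower: "J x \<ge> - K\<^sup>2" if "x \<in> E" for x
  proof -
    have "Re (\<phi> x) \<le> K * norm x"
      using bound[OF that] complex_Re_le_cmod[of "\<phi> x"] by linarith
    moreover have "0 \<le> (norm x - K)\<^sup>2" by simp
    ultimately show ?thesis by (simp add: J_def power2_diff mult.commute)
  qed
  have bdd: "bdd_below (J ` E)" using lower by (auto intro!: bdd_belowI)
  have m: "m \<le> J x" if "x \<in> E" for x
    unfolding m_def using that bdd by (intro cInf_lower) auto
  have aux: "D \<le> 2 * (p - 2 * a - m) + 2 * (q - 2 * b - m)"
    if "m \<le> S / 4 - a - b" "S = p + q + 2 * r" "D = p + q - 2 * r" for S D a b p q r :: real
    using that by argo
  have par: "(norm (x - y))\<^sup>2 \<le> 2 * (J x - m) + 2 * (J y - m)" if "x \<in> E" "y \<in> E" for x y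
  proof -
    have "m \<le> J ((1/2) *\<^sub>R (x + y))" using that by (intro m E')
    also have "\<dots> = (norm (x + y))\<^sup>2 / 4 - Re (\<phi> x) - Re (\<phi> y)"
      using that by (simp add: J_def sR E' add power_divide) (simp add: field_simps)
    finally show ?thesis
      using aux[OF _ norm_add_sq[of x y] norm_diff_sq[of x y]] unfolding J_def by blast
  qed
  have "\<exists>x\<in>E. J x < m + e" if "e > 0" for e
    using cInf_lessD[of "J ` E" "m + e"] E'(2) that by (auto simp: m_def)
  then have "\<exists>X. \<forall>n. X n \<in> E \<and> J (X n) < m + 1 / real (Suc n)"
    by (intro choice) (simp add: Bex_def)
  then obtain X where X: "\<And>n. X n \<in> E" "\<And>n. J (X n) < m + 1 / real (Suc n)" by blast
  have "Cauchy X"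
  proof (rule metric_CauchyI)
    fix e :: real assume e: "e > 0"
    obtain N where N: "1 / real (Suc N) < e\<^sup>2 / 4"
      using nat_approx_posE[of "e\<^sup>2 / 4"] e by auto
    have small: "J (X n) - m < e\<^sup>2 / 4" if "n \<ge> N" for n
    proof -
      have "1 / real (Suc n) \<le> 1 / real (Suc N)" using that by (simp add: frac_le)
      then show ?thesis using X(2)[of n] N by linarith
    qed
    have "dist (X i) (X j) < e" if "i \<ge> N" "j \<ge> N" for i j
    proof -
      have "(norm (X i - X j))\<^sup>2 < e\<^sup>2"
        using par[OF X(1) X(1), of i j] small[OF that(1)] small[OF that(2)] by argo
      then show ?thesis using e by (simp add: dist_norm power_less_imp_less_base)
    qed
    then show "\<exists>M. \<forall>i\<ge>M. \<forall>j\<ge>M. dist (X i) (X j) < e" by blast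
  qed
  then obtain y where y: "X \<longlonglongrightarrow> y" using Cauchy_convergent_iff convergent_def by blast
  have yE: "y \<in> E" using closed_sequentially[OF E'(1) _ y] X(1) by blast
  have "(\<lambda>n. \<phi> (X n) - \<phi> y) \<longlonglongrightarrow> 0"
  proof (rule Lim_null_comparison[where g = "\<lambda>n. K * norm (X n - y)"])
    show "\<forall>\<^sub>F n in sequentially. norm (\<phi> (X n) - \<phi> y) \<le> K * norm (X n - y)"
      by (rule always_eventually) (metis diff bound E'(7) X(1) yE)
    show "(\<lambda>n. K * norm (X n - y)) \<longlonglongrightarrow> 0"
      using tendsto_mult_right_zero[OF tendsto_norm_zero[OF LIM_zero[OF y]]] .
  qed
  then have "(\<lambda>n. \<phi> (X n)) \<longlonglongrightarrow> \<phi> y" by (rule LIM_zero_cancel)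
  then have "(\<lambda>n. J (X n)) \<longlonglongrightarrow> J y" unfolding J_def by (intro tendsto_intros y)
  moreover have "(\<lambda>n. m + 1 / real (Suc n)) \<longlonglongrightarrow> m + 0"
    by (intro tendsto_intros LIMSEQ_Suc lim_1_over_n)
  ultimately have Jy: "J y \<le> m"
    using LIMSEQ_le[of "\<lambda>n. J (X n)" "J y" "\<lambda>n. m + 1 / real (Suc n)" "m + 0"]
      X(2)[THEN less_imp_le] by auto
  have re: "Re (\<phi> z) = Re (cinner z y)" if z: "z \<in> E" for z
  proof (rule ccontr)
    assume ne: "Re (\<phi> z) \<noteq> Re (cinner z y)"
    define d where "d = Re (\<phi> z) - Re (cinner z y)"
    define t where "t = d / ((norm z)\<^sup>2 + 1)"
    have "J y \<le> J (y + t *\<^sub>R z)" using Jy m[of "y + t *\<^sub>R z"] E' yE z by auto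
    also have "\<dots> = J y + t\<^sup>2 * (norm z)\<^sup>2 - 2 * t * d"
      using yE z E' by (simp add: J_def norm_add_sq add sR cinner_scaleR_right power_mult_distrib
          cinner_commute[of z y] d_def algebra_simps)
    finally have "2 * t * d \<le> t\<^sup>2 * (norm z)\<^sup>2" by simp
    also have "\<dots> \<le> t\<^sup>2 * ((norm z)\<^sup>2 + 1)" by (simp add: mult_left_mono)
    also have "\<dots> = t * d"
    proof -
      have "((norm z)\<^sup>2 + 1) \<noteq> 0" by (smt (verit) zero_le_power2)
      then show ?thesis by (simp add: t_def power2_eq_square)
    qed
    finally have "t * d \<le> 0" by argo
    moreover have "t * d > 0"
      using ne by (simp add: t_def d_def flip: power2_eq_square)
        (smt (verit) zero_le_power2 divide_pos_pos zero_less_power2)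
    ultimately show False by simp
  qed
  have "\<phi> x = cinner x y" if "x \<in> E" for x
  proof (rule complex_eqI)
    show "Re (\<phi> x) = Re (cinner x y)" by (rule re[OF that])
    have "Re (\<phi> ((-\<i>) *\<^sub>C x)) = Re (cinner ((-\<i>) *\<^sub>C x) y)" by (intro re E' that)
    then show "Im (\<phi> x) = Im (cinner x y)"
      by (simp only: scale[OF that] cinner_scaleC_left) simp
  qed
  then show thesis using that yE by blast
qed

lemma adjoint_ex:
  assumes E: "closed_csubspace E" and A: "bounded_op E UNIV A"
  obtains x where "x \<in> E" "\<And>u. u \<in> E \<Longrightarrow> cinner (A u) y = cinner u x"
proof -
  from A obtain K where K: "\<And>x. x \<in> E \<Longrightarrow> norm (A x) \<le> K * norm x"
    unfolding bounded_op_def by blast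
  show thesis
  proof (rule riesz_representation[OF E, of "\<lambda>u. cinner (A u) y" "K * norm y"])
    fix x assume "x \<in> E"
    then have "cmod (cinner (A x) y) \<le> K * norm x * norm y"
      using cauchy_schwarz[of "A x" y] mult_right_mono[OF K norm_ge_zero, of x y] by simp
    then show "cmod (cinner (A x) y) \<le> K * norm y * norm x" by (simp add: mult_ac)
  qed (use A that in \<open>auto simp: bounded_op_def cinner_add_left cinner_scaleC_left\<close>)
qed

lemma cadjoint_eqI:
  assumes "\<And>u. cinner (A u) y = cinner u x"
  shows "cadjoint A y = x"
  unfolding adjoint_on_def
proof (rule the_equality)
  fix x' assume "x' \<in> UNIV \<and> (\<forall>u\<in>UNIV. cinner (A u) y = cinner u x')"
  then have "cinner u (x' - x) = 0" for u
    using assms by (simp add: cinner.diff_right)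
  then show "x' = x" using cinner_eq_0_all by (metis eq_iff_diff_eq_0)
qed (use assms in auto)

lemma cinner_cadjoint:
  assumes "bounded_clinear A"
  shows "cinner (A u) y = cinner u (cadjoint A y)"
proof -
  obtain x where "\<And>u. cinner (A u) y = cinner u x"
    using adjoint_ex[OF closed_csubspace_UNIV assms] by auto
  then show ?thesis using cadjoint_eqI by metis
qed

lemma cinner_cadjoint_left:
  "bounded_clinear A \<Longrightarrow> cinner (cadjoint A y) u = cinner y (A u)"
  by (metis cinner_cadjoint cinner_commute)

lemma norm_cadjoint_le:
  assumes A: "bounded_clinear A" and K: "\<And>x. norm (A x) \<le> K * norm x" and "K \<ge> 0"
  shows "norm (cadjoint A y) \<le> K * norm y"
proof (cases "cadjoint A y = 0")
  case True
  then show ?thesis using \<open>K \<ge> 0\<close> by simp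
next
  case False
  let ?x = "cadjoint A y"
  have "(norm ?x)\<^sup>2 = Re (cinner (A ?x) y)" using cinner_cadjoint[OF A, of ?x y] by simp
  also have "\<dots> \<le> norm (A ?x) * norm y"
    using cauchy_schwarz[of "A ?x" y] complex_Re_le_cmod[of "cinner (A ?x) y"] by linarith
  also have "\<dots> \<le> K * norm ?x * norm y" by (intro mult_right_mono K) auto
  finally have "norm ?x * norm ?x \<le> norm ?x * (K * norm y)" by (simp add: power2_eq_square mult_ac)
  then show ?thesis using False by (simp add: mult_le_cancel_left)
qed

lemma bounded_clinear_cadjoint:
  assumes A: "bounded_clinear A"
  shows "bounded_clinear (cadjoint A)"
proof -
  obtain K where K: "\<And>x. norm (A x) \<le> K * norm x" using A unfolding bounded_op_def by blast
  show ?thesis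
    unfolding bounded_op_def
  proof (intro conjI ballI allI)
    show "cadjoint A (x + y) = cadjoint A x + cadjoint A y" for x y
      by (rule cadjoint_eqI) (simp add: cinner_add_right cinner_cadjoint[OF A])
    show "cadjoint A (c *\<^sub>C x) = c *\<^sub>C cadjoint A x" for c x
      by (rule cadjoint_eqI) (simp add: cinner_scaleC_right cinner_cadjoint[OF A])
    show "\<exists>K. \<forall>x\<in>UNIV. norm (cadjoint A x) \<le> K * norm x"
    proof (intro exI ballI)
      fix x
      have "norm (A u) \<le> \<bar>K\<bar> * norm u" for u
        using K[of u] mult_right_mono[OF abs_ge_self norm_ge_zero, of K u] by linarith
      then show "norm (cadjoint A x) \<le> \<bar>K\<bar> * norm x" 
        by (intro norm_cadjoint_le[OF A]) auto
    qed
  qed auto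
qed

subsection \<open>Positive operators\<close>

text \<open>Over the complex numbers a real quadratic form polarizes to a Hermitian sesquilinear form.\<close>

lemma positive_op_selfadjoint:
  assumes "positive_op A"
  shows "cinner (A x) y = cinner x (A y)"
proof -
  have A: "bounded_clinear A" and Im0: "Im (cinner (A h) h) = 0" for h
    using assms by (auto simp: positive_op_def complex_nonneg_Reals_iff)
  note lin = clinear[OF A]
  have 1: "Im (cinner (A x) y) + Im (cinner (A y) x) = 0" for x y
    using Im0[of "x + y"] Im0[of x] Im0[of y]
    by (simp add: lin cinner_add_left cinner_add_right)
  have 2: "Re (cinner (A x) y) = Re (cinner (A y) x)"
    using 1[of x "\<i> *\<^sub>C y"] by (simp add: lin cinner_scaleC_left cinner_scaleC_right)
  have "cinner (A x) y = cnj (cinner (A y) x)"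
    using 1[of x y] 2 by (simp add: complex_eq_iff)
  then show ?thesis by (metis cinner_commute)
qed

lemma positive_op_Re_nonneg: "positive_op A \<Longrightarrow> 0 \<le> Re (cinner (A x) x)"
  by (simp add: positive_op_def complex_nonneg_Reals_iff)

lemma positive_op_bounded: "positive_op A \<Longrightarrow> bounded_clinear A"
  by (simp add: positive_op_def)

lemma positive_opI:
  assumes "bounded_clinear A" "\<And>x y. cinner (A x) y = cinner x (A y)" "\<And>x. 0 \<le> Re (cinner (A x) x)"
  shows "positive_op A"
  unfolding positive_op_def complex_nonneg_Reals_iff
proof (intro conjI allI assms)
  fix h show "Im (cinner (A h) h) = 0"
    using assms(2)[of h h] cinner_commute[of h "A h"] by (metis Reals_cnj_iff complex_is_Real_iff)
qed

text \<open>A vector on which the form of a positive operator vanishes minimizes the form, hence lies in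
  the kernel.\<close>

lemma positive_op_form_zero:
  assumes A: "positive_op A" and z: "Re (cinner (A y) y) = 0"
  shows "A y = 0"
proof (rule ccontr)
  assume ne: "A y \<noteq> 0"
  define q where "q = Re (cinner (A (A y)) (A y))"
  define t where "t = (norm (A y))\<^sup>2 / (q + 1)"
  have q: "q \<ge> 0" unfolding q_def by (rule positive_op_Re_nonneg[OF A])
  have t: "t > 0" using ne q by (simp add: t_def)
  note lin = clinear[OF positive_op_bounded[OF A]]
  have "0 \<le> Re (cinner (A (y - t *\<^sub>R A y)) (y - t *\<^sub>R A y))"
    by (rule positive_op_Re_nonneg[OF A])
  also have "\<dots> = t\<^sup>2 * q - 2 * t * (norm (A y))\<^sup>2"
    using z positive_op_selfadjoint[OF A, of "A y" y]
    by (simp add: lin cinner.diff_left cinner.diff_right cinner_scaleR_left cinner_scaleR_right q_def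
        power2_eq_square cinner_self algebra_simps)
  also have "t\<^sup>2 * q \<le> t\<^sup>2 * (q + 1)" by (simp add: mult_left_mono)
  also have "t\<^sup>2 * (q + 1) = t * (norm (A y))\<^sup>2"
    using q by (simp add: t_def power2_eq_square)
  finally have "t * (norm (A y))\<^sup>2 \<le> 0" by simp
  then show False using t ne by (simp add: mult_le_0_iff)
qed

subsection \<open>Square roots\<close>

text \<open>The Taylor coefficients of $1-\sqrt{1-x}$, read off from $2y = x + y^2$ for $y = 1-\sqrt{1-x}$.\<close>

fun sqrt_coeff :: "nat \<Rightarrow> real" where
  "sqrt_coeff n = (if n = 0 then 0 else if n = 1 then 1 / 2
     else (\<Sum>k\<in>{1..<n}. sqrt_coeff k * sqrt_coeff (n - k)) / 2)"

declare sqrt_coeff.simps [simp del]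

lemma sqrt_coeff_conv:
  "(\<Sum>k\<le>n. sqrt_coeff k * sqrt_coeff (n - k)) = 2 * sqrt_coeff n - (if n = 1 then 1 else 0)"
proof -
  have 0: "sqrt_coeff 0 = 0" by (simp add: sqrt_coeff.simps)
  have "(\<Sum>k\<le>n. sqrt_coeff k * sqrt_coeff (n - k)) = (\<Sum>k\<in>{1..<n}. sqrt_coeff k * sqrt_coeff (n - k))"
  proof (rule sum.mono_neutral_right)
    show "\<forall>i\<in>{..n} - {1..<n}. sqrt_coeff i * sqrt_coeff (n - i) = 0"
    proof
      fix i assume "i \<in> {..n} - {1..<n}"
      then have "i = 0 \<or> n - i = 0" by auto
      then show "sqrt_coeff i * sqrt_coeff (n - i) = 0" using 0 by auto
    qed
  qed auto
  also have "\<dots> = 2 * sqrt_coeff n - (if n = 1 then 1 else 0)"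
    by (subst (3) sqrt_coeff.simps) auto
  finally show ?thesis .
qed

lemma sqrt_coeff_nonneg: "sqrt_coeff n \<ge> 0"
proof (induction n rule: less_induct)
  case (less n)
  then show ?case
    by (subst sqrt_coeff.simps) (auto intro!: divide_nonneg_nonneg sum_nonneg mult_nonneg_nonneg)
qed

text \<open>The map $y \mapsto (1 + y^2)/2$ leads from one partial sum to a bound for the next and preserves $y \le 1$.\<close>

lemma sqrt_coeff_partial: "(\<Sum>n\<le>N. sqrt_coeff n) \<le> 1"
proof (induction N)
  case (Suc N)
  let ?c = sqrt_coeff
  have 0: "?c 0 = 0" by (simp add: sqrt_coeff.simps)
  have "2 * (\<Sum>n\<le>Suc N. ?c n) - 1 = (\<Sum>n\<le>Suc N. \<Sum>k\<le>n. ?c k * ?c (n - k))"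
    unfolding sqrt_coeff_conv by (simp add: sum_subtractf sum_distrib_left)
  also have "\<dots> = (\<Sum>(i,j)\<in>{(i,j). i + j \<le> Suc N}. ?c i * ?c j)"
    by (rule sum.triangle_reindex_eq[symmetric])
  also have "\<dots> \<le> (\<Sum>(i,j)\<in>{..N} \<times> {..N}. ?c i * ?c j)"
  proof -
    have fin: "finite {(i,j). i + j \<le> Suc N}"
      by (rule finite_subset[of _ "{..Suc N} \<times> {..Suc N}"]) auto
    have "(\<Sum>(i,j)\<in>{(i,j). i + j \<le> Suc N}. ?c i * ?c j)
        = (\<Sum>(i,j)\<in>{(i,j). i + j \<le> Suc N} \<inter> {..N} \<times> {..N}. ?c i * ?c j)"
    proof (rule sum.mono_neutral_right[OF fin])
      show "\<forall>p\<in>{(i,j). i + j \<le> Suc N} - {(i,j). i + j \<le> Suc N} \<inter> {..N} \<times> {..N}. (case p of (i,j) \<Rightarrow> ?c i * ?c j) = 0"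
      proof (clarify)
        fix i j assume "i + j \<le> Suc N" "(i, j) \<notin> {(i,j). i + j \<le> Suc N} \<inter> {..N} \<times> {..N}"
        then have "i = 0 \<or> j = 0" by auto
        then show "?c i * ?c j = 0" using 0 by auto
      qed
    qed auto
    also have "\<dots> \<le> (\<Sum>(i,j)\<in>{..N} \<times> {..N}. ?c i * ?c j)"
      by (rule sum_mono2) (auto simp: sqrt_coeff_nonneg)
    finally show ?thesis .
  qed
  also have "\<dots> = (\<Sum>n\<le>N. ?c n)\<^sup>2"
    by (simp add: power2_eq_square sum_product sum.cartesian_product)
  also have "\<dots> \<le> 1"
    using Suc by (intro power_le_one sum_nonneg) (auto simp: sqrt_coeff_nonneg)
  finally show ?case by simp
qed (simp add: sqrt_coeff.simps)

lemma sqrt_coeff_summable: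
  "sqrt_coeff summable_on UNIV" "(\<Sum>\<^sub>\<infinity>n. sqrt_coeff n) \<le> 1"
proof -
  have fin: "sum sqrt_coeff F \<le> 1" if "finite F" for F
  proof -
    have "sum sqrt_coeff F \<le> sum sqrt_coeff {..Max (insert 0 F)}"
      using that by (intro sum_mono2) (auto simp: sqrt_coeff_nonneg)
    then show ?thesis using sqrt_coeff_partial order_trans by blast
  qed
  show "sqrt_coeff summable_on UNIV"
    by (rule nonneg_bdd_above_summable_on) (auto intro!: bdd_aboveI2[of _ _ 1] fin simp: sqrt_coeff_nonneg)
  then show "(\<Sum>\<^sub>\<infinity>n. sqrt_coeff n) \<le> 1"
    by (rule infsum_le_finite_sums) (use fin in auto)
qed

definition sqrt_one_minus :: "('a::chilbert_space \<Rightarrow> 'a) \<Rightarrow> 'a \<Rightarrow> 'a" where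
  "sqrt_one_minus X h = h - (\<Sum>\<^sub>\<infinity>n. sqrt_coeff n *\<^sub>R (X ^^ n) h)"

lemma norm_funpow_le:
  fixes X :: "'a::real_normed_vector \<Rightarrow> 'a"
  assumes "\<And>h. norm (X h) \<le> norm h"
  shows "norm ((X ^^ n) h) \<le> norm h"
  by (induction n) (auto intro: order_trans[OF assms])

lemma sqrt_series_abs_summable:
  fixes X :: "'a::chilbert_space \<Rightarrow> 'a"
  assumes X: "\<And>h. norm (X h) \<le> norm h"
  shows "(\<lambda>n. norm (sqrt_coeff n *\<^sub>R (X ^^ n) h)) summable_on UNIV"
proof (rule summable_on_comparison_test)
  show "(\<lambda>n. sqrt_coeff n * norm h) summable_on UNIV"
    by (intro summable_on_cmult_left sqrt_coeff_summable)
qed (auto simp: sqrt_coeff_nonneg intro!: mult_left_mono norm_funpow_le X)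

lemma sqrt_series_summable:
  fixes X :: "'a::chilbert_space \<Rightarrow> 'a"
  assumes X: "\<And>h. norm (X h) \<le> norm h"
  shows "(\<lambda>n. sqrt_coeff n *\<^sub>R (X ^^ n) h) summable_on UNIV"
  by (rule Infinite_Sum.abs_summable_summable) (rule sqrt_series_abs_summable[OF X])

lemma norm_sqrt_series_le:
  fixes X :: "'a::chilbert_space \<Rightarrow> 'a"
  assumes X: "\<And>h. norm (X h) \<le> norm h"
  shows "norm (\<Sum>\<^sub>\<infinity>n. sqrt_coeff n *\<^sub>R (X ^^ n) h) \<le> norm h"
proof -
  have "norm (\<Sum>\<^sub>\<infinity>n. sqrt_coeff n *\<^sub>R (X ^^ n) h) \<le> (\<Sum>\<^sub>\<infinity>n. norm (sqrt_coeff n *\<^sub>R (X ^^ n) h))"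
    by (rule norm_infsum_bound) (rule sqrt_series_abs_summable[OF X])
  also have "\<dots> \<le> (\<Sum>\<^sub>\<infinity>n. sqrt_coeff n * norm h)"
    by (intro infsum_mono sqrt_series_abs_summable X summable_on_cmult_left sqrt_coeff_summable)
      (auto simp: sqrt_coeff_nonneg intro!: mult_left_mono norm_funpow_le X)
  also have "\<dots> = (\<Sum>\<^sub>\<infinity>n. sqrt_coeff n) * norm h"
    by (rule infsum_cmult_left) (simp add: sqrt_coeff_summable)
  also have "\<dots> \<le> 1 * norm h" by (intro mult_right_mono sqrt_coeff_summable) auto
  finally show ?thesis by simp
qed

text \<open>The series only involves powers of \<open>X\<close>, so whatever intertwines two operators intertwines their roots.\<close>

lemma sqrt_one_minus_intertwine:
  assumes X: "\<And>h. norm (X h) \<le> norm h" and Y: "\<And>h. norm (Y h) \<le> norm h"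
    and B: "bounded_linear B" and BX: "\<And>h. B (X h) = Y (B h)"
  shows "B (sqrt_one_minus X h) = sqrt_one_minus Y (B h)"
proof -
  have pow: "B ((X ^^ n) h) = (Y ^^ n) (B h)" for n
    by (induction n) (simp_all add: BX)
  have "B (\<Sum>\<^sub>\<infinity>n. sqrt_coeff n *\<^sub>R (X ^^ n) h) = (\<Sum>\<^sub>\<infinity>n. B (sqrt_coeff n *\<^sub>R (X ^^ n) h))"
    by (rule infsumI[symmetric], rule has_sum_bounded_linear[OF B], rule has_sum_infsum,
        rule sqrt_series_summable[OF X])
  then show ?thesis
    by (simp add: sqrt_one_minus_def linear_simps[OF B] pow)
qed

lemma sqrt_one_minus_bounded:
  assumes X: "\<And>h. norm (X h) \<le> norm h" and X': "bounded_clinear X"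
  shows "bounded_clinear (sqrt_one_minus X)"
proof -
  let ?P = "\<lambda>h. \<Sum>\<^sub>\<infinity>n. sqrt_coeff n *\<^sub>R (X ^^ n) h"
  note pw = bounded_clinear_funpow[OF X']
  have "bounded_clinear ?P"
    unfolding bounded_op_def
  proof (intro conjI ballI allI)
    show "?P (x + y) = ?P x + ?P y" for x y
      by (simp add: clinear[OF pw] scaleR_add_right
          infsum_add sqrt_series_summable[OF X])
    show "?P (c *\<^sub>C x) = c *\<^sub>C ?P x" for c x
      by (simp add: bounded_clinear_scaleC[OF pw] flip: scaleC_scaleR)
        (rule infsumI, rule has_sum_bounded_linear[OF scaleC.bounded_linear_right],
         rule has_sum_infsum, rule sqrt_series_summable[OF X])
    show "\<exists>K. \<forall>x\<in>UNIV. norm (?P x) \<le> K * norm x"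
      by (intro exI[of _ 1]) (use norm_sqrt_series_le[OF X] in auto)
  qed auto
  then show ?thesis
    unfolding sqrt_one_minus_def by (intro bounded_clinear_diff bounded_clinear_id)
qed

text \<open>The Cauchy product of the series \<open>P\<close> with itself is \<open>2 P - X\<close> by the recursion of the coefficients, and
  \<open>(I - P)\<^sup>2 = I - 2 P + P\<^sup>2\<close>.\<close>

lemma sqrt_one_minus_square:
  assumes X: "\<And>h. norm (X h) \<le> norm h" and X': "bounded_clinear X"
  shows "sqrt_one_minus X (sqrt_one_minus X h) = h - X h"
proof -
  let ?c = sqrt_coeff
  define P where "P h = (\<Sum>\<^sub>\<infinity>n. ?c n *\<^sub>R (X ^^ n) h)" for h
  note lin = clinear[OF bounded_clinear_funpow[OF X']]
  have Pd: "P (x - y) = P x - P y" for x y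
    using linear_simps(2)[OF bounded_clinear_linear[OF sqrt_one_minus_bounded[OF X X']], of x y]
    by (simp add: sqrt_one_minus_def P_def algebra_simps)
  let ?f = "\<lambda>(n, m). (?c n * ?c m) *\<^sub>R (X ^^ (n + m)) h"
  have "(\<lambda>x. norm (?f x)) summable_on UNIV"
  proof (rule summable_on_comparison_test)
    have "(\<lambda>(n, m). ?c n * ?c m) summable_on UNIV"
      by (rule summable_on_times) (auto simp: sqrt_coeff_summable sqrt_coeff_nonneg)
    then show "(\<lambda>x. (case x of (n, m) \<Rightarrow> ?c n * ?c m) * norm h) summable_on UNIV"
      by (rule summable_on_cmult_left)
  qed (auto simp: sqrt_coeff_nonneg intro!: mult_left_mono norm_funpow_le X)
  then have sf: "?f summable_on UNIV" by (rule Infinite_Sum.abs_summable_summable)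
  have inner: "((\<lambda>m. ?f (n, m)) has_sum ?c n *\<^sub>R (X ^^ n) (P h)) UNIV" for n
  proof -
    have "((\<lambda>m. ?c n *\<^sub>R (X ^^ n) (?c m *\<^sub>R (X ^^ m) h)) has_sum ?c n *\<^sub>R (X ^^ n) (P h)) UNIV"
      unfolding P_def
      by (intro has_sum_bounded_linear[OF bounded_linear_scaleR_right]
          has_sum_clinear[OF bounded_clinear_funpow[OF X']]
          has_sum_infsum sqrt_series_summable[OF X])
    then show ?thesis by (simp add: lin funpow_add)
  qed
  have "(?f has_sum infsum ?f UNIV) (UNIV \<times> UNIV)"
    using sf by simp
  then have "((\<lambda>n. ?c n *\<^sub>R (X ^^ n) (P h)) has_sum infsum ?f UNIV) UNIV"
    by (rule has_sum_SigmaD) (rule inner)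
  then have 1: "P (P h) = infsum ?f UNIV"
    unfolding P_def[of "P h"] by (rule infsumI)
  have "((\<lambda>k. \<Sum>i | (\<lambda>(n, m). n + m) i = k. ?f i) has_sum infsum ?f UNIV) UNIV"
  proof (rule has_sum_finite_fibres)
    show "(?f has_sum infsum ?f UNIV) UNIV" using sf by simp
    show "finite {i. (\<lambda>(n, m). n + m) i = k}" for k :: nat
      by (rule finite_subset[of _ "{..k} \<times> {..k}"]) auto
  qed
  moreover have "(\<Sum>i | (\<lambda>(n, m). n + m) i = k. ?f i) = 2 *\<^sub>R (?c k *\<^sub>R (X ^^ k) h) - (if k = 1 then X h else 0)" for k
  proof -
    have "(\<Sum>i | (\<lambda>(n, m). n + m) i = k. ?f i) = (\<Sum>i\<le>k. (?c i * ?c (k - i)) *\<^sub>R (X ^^ k) h)"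
      by (rule sum.reindex_bij_witness[of _ "\<lambda>i. (i, k - i)" fst]) auto
    also have "\<dots> = (2 * ?c k - (if k = 1 then 1 else 0)) *\<^sub>R (X ^^ k) h"
      by (simp only: sqrt_coeff_conv flip: scaleR_sum_left)
    finally show ?thesis by (simp add: scaleR_diff_left)
  qed
  ultimately have "((\<lambda>k. 2 *\<^sub>R (?c k *\<^sub>R (X ^^ k) h) - (if k = 1 then X h else 0)) has_sum infsum ?f UNIV) UNIV"
    by simp
  moreover have "((\<lambda>k. 2 *\<^sub>R (?c k *\<^sub>R (X ^^ k) h) - (if k = 1 then X h else 0)) has_sum 2 *\<^sub>R P h - X h) UNIV"
  proof (rule has_sum_diff)
    show "((\<lambda>k. 2 *\<^sub>R (?c k *\<^sub>R (X ^^ k) h)) has_sum 2 *\<^sub>R P h) UNIV"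
      unfolding P_def
      by (intro has_sum_bounded_linear[OF bounded_linear_scaleR_right] has_sum_infsum sqrt_series_summable[OF X])
    show "((\<lambda>k. if k = 1 then X h else 0) has_sum X h) (UNIV :: nat set)"
      by (rule has_sum_finite_neutralI[of "{1}"]) auto
  qed
  ultimately have "P (P h) = 2 *\<^sub>R P h - X h" unfolding 1 by (rule has_sum_unique)
  then show ?thesis
    by (simp add: sqrt_one_minus_def Pd flip: P_def) (simp add: scaleR_2)
qed

lemma sqrt_one_minus_positive:
  assumes X: "\<And>h. norm (X h) \<le> norm h" and X': "bounded_clinear X"
    and sa: "\<And>x y. cinner (X x) y = cinner x (X y)"
  shows "positive_op (sqrt_one_minus X)"
proof (rule positive_opI)
  note s = has_sum_infsum[OF sqrt_series_summable[OF X]]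
  have pow: "cinner ((X ^^ n) x) y = cinner x ((X ^^ n) y)" for n x y
  proof (induction n arbitrary: y)
    case (Suc n)
    then show ?case by (simp add: sa) (simp add: funpow_swap1)
  qed simp
  show "cinner (sqrt_one_minus X x) y = cinner x (sqrt_one_minus X y)" for x y
  proof -
    have "((\<lambda>n. cinner (sqrt_coeff n *\<^sub>R (X ^^ n) x) y) has_sum
        cinner (\<Sum>\<^sub>\<infinity>n. sqrt_coeff n *\<^sub>R (X ^^ n) x) y) UNIV"
      by (rule has_sum_bounded_linear[OF cinner.bounded_linear_left s])
    moreover have "((\<lambda>n. cinner x (sqrt_coeff n *\<^sub>R (X ^^ n) y)) has_sum
        cinner x (\<Sum>\<^sub>\<infinity>n. sqrt_coeff n *\<^sub>R (X ^^ n) y)) UNIV"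
      by (rule has_sum_bounded_linear[OF cinner.bounded_linear_right s])
    ultimately have "cinner (\<Sum>\<^sub>\<infinity>n. sqrt_coeff n *\<^sub>R (X ^^ n) x) y
        = cinner x (\<Sum>\<^sub>\<infinity>n. sqrt_coeff n *\<^sub>R (X ^^ n) y)"
      by (simp add: cinner_scaleR_left cinner_scaleR_right pow has_sum_unique)
    then show ?thesis
      by (simp add: sqrt_one_minus_def cinner.diff_left cinner.diff_right)
  qed
  show "0 \<le> Re (cinner (sqrt_one_minus X x) x)" for x
  proof -
    let ?p = "\<Sum>\<^sub>\<infinity>n. sqrt_coeff n *\<^sub>R (X ^^ n) x"
    have "Re (cinner ?p x) \<le> norm ?p * norm x"
      using cauchy_schwarz[of ?p x] complex_Re_le_cmod[of "cinner ?p x"] by linarith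
    also have "\<dots> \<le> norm x * norm x" by (intro mult_right_mono norm_sqrt_series_le X) auto
    finally show ?thesis by (simp add: sqrt_one_minus_def cinner.diff_left power2_eq_square cinner_self)
  qed
qed (rule sqrt_one_minus_bounded[OF X X'])

text \<open>Any positive square root \<open>S\<close> commutes with its square, hence with the series root \<open>Q\<close>. For
  \<open>y = (S - Q) h\<close> the equation \<open>(S + Q) y = 0\<close> forces \<open>S y = Q y = 0\<close>, so that
  \<open>\<parallel>y\<parallel>\<^sup>2 = \<langle>h, (S - Q) y\<rangle> = 0\<close>.\<close>

theorem positive_sqrt_one_minus:
  assumes X: "\<And>h. norm (X h) \<le> norm h" and X': "bounded_clinear X"
    and sa: "\<And>x y. cinner (X x) y = cinner x (X y)"
  shows "positive_sqrt (\<lambda>h. h - X h) = sqrt_one_minus X"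
  unfolding positive_sqrt_def
proof (rule the_equality)
  let ?Q = "sqrt_one_minus X"
  have Q: "positive_op ?Q" by (rule sqrt_one_minus_positive[OF X X' sa])
  then show "positive_op ?Q \<and> ?Q \<circ> ?Q = (\<lambda>h. h - X h)"
    by (simp add: fun_eq_iff sqrt_one_minus_square[OF X X'])
  fix S assume "positive_op S \<and> S \<circ> S = (\<lambda>h. h - X h)"
  then have S: "positive_op S" and SS: "S (S h) = h - X h" for h
    by (auto simp: fun_eq_iff)
  note Sl = clinear[OF positive_op_bounded[OF S]]
  note Ql = clinear[OF positive_op_bounded[OF Q]]
  have "S (h - X h) = S h - X (S h)" for h
    using SS[of h] SS[of "S h"] by simp
  then have SX: "S (X h) = X (S h)" for h by (simp add: Sl)
  have SQ: "S (?Q h) = ?Q (S h)" for h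
    by (rule sqrt_one_minus_intertwine[OF X X bounded_clinear_linear[OF positive_op_bounded[OF S]] SX])
  show "S = ?Q"
  proof
    fix h
    define y where "y = S h - ?Q h"
    have "S y + ?Q y = 0"
      by (simp add: y_def Sl Ql SQ SS sqrt_one_minus_square[OF X X'])
    then have "Re (cinner (S y) y) + Re (cinner (?Q y) y) = 0"
      by (metis cinner_add_left cinner_zero_left plus_complex.simps(1) zero_complex.simps(1))
    then have "Re (cinner (S y) y) = 0" "Re (cinner (?Q y) y) = 0"
      using positive_op_Re_nonneg[OF S, of y] positive_op_Re_nonneg[OF Q, of y] by linarith+
    then have "S y = 0" "?Q y = 0"
      using positive_op_form_zero S Q by auto
    then have "cinner y y = 0"
      by (subst (1) y_def)
        (simp add: cinner.diff_left positive_op_selfadjoint[OF S] positive_op_selfadjoint[OF Q])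
    then show "S h = ?Q h" by (simp add: cinner_self y_def)
  qed
qed

section \<open>Multinomial coefficients\<close>

abbreviation multi_degree :: "'d::finite multi_index \<Rightarrow> nat" where
  "multi_degree \<alpha> \<equiv> sum \<alpha> UNIV"

abbreviation multinomial :: "'d::finite multi_index \<Rightarrow> real" where
  "multinomial \<equiv> multi_coeff (\<lambda>_. 1)"

definition unit_index :: "'d \<Rightarrow> 'd multi_index" where
  "unit_index i = (\<lambda>j. if j = i then 1 else 0)"

lemma multi_coeff_multinomial: "multi_coeff a \<alpha> = a (multi_degree \<alpha>) * multinomial \<alpha>"
  by (simp add: multi_coeff_def)

lemma multinomial_pos: "multinomial \<alpha> > 0"
  by (simp add: multi_coeff_def prod_pos)

lemma degree_eq_0: "multi_degree \<alpha> = 0 \<longleftrightarrow> \<alpha> = 0"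
  by (auto simp: fun_eq_iff)

lemma degree_add: "multi_degree (\<alpha> + \<beta>) = multi_degree \<alpha> + multi_degree \<beta>"
  by (simp add: sum.distrib)

lemma degree_unit_index: "multi_degree (unit_index i) = 1"
  by (simp add: unit_index_def)

lemma index_diff_add: "\<beta> \<le> \<alpha> \<Longrightarrow> \<alpha> - \<beta> + \<beta> = (\<alpha> :: 'd multi_index)"
  by (auto simp: le_fun_def fun_eq_iff)

lemma degree_diff: "\<beta> \<le> \<alpha> \<Longrightarrow> multi_degree (\<alpha> - \<beta>) = multi_degree \<alpha> - multi_degree (\<beta> :: 'd::finite multi_index)"
  using degree_add[of "\<alpha> - \<beta>" \<beta>] index_diff_add[of \<beta> \<alpha>] by simp

lemma degree_mono: "\<beta> \<le> \<alpha> \<Longrightarrow> multi_degree \<beta> \<le> multi_degree (\<alpha> :: 'd::finite multi_index)"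
  by (auto simp: le_fun_def intro: sum_mono)

lemma unit_index_le: "unit_index i \<le> \<alpha> \<longleftrightarrow> \<alpha> i > 0"
  by (auto simp: unit_index_def le_fun_def)

lemma finite_indices_le: "finite {\<beta>. \<beta> \<le> (\<alpha> :: 'd::finite multi_index)}"
proof (rule finite_subset)
  show "{\<beta>. \<beta> \<le> \<alpha>} \<subseteq> PiE UNIV (\<lambda>i. {..\<alpha> i})" by (auto simp: le_fun_def PiE_def)
qed (auto intro: finite_PiE)

lemma finite_indices_degree_le: "finite {\<alpha> :: 'd::finite multi_index. multi_degree \<alpha> \<le> n}"
proof (rule finite_subset)
  show "{\<alpha>. multi_degree \<alpha> \<le> n} \<subseteq> {\<alpha>. \<alpha> \<le> (\<lambda>_::'d. n)}"
    by (auto simp: le_fun_def) (metis member_le_sum UNIV_I finite_class.finite_UNIV le0 le_trans)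
qed (rule finite_indices_le)

lemma finite_indices_degree: "finite {\<alpha> :: 'd::finite multi_index. multi_degree \<alpha> = n}"
  by (rule finite_subset[OF _ finite_indices_degree_le[of n]]) auto

text \<open>Pascal's rule: a word with content \<open>\<alpha>\<close> arises by prepending a letter.\<close>

lemma multinomial_rec:
  assumes "\<alpha> \<noteq> 0"
  shows "multinomial \<alpha> = (\<Sum>i | \<alpha> i > 0. multinomial (\<alpha> - unit_index i))"
proof -
  let ?n = "multi_degree \<alpha>" and ?P = "\<Prod>i\<in>UNIV. fact (\<alpha> i) :: real"
  have n: "?n > 0" using assms degree_eq_0 by (metis gr0I)
  have P: "?P > 0" by (simp add: prod_pos)
  have step: "multinomial (\<alpha> - unit_index i) = fact (?n - 1) * real (\<alpha> i) / ?P" if "\<alpha> i > 0" for i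
  proof -
    let ?\<gamma> = "\<alpha> - unit_index i"
    have "(\<Prod>j\<in>UNIV. fact (\<alpha> j) :: real) = fact (\<alpha> i) * (\<Prod>j\<in>UNIV - {i}. fact (\<alpha> j))"
      by (rule prod.remove) auto
    also have "(\<Prod>j\<in>UNIV - {i}. fact (\<alpha> j) :: real) = (\<Prod>j\<in>UNIV - {i}. fact (?\<gamma> j))"
      by (rule prod.cong) (auto simp: unit_index_def)
    also have "fact (\<alpha> i) = real (\<alpha> i) * fact (?\<gamma> i)"
      using that by (simp add: unit_index_def fact_reduce)
    also have "real (\<alpha> i) * fact (?\<gamma> i) * (\<Prod>j\<in>UNIV - {i}. fact (?\<gamma> j)) = real (\<alpha> i) * (\<Prod>j\<in>UNIV. fact (?\<gamma> j))"
      by (simp add: prod.remove[of UNIV i])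
    finally have "?P = real (\<alpha> i) * (\<Prod>j\<in>UNIV. fact (?\<gamma> j))" .
    moreover have "multi_degree ?\<gamma> = ?n - 1"
      using that by (subst degree_diff) (simp_all add: unit_index_le degree_unit_index)
    ultimately show ?thesis using that by (simp add: multi_coeff_def)
  qed
  have "(\<Sum>i | \<alpha> i > 0. multinomial (\<alpha> - unit_index i)) = (\<Sum>i | \<alpha> i > 0. fact (?n - 1) * real (\<alpha> i) / ?P)"
    by (intro sum.cong) (auto simp: step)
  also have "\<dots> = (\<Sum>i\<in>UNIV. fact (?n - 1) * real (\<alpha> i) / ?P)"
    by (rule sum.mono_neutral_left) auto
  also have "\<dots> = fact (?n - 1) * real ?n / ?P"
    by (simp add: sum_distrib_left sum_divide_distrib)
  also have "\<dots> = multinomial \<alpha>"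
    using n by (simp add: multi_coeff_def fact_reduce[of ?n] mult.commute)
  finally show ?thesis ..
qed

text \<open>Pascal's rule summed over all words of length \<open>n + 1\<close>, which split into a last letter and a word of length \<open>n\<close>.\<close>

lemma sum_multinomial_Suc:
  fixes f :: "'d::finite multi_index \<Rightarrow> real"
  shows "(\<Sum>\<alpha> | multi_degree \<alpha> = Suc n. multinomial \<alpha> * f \<alpha>)
    = (\<Sum>\<beta> | multi_degree \<beta> = n. multinomial \<beta> * (\<Sum>i\<in>UNIV. f (\<beta> + unit_index i)))"
proof -
  have "(\<Sum>\<alpha> | multi_degree \<alpha> = Suc n. multinomial \<alpha> * f \<alpha>)
      = (\<Sum>\<alpha> | multi_degree \<alpha> = Suc n. \<Sum>i | \<alpha> i > 0. multinomial (\<alpha> - unit_index i) * f \<alpha>)"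
  proof (rule sum.cong)
    fix \<alpha> :: "'d multi_index" assume "\<alpha> \<in> {\<alpha>. multi_degree \<alpha> = Suc n}"
    then have "\<alpha> \<noteq> 0" using degree_eq_0[of \<alpha>] by auto
    then show "multinomial \<alpha> * f \<alpha> = (\<Sum>i | \<alpha> i > 0. multinomial (\<alpha> - unit_index i) * f \<alpha>)"
      by (subst multinomial_rec[of \<alpha>]) (auto simp: sum_distrib_right)
  qed simp
  also have "\<dots> = (\<Sum>(\<alpha>, i)\<in>Sigma {\<alpha>. multi_degree \<alpha> = Suc n} (\<lambda>\<alpha>. {i. \<alpha> i > 0}). multinomial (\<alpha> - unit_index i) * f \<alpha>)"
    by (rule sum.Sigma) (auto simp: finite_indices_degree)
  also have "\<dots> = (\<Sum>(\<beta>, i)\<in>{\<beta>. multi_degree \<beta> = n} \<times> UNIV. multinomial \<beta> * f (\<beta> + unit_index i))"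
  proof (rule sum.reindex_bij_witness[of _ "\<lambda>(\<beta>, i). (\<beta> + unit_index i, i)" "\<lambda>(\<alpha>, i). (\<alpha> - unit_index i, i)"], goal_cases)
    case (1 p)
    then show ?case by (auto simp only: split_beta mem_Sigma_iff mem_Collect_eq unit_index_le[symmetric] fst_conv snd_conv index_diff_add)
  next
    case (2 p)
    then obtain \<alpha> i where p: "p = (\<alpha>, i)" "\<alpha> i > 0" "multi_degree \<alpha> = Suc n" by auto
    have "multi_degree (\<alpha> - unit_index i) = n"
      using p degree_diff[of "unit_index i" \<alpha>] by (simp only: unit_index_le degree_unit_index)
    then show ?case using p(1) by simp
  next
    case (3 p)
    then show ?case by (auto simp: fun_eq_iff)
  next
    case (4 p)
    then obtain \<beta> i where p: "p = (\<beta>, i)" "multi_degree \<beta> = n" by auto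
    have "multi_degree (\<beta> + unit_index i) = Suc n" by (simp only: degree_add degree_unit_index p(2))
    then show ?case using p(1) by (simp only: split mem_Sigma_iff mem_Collect_eq) (simp add: unit_index_def)
  next
    case (5 p)
    then show ?case by (auto simp only: split_beta mem_Sigma_iff mem_Collect_eq unit_index_le[symmetric] fst_conv snd_conv index_diff_add)
  qed
  finally show ?thesis by (simp only: sum.cartesian_product[symmetric] sum_distrib_left)
qed

lemma indices_degree_0: "{\<alpha>. multi_degree \<alpha> = 0} = {0}"
  by (simp only: degree_eq_0 singleton_conv)

lemma multinomial_theorem:
  fixes x :: "'d::finite \<Rightarrow> real"
  shows "(\<Sum>\<alpha> | multi_degree \<alpha> = n. multinomial \<alpha> * (\<Prod>i\<in>UNIV. x i ^ \<alpha> i)) = (\<Sum>i\<in>UNIV. x i) ^ n"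
proof (induction n)
  case 0
  then show ?case unfolding indices_degree_0 by (simp add: multi_coeff_def)
next
  case (Suc n)
  have "(\<Prod>j\<in>UNIV. x j ^ unit_index i j) = x i" for i
    by (simp add: unit_index_def if_distrib[of "\<lambda>k. _ ^ k"] cong: if_cong)
  then show ?case
    unfolding sum_multinomial_Suc
    by (simp add: power_add prod.distrib sum_distrib_left[symmetric] sum_distrib_right[symmetric] Suc flip: mult.assoc)
qed

text \<open>A word of content \<open>\<alpha>\<close> splits uniquely into its first \<open>k\<close> letters and the remaining ones.\<close>

lemma multinomial_vandermonde:
  fixes \<alpha> :: "'d::finite multi_index"
  assumes "k \<le> multi_degree \<alpha>"
  shows "(\<Sum>\<beta> | multi_degree \<beta> = k. multinomial \<beta> * (if \<beta> \<le> \<alpha> then multinomial (\<alpha> - \<beta>) else 0)) = multinomial \<alpha>"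
  using assms
proof (induction k)
  case 0
  have "\<alpha> - 0 = \<alpha>" "0 \<le> \<alpha>" by (auto simp: le_fun_def)
  then show ?case unfolding indices_degree_0 by (simp add: multi_coeff_def)
next
  case (Suc k)
  let ?f = "\<lambda>\<beta>. if \<beta> \<le> \<alpha> then multinomial (\<alpha> - \<beta>) else 0"
  have "(\<Sum>i\<in>UNIV. ?f (\<beta> + unit_index i)) = ?f \<beta>" if deg: "multi_degree \<beta> = k" for \<beta>
  proof -
    have "\<beta> j + unit_index i j \<le> \<alpha> j \<longleftrightarrow> \<beta> j \<le> \<alpha> j \<and> unit_index i j \<le> \<alpha> j - \<beta> j" for i j by arith
    then have le: "\<beta> + unit_index i \<le> \<alpha> \<longleftrightarrow> \<beta> \<le> \<alpha> \<and> (\<alpha> - \<beta>) i > 0" for i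
      using unit_index_le[of i "\<alpha> - \<beta>"] unfolding le_fun_def plus_fun_apply minus_apply by (simp only: all_conj_distrib)
    have minus: "\<alpha> - (\<beta> + unit_index i) = \<alpha> - \<beta> - unit_index i" for i by (auto simp: fun_eq_iff)
    show ?thesis
    proof (cases "\<beta> \<le> \<alpha>")
      case True
      then have nz: "\<alpha> - \<beta> \<noteq> 0"
        using degree_diff[OF True] deg Suc.prems degree_eq_0[of "\<alpha> - \<beta>"] by linarith
      then have "?f \<beta> = (\<Sum>i | (\<alpha> - \<beta>) i > 0. multinomial (\<alpha> - \<beta> - unit_index i))"
        using True by (simp only: multinomial_rec[OF nz] if_True)
      also have "\<dots> = (\<Sum>i\<in>UNIV. ?f (\<beta> + unit_index i))"
        unfolding le minus using True by (intro sum.mono_neutral_cong_left) auto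
      finally show ?thesis ..
    qed (simp only: le simp_thms if_False sum.neutral_const)
  qed
  then show ?case
    unfolding sum_multinomial_Suc using Suc by (simp cong: conj_cong)
qed

section \<open>The renewal equation\<close>

definition below :: "'d::finite multi_index \<Rightarrow> 'd nonzero_index set" where
  "below \<alpha> = {\<beta>. index_of \<beta> \<le> \<alpha>}"

lemma index_of_nonzero: "index_of \<beta> \<noteq> 0"
  using index_of[of \<beta>] by (simp add: zero_fun_def)

lemma inj_index_of: "inj index_of"
  by (simp add: inj_def index_of_inject)

lemma index_of_surj: "\<alpha> \<noteq> 0 \<Longrightarrow> \<exists>\<beta>. index_of \<beta> = \<alpha>"
  using Abs_nonzero_index_inverse[of \<alpha>] by (auto simp: zero_fun_def)

lemma finite_below: "finite (below \<alpha>)"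
  unfolding below_def
  by (rule finite_imageD[OF finite_subset[OF _ finite_indices_le[of \<alpha>]]])
    (auto intro: inj_on_subset[OF inj_index_of])

lemma degree_index_of: "multi_degree (index_of \<beta>) > 0"
  using degree_eq_0 index_of_nonzero by (metis gr0I)

lemma below_0: "below 0 = {}"
  using index_of_nonzero by (auto simp: below_def le_fun_def fun_eq_iff)

lemma degree_diff_below: "\<beta> \<in> below \<alpha> \<Longrightarrow> multi_degree (\<alpha> - index_of \<beta>) < multi_degree \<alpha>"
proof -
  assume "\<beta> \<in> below \<alpha>"
  then have "index_of \<beta> \<le> \<alpha>" by (simp only: below_def mem_Collect_eq)
  then show ?thesis
    using degree_index_of[of \<beta>] degree_mono[of "index_of \<beta>" \<alpha>] degree_diff[of "index_of \<beta>" \<alpha>] by linarith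
qed

lemma has_sum_cauchy_below:
  fixes f :: "'d::finite nonzero_index \<Rightarrow> 'd multi_index \<Rightarrow> 'b::banach"
  assumes "((\<lambda>(\<beta>, \<gamma>). f \<beta> \<gamma>) has_sum S) UNIV"
  shows "((\<lambda>\<alpha>. \<Sum>\<beta>\<in>below \<alpha>. f \<beta> (\<alpha> - index_of \<beta>)) has_sum S) UNIV"
proof -
  let ?p = "\<lambda>(\<beta>, \<gamma>). index_of \<beta> + \<gamma>"
  have bij: "bij_betw (\<lambda>\<beta>. (\<beta>, \<alpha> - index_of \<beta>)) (below \<alpha>) {i. ?p i = \<alpha>}" for \<alpha> :: "'d multi_index"
    by (rule bij_betwI[of _ _ _ fst]) 
      (auto simp: below_def le_fun_def fun_eq_iff, metis le_add1, metis add_diff_cancel_left')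
  have "((\<lambda>\<alpha>. \<Sum>i | ?p i = \<alpha>. (\<lambda>(\<beta>, \<gamma>). f \<beta> \<gamma>) i) has_sum S) UNIV"
    by (rule has_sum_finite_fibres[OF assms]) (use bij finite_below bij_betw_finite in blast)
  then show ?thesis by (simp add: sum.reindex_bij_betw[OF bij, symmetric])
qed

locale invariant_kernel =
  fixes a :: "nat \<Rightarrow> real"
  assumes a_0: "a 0 = 1" and a_pos: "a n > 0"
    and radius: "0 \<le> r \<Longrightarrow> r < 1 \<Longrightarrow> summable (\<lambda>n. a n * r ^ n)"
begin

lemma multi_coeff_pos: "multi_coeff a \<alpha> > 0"
  by (subst multi_coeff_multinomial) (simp add: a_pos multinomial_pos)

lemma multi_coeff_0: "multi_coeff a 0 = 1"
  by (simp add: multi_coeff_def a_0)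

lemma renewal:
  assumes "n > 0"
  shows "a n = (\<Sum>k\<le>n. cnp_coeff a k * a (n - k))"
proof -
  have "(1 - inverse (Abs_fps a)) * Abs_fps a = Abs_fps a - 1"
    by (simp add: left_diff_distrib inverse_mult_eq_1 a_0)
  then have "fps_nth ((1 - inverse (Abs_fps a)) * Abs_fps a) n = fps_nth (Abs_fps a - 1) n" by simp
  then show ?thesis
    using assms by (simp add: fps_mult_nth cnp_coeff_def atLeast0AtMost)
qed

lemma cnp_coeff_0: "cnp_coeff a 0 = 0"
  by (simp add: cnp_coeff_def a_0)

text \<open>The renewal equation of the \<open>a\<^sub>n\<close> is $s = 1 + (1 - 1/s) s$; the convolution of multinomial coefficients
  spreads it over the multi-indices of a given degree.\<close>

lemma multi_renewal:
  fixes \<alpha> :: "'d::finite multi_index"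
  assumes "\<alpha> \<noteq> 0"
  shows "multi_coeff a \<alpha> = (\<Sum>\<beta>\<in>below \<alpha>. b_coeff a (index_of \<beta>) * multi_coeff a (\<alpha> - index_of \<beta>))"
proof -
  let ?g = "\<lambda>\<beta>. b_coeff a \<beta> * multi_coeff a (\<alpha> - \<beta>)"
  have n: "multi_degree \<alpha> > 0" using assms degree_eq_0 by (metis gr0I)
  have "multi_coeff a \<alpha> = (\<Sum>k\<le>multi_degree \<alpha>. cnp_coeff a k * a (multi_degree \<alpha> - k) * multinomial \<alpha>)"
    by (subst multi_coeff_multinomial) (simp add: renewal[OF n] sum_distrib_right)
  also have "\<dots> = (\<Sum>k\<le>multi_degree \<alpha>. \<Sum>\<beta> | \<beta> \<in> {\<beta>. \<beta> \<le> \<alpha>} \<and> multi_degree \<beta> = k. ?g \<beta>)"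
  proof (rule sum.cong)
    fix k assume k: "k \<in> {..multi_degree \<alpha>}"
    then have "cnp_coeff a k * a (multi_degree \<alpha> - k) * multinomial \<alpha> = (\<Sum>\<beta> | multi_degree \<beta> = k.
        cnp_coeff a k * a (multi_degree \<alpha> - k) * (multinomial \<beta> * (if \<beta> \<le> \<alpha> then multinomial (\<alpha> - \<beta>) else 0)))"
      by (subst multinomial_vandermonde[symmetric, of k]) (auto simp: sum_distrib_left)
    also have "\<dots> = (\<Sum>\<beta> | \<beta> \<in> {\<beta>. \<beta> \<le> \<alpha>} \<and> multi_degree \<beta> = k. ?g \<beta>)"
    proof (rule sum.mono_neutral_cong_right)
      fix \<beta> assume "\<beta> \<in> {\<beta>. \<beta> \<in> {\<beta>. \<beta> \<le> \<alpha>} \<and> multi_degree \<beta> = k}"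
      then show "cnp_coeff a k * a (multi_degree \<alpha> - k) * (multinomial \<beta> * (if \<beta> \<le> \<alpha> then multinomial (\<alpha> - \<beta>) else 0)) = ?g \<beta>"
        using degree_diff[of \<beta> \<alpha>]
        by (simp only: multi_coeff_multinomial[of "cnp_coeff a"] multi_coeff_multinomial[of a] mem_Collect_eq if_True mult_ac)
    qed (auto simp: finite_indices_degree)
    finally show "cnp_coeff a k * a (multi_degree \<alpha> - k) * multinomial \<alpha> = (\<Sum>\<beta> | \<beta> \<in> {\<beta>. \<beta> \<le> \<alpha>} \<and> multi_degree \<beta> = k. ?g \<beta>)" .
  qed simp
  also have "\<dots> = (\<Sum>\<beta>\<in>{\<beta>. \<beta> \<le> \<alpha>}. ?g \<beta>)"
    by (rule sum.group) (auto simp: finite_indices_le intro: degree_mono)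
  also have "\<dots> = (\<Sum>\<beta>\<in>index_of ` below \<alpha>. ?g \<beta>)"
  proof (rule sum.mono_neutral_right)
    show "\<forall>\<beta>\<in>{\<beta>. \<beta> \<le> \<alpha>} - index_of ` below \<alpha>. ?g \<beta> = 0"
    proof
      fix \<beta> assume "\<beta> \<in> {\<beta>. \<beta> \<le> \<alpha>} - index_of ` below \<alpha>"
      then have "\<beta> = 0" using index_of_surj[of \<beta>] by (auto simp: below_def)
      then show "?g \<beta> = 0" by (simp add: multi_coeff_def cnp_coeff_0)
    qed
  qed (auto simp: finite_indices_le below_def)
  also have "\<dots> = (\<Sum>\<beta>\<in>below \<alpha>. ?g (index_of \<beta>))"
    by (rule sum.reindex[unfolded comp_def]) (rule inj_on_subset[OF inj_index_of], simp)
  finally show ?thesis .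
qed

lemma norm_monomial_sq: "(cmod (monomial z \<alpha>))\<^sup>2 = (\<Prod>i\<in>UNIV. ((cmod (z $ i))\<^sup>2) ^ \<alpha> i)"
proof -
  have "cmod (monomial z \<alpha>) = (\<Prod>i\<in>UNIV. cmod (z $ i) ^ \<alpha> i)"
    by (simp add: monomial_def norm_power flip: prod_norm)
  then show ?thesis
    by (simp add: prod_power_distrib flip: power_mult) (simp add: mult.commute)
qed

text \<open>By the multinomial theorem the part of degree \<open>n\<close> is $a_n \|z\|^{2n}$.\<close>

lemma kernel_summable:
  fixes z :: "complex ^ 'd::finite"
  assumes z: "z \<in> ball 0 1"
  shows "(\<lambda>\<alpha>. multi_coeff a \<alpha> * (cmod (monomial z \<alpha>))\<^sup>2) summable_on UNIV"
proof (rule nonneg_bdd_above_summable_on)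
  let ?g = "\<lambda>\<alpha>. multi_coeff a \<alpha> * (cmod (monomial z \<alpha>))\<^sup>2"
  let ?r = "(norm z)\<^sup>2"
  have r: "?r = (\<Sum>i\<in>UNIV. (cmod (z $ i))\<^sup>2)"
    by (simp add: norm_vec_def L2_set_def sum_nonneg)
  have "?r < 1" using z by (simp add: power_less_one_iff)
  then have sm: "summable (\<lambda>n. a n * ?r ^ n)" by (intro radius) auto
  show g0: "?g \<alpha> \<ge> 0" for \<alpha> :: "'d multi_index" using multi_coeff_pos[of \<alpha>] by simp
  have "sum ?g F \<le> (\<Sum>n. a n * ?r ^ n)" if F: "finite F" for F
  proof -
    define N where "N = Max (insert 0 (multi_degree ` F))"
    have "sum ?g F \<le> sum ?g {\<alpha>. multi_degree \<alpha> \<le> N}"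
      using F g0 by (intro sum_mono2) (auto simp: N_def finite_indices_degree_le)
    also have "\<dots> = (\<Sum>n\<le>N. \<Sum>\<alpha> | \<alpha> \<in> {\<alpha>. multi_degree \<alpha> \<le> N} \<and> multi_degree \<alpha> = n. ?g \<alpha>)"
      by (rule sum.group[symmetric]) (auto simp: finite_indices_degree_le)
    also have "\<dots> = (\<Sum>n\<le>N. a n * ?r ^ n)"
    proof (rule sum.cong)
      fix n assume "n \<in> {..N}"
      then have "(\<Sum>\<alpha> | \<alpha> \<in> {\<alpha>. multi_degree \<alpha> \<le> N} \<and> multi_degree \<alpha> = n. ?g \<alpha>)
          = (\<Sum>\<alpha> | multi_degree \<alpha> = n. a n * (multinomial \<alpha> * (\<Prod>i\<in>UNIV. ((cmod (z $ i))\<^sup>2) ^ \<alpha> i)))"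
        by (intro sum.cong) (auto simp: multi_coeff_multinomial[of a] norm_monomial_sq)
      then show "(\<Sum>\<alpha> | \<alpha> \<in> {\<alpha>. multi_degree \<alpha> \<le> N} \<and> multi_degree \<alpha> = n. ?g \<alpha>) = a n * ?r ^ n"
        by (simp add: r multinomial_theorem flip: sum_distrib_left)
    qed simp
    also have "\<dots> \<le> (\<Sum>n. a n * ?r ^ n)"
      by (intro sum_le_suminf sm) (auto intro!: mult_nonneg_nonneg simp: less_imp_le[OF a_pos])
    finally show ?thesis .
  qed
  then show "bdd_above (sum ?g ` {F. F \<subseteq> UNIV \<and> finite F})" by (auto intro!: bdd_aboveI2)
qed

end

section \<open>Hilbert space direct sums\<close>

lemma hsum_nth_Abs: "(\<lambda>i. (norm (f i))\<^sup>2) summable_on UNIV \<Longrightarrow> hsum_nth (Abs_hsum f) i = f i"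
  by (simp add: Abs_hsum_inverse)

lemma norm_hsum_sq: "(norm x)\<^sup>2 = (\<Sum>\<^sub>\<infinity>i. (norm (hsum_nth x i))\<^sup>2)"
  by (simp add: norm_hsum_def hsum_norm_def infsum_nonneg)

lemma hsum_norm_has_sum: "((\<lambda>i. (norm (hsum_nth x i))\<^sup>2) has_sum (norm x)\<^sup>2) UNIV"
  unfolding norm_hsum_sq by (intro has_sum_infsum hsum_summable)

lemma cinner_hsum_has_sum: "((\<lambda>i. cinner (hsum_nth x i) (hsum_nth y i)) has_sum cinner x y) UNIV"
  unfolding cinner_hsum_def by (intro has_sum_infsum hsum_cinner_summable)

lemma norm_hsum_nth: "norm (hsum_nth x i) \<le> norm x"
  using norm_hsum_nth_le by (simp add: norm_hsum_def)

lemma bounded_clinear_hsum_nth: "bounded_clinear (\<lambda>x. hsum_nth x i)"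
  by (auto simp: bounded_op_def hsum_nth_simps hsum_nth_scaleC intro!: exI[of _ 1] norm_hsum_nth)

definition hsum_single :: "'i \<Rightarrow> 'e::chilbert_space \<Rightarrow> ('i, 'e) hsum" where
  "hsum_single i v = Abs_hsum (\<lambda>k. if k = i then v else 0)"

lemma hsum_nth_single: "hsum_nth (hsum_single i v) k = (if k = i then v else 0)"
  unfolding hsum_single_def
  by (rule hsum_nth_Abs, rule finite_nonzero_values_imp_summable_on, rule finite_subset[of _ "{i}"]) auto

lemma cinner_hsum_single: "cinner x (hsum_single i v) = cinner (hsum_nth x i) v"
proof -
  have "((\<lambda>k. cinner (hsum_nth x k) (hsum_nth (hsum_single i v) k)) has_sum cinner (hsum_nth x i) v) UNIV"
    by (rule has_sum_finite_neutralI[of "{i}"]) (auto simp: hsum_nth_single)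
  with cinner_hsum_has_sum[of x "hsum_single i v"] show ?thesis by (rule has_sum_unique)
qed

text \<open>A vector differs from the sum of finitely many of its components by the tail of its norm series.\<close>

lemma hsum_has_sum_single: "((\<lambda>i. hsum_single i (hsum_nth x i)) has_sum x) UNIV"
proof -
  have nth: "hsum_nth (\<Sum>i\<in>F. hsum_single i (hsum_nth x i)) k = (if k \<in> F then hsum_nth x k else 0)" if "finite F" for F k
    using that by (induction F rule: finite_induct) (auto simp: hsum_nth_simps hsum_nth_single)
  have "((\<lambda>F. \<Sum>i\<in>F. hsum_single i (hsum_nth x i)) \<longlongrightarrow> x) (finite_subsets_at_top UNIV)"
  proof (rule tendstoI)
    fix e :: real assume e: "e > 0"
    have "(sum (\<lambda>i. (norm (hsum_nth x i))\<^sup>2) \<longlongrightarrow> (norm x)\<^sup>2) (finite_subsets_at_top UNIV)"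
      using hsum_norm_has_sum[of x] by (simp add: has_sum_def)
    then have "\<forall>\<^sub>F F in finite_subsets_at_top UNIV. dist (\<Sum>i\<in>F. (norm (hsum_nth x i))\<^sup>2) ((norm x)\<^sup>2) < e\<^sup>2"
      using e by (intro tendstoD) auto
    moreover have "\<forall>\<^sub>F F in finite_subsets_at_top UNIV. finite (F :: 'a set)"
      by (rule eventually_finite_subsets_at_top_weakI)
    ultimately show "\<forall>\<^sub>F F in finite_subsets_at_top UNIV. dist (\<Sum>i\<in>F. hsum_single i (hsum_nth x i)) x < e"
    proof eventually_elim
      case (elim F)
      let ?d = "x - (\<Sum>i\<in>F. hsum_single i (hsum_nth x i))"
      have "((\<lambda>i. (norm (hsum_nth x i))\<^sup>2 - (if i \<in> F then (norm (hsum_nth x i))\<^sup>2 else 0)) has_sum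
          (norm x)\<^sup>2 - (\<Sum>i\<in>F. (norm (hsum_nth x i))\<^sup>2)) UNIV"
        by (rule has_sum_diff[OF hsum_norm_has_sum]) (rule has_sum_finite_neutralI[of F], use elim in auto)
      moreover have "(norm (hsum_nth x i))\<^sup>2 - (if i \<in> F then (norm (hsum_nth x i))\<^sup>2 else 0) = (norm (hsum_nth ?d i))\<^sup>2" for i
        using elim by (simp add: hsum_nth_simps nth)
      ultimately have "(norm ?d)\<^sup>2 = (norm x)\<^sup>2 - (\<Sum>i\<in>F. (norm (hsum_nth x i))\<^sup>2)"
        using hsum_norm_has_sum[of ?d] has_sum_unique by (metis (no_types, lifting) has_sum_cong)
      also have "\<dots> < e\<^sup>2" using elim by (simp add: dist_real_def)
      finally have "norm ?d < e" using e by (simp add: power_less_imp_less_base)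
      then show ?case by (simp add: dist_norm norm_minus_commute)
    qed
  qed
  then show ?thesis by (simp add: has_sum_def)
qed

subsection \<open>Rows of scalars\<close>

text \<open>Evaluation at a point of the ball and the operator \<open>Z\<close> are both of the form
  $(h_i) \mapsto \sum_i c_i h_i$ with a square summable row $c$.\<close>

definition row_sum :: "('i \<Rightarrow> complex) \<Rightarrow> ('i, 'e::chilbert_space) hsum \<Rightarrow> 'e" where
  "row_sum c F = (\<Sum>\<^sub>\<infinity>i. c i *\<^sub>C hsum_nth F i)"

definition column :: "('i \<Rightarrow> complex) \<Rightarrow> 'e::chilbert_space \<Rightarrow> ('i, 'e) hsum" where
  "column c e = Abs_hsum (\<lambda>i. cnj (c i) *\<^sub>C e)"

text \<open>The scalars $|c_i|$ and the norms of the components form two vectors of the scalar direct sum, and the sum in question is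
  their inner product.\<close>

lemma l2_row:
  fixes F :: "('i, 'e::chilbert_space) hsum"
  assumes c: "(\<lambda>i. (cmod (c i))\<^sup>2) summable_on UNIV"
  shows "(\<lambda>i. norm (c i *\<^sub>C hsum_nth F i)) summable_on UNIV"
    and "(\<Sum>\<^sub>\<infinity>i. norm (c i *\<^sub>C hsum_nth F i)) \<le> sqrt (\<Sum>\<^sub>\<infinity>i. (cmod (c i))\<^sup>2) * norm F"
proof -
  define C N :: "('i, complex) hsum"
    where "C = Abs_hsum (\<lambda>i. of_real (cmod (c i)))" and "N = Abs_hsum (\<lambda>i. of_real (norm (hsum_nth F i)))"
  have nth: "hsum_nth C i = of_real (cmod (c i))" "hsum_nth N i = of_real (norm (hsum_nth F i))" for i
    by (simp_all add: C_def N_def hsum_nth_Abs c hsum_summable)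
  have hs: "((\<lambda>i. complex_of_real (norm (c i *\<^sub>C hsum_nth F i))) has_sum cinner C N) UNIV"
    using cinner_hsum_has_sum[of C N] by (simp add: nth cinner_complex_def norm_scaleC)
  have hr: "((\<lambda>i. norm (c i *\<^sub>C hsum_nth F i)) has_sum Re (cinner C N)) UNIV"
    using has_sum_Re[OF hs] by simp
  then show "(\<lambda>i. norm (c i *\<^sub>C hsum_nth F i)) summable_on UNIV"
    by (rule has_sum_imp_summable)
  have "(\<Sum>\<^sub>\<infinity>i. norm (c i *\<^sub>C hsum_nth F i)) = Re (cinner C N)"
    using hr by (rule infsumI)
  also have "\<dots> \<le> norm C * norm N"
    using cauchy_schwarz[of C N] complex_Re_le_cmod[of "cinner C N"] by linarith
  also have "norm C = sqrt (\<Sum>\<^sub>\<infinity>i. (cmod (c i))\<^sup>2)"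
    by (simp add: norm_hsum_def hsum_norm_def nth)
  also have "norm N = norm F"
    by (simp add: norm_hsum_def hsum_norm_def nth)
  finally show "(\<Sum>\<^sub>\<infinity>i. norm (c i *\<^sub>C hsum_nth F i)) \<le> sqrt (\<Sum>\<^sub>\<infinity>i. (cmod (c i))\<^sup>2) * norm F" .
qed

context
  fixes c :: "'i \<Rightarrow> complex"
  assumes c: "(\<lambda>i. (cmod (c i))\<^sup>2) summable_on UNIV"
begin

lemma row_sum_has_sum: "((\<lambda>i. c i *\<^sub>C hsum_nth F i) has_sum row_sum c F) UNIV"
  unfolding row_sum_def
  by (rule abs_summable_has_sum, rule l2_row(1)[OF c])

lemma norm_row_sum: "norm (row_sum c F) \<le> sqrt (\<Sum>\<^sub>\<infinity>i. (cmod (c i))\<^sup>2) * norm F"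
  unfolding row_sum_def
  by (rule order_trans[OF norm_infsum_bound l2_row(2)]) (intro l2_row c)+

lemma row_sum_bounded: "bounded_clinear (row_sum c)"
  unfolding bounded_op_def
proof (intro conjI ballI allI)
  show "row_sum c (x + y) = row_sum c x + row_sum c y" for x y
  proof (rule has_sum_unique[OF row_sum_has_sum])
    show "((\<lambda>i. c i *\<^sub>C hsum_nth (x + y) i) has_sum row_sum c x + row_sum c y) UNIV"
      using has_sum_add[OF row_sum_has_sum[of x] row_sum_has_sum[of y]]
      by (simp add: hsum_nth_simps scaleC_add_right)
  qed
  show "row_sum c (k *\<^sub>C x) = k *\<^sub>C row_sum c x" for k x
  proof (rule has_sum_unique[OF row_sum_has_sum])
    show "((\<lambda>i. c i *\<^sub>C hsum_nth (k *\<^sub>C x) i) has_sum k *\<^sub>C row_sum c x) UNIV"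
      using has_sum_bounded_linear[OF scaleC.bounded_linear_right[of k] row_sum_has_sum[of x]]
      by (simp add: hsum_nth_scaleC scaleC_scaleC mult.commute)
  qed
  show "\<exists>K. \<forall>x\<in>UNIV. norm (row_sum c x) \<le> K * norm x"
    using norm_row_sum by blast
qed auto

lemma hsum_nth_column: "hsum_nth (column c e) i = cnj (c i) *\<^sub>C e"
  unfolding column_def
  by (intro hsum_nth_Abs) (simp add: norm_scaleC power_mult_distrib summable_on_cmult_left[OF c])

lemma cinner_column: "cinner F (column c e) = cinner (row_sum c F) e"
proof -
  have "((\<lambda>i. cinner (c i *\<^sub>C hsum_nth F i) e) has_sum cinner (row_sum c F) e) UNIV"
    by (rule has_sum_bounded_linear[OF cinner.bounded_linear_left row_sum_has_sum])
  moreover have "((\<lambda>i. cinner (c i *\<^sub>C hsum_nth F i) e) has_sum cinner F (column c e)) UNIV"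
    using cinner_hsum_has_sum[of F "column c e"]
    by (simp add: hsum_nth_column cinner_scaleC_left cinner_scaleC_right)
  ultimately show ?thesis by (rule has_sum_unique[symmetric])
qed

end

lemma has_sum_row_column:
  assumes c: "(\<lambda>i. (cmod (c i))\<^sup>2) summable_on UNIV" and d: "(\<lambda>i. (cmod (d i))\<^sup>2) summable_on UNIV"
  shows "(\<lambda>i. norm (c i * cnj (d i))) summable_on UNIV"
    and "row_sum c (column d e) = (\<Sum>\<^sub>\<infinity>i. c i * cnj (d i)) *\<^sub>C e"
proof -
  show s: "(\<lambda>i. norm (c i * cnj (d i))) summable_on UNIV"
    using l2_row(1)[OF c, of "column d (1 :: complex)"]
    by (simp add: hsum_nth_column[OF d] scaleC_complex_def)
  have "((\<lambda>i. (c i * cnj (d i)) *\<^sub>C e) has_sum (\<Sum>\<^sub>\<infinity>i. c i * cnj (d i)) *\<^sub>C e) UNIV"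
    by (rule has_sum_bounded_linear[OF scaleC.bounded_linear_left abs_summable_has_sum[OF s]])
  moreover have "((\<lambda>i. (c i * cnj (d i)) *\<^sub>C e) has_sum row_sum c (column d e)) UNIV"
    using row_sum_has_sum[OF c, of "column d e"] by (simp add: hsum_nth_column[OF d] scaleC_scaleC)
  ultimately show "row_sum c (column d e) = (\<Sum>\<^sub>\<infinity>i. c i * cnj (d i)) *\<^sub>C e"
    using has_sum_unique by metis
qed

section \<open>Uniqueness of power series coefficients in several variables\<close>

text \<open>The first non-zero coefficient would be the limit at the origin of the series divided by a power of \<open>\<zeta>\<close>.\<close>

lemma power_series_zero_1:
  fixes C :: "nat \<Rightarrow> complex"
  assumes "\<And>\<zeta>. cmod \<zeta> < 1 \<Longrightarrow> (\<lambda>k. C k * \<zeta> ^ k) sums 0"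
  shows "C m = 0"
proof (induction m rule: less_induct)
  case (less m)
  have "(\<lambda>k. C (k + m) * \<zeta> ^ k) sums 0" if "\<zeta> \<noteq> 0" "cmod \<zeta> < 1" for \<zeta>
  proof -
    have "(\<Sum>i<m. C i * \<zeta> ^ i) = 0" using less by (intro sum.neutral) auto
    then have "(\<lambda>k. C (k + m) * \<zeta> ^ (k + m)) sums 0"
      using assms[OF that(2)] by (subst sums_iff_shift) simp
    then have "(\<lambda>k. C (k + m) * \<zeta> ^ (k + m) / \<zeta> ^ m) sums (0 / \<zeta> ^ m)"
      by (rule sums_divide)
    then show ?thesis using that by (simp add: power_add)
  qed
  then have "((\<lambda>_ :: complex. 0) \<longlongrightarrow> C (0 + m)) (at 0)"
    by (intro powser_limit_0_strong[of 1]) auto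
  then show ?case by (simp add: tendsto_const_iff)
qed

lemma monomial_scale_coordinate:
  fixes z :: "complex ^ 'd::finite"
  shows "monomial (\<chi> j. if j = i then \<zeta> * z $ i else z $ j) \<alpha> = \<zeta> ^ \<alpha> i * monomial z \<alpha>"
proof -
  let ?z = "\<chi> j. if j = i then \<zeta> * z $ i else z $ j"
  have "monomial ?z \<alpha> = (?z $ i) ^ \<alpha> i * (\<Prod>j\<in>UNIV - {i}. (?z $ j) ^ \<alpha> j)"
    unfolding monomial_def by (rule prod.remove) auto
  also have "(\<Prod>j\<in>UNIV - {i}. (?z $ j) ^ \<alpha> j) = (\<Prod>j\<in>UNIV - {i}. (z $ j) ^ \<alpha> j)"
    by (rule prod.cong) auto
  also have "(?z $ i) ^ \<alpha> i * \<dots> = \<zeta> ^ \<alpha> i * ((z $ i) ^ \<alpha> i * \<dots>)"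
    by (simp add: power_mult_distrib)
  also have "(z $ i) ^ \<alpha> i * (\<Prod>j\<in>UNIV - {i}. (z $ j) ^ \<alpha> j) = monomial z \<alpha>"
    unfolding monomial_def by (rule prod.remove[symmetric]) auto
  finally show ?thesis .
qed

text \<open>The variables are separated one at a time: scaling one coordinate by \<open>\<zeta>\<close> turns the series into
  a power series in \<open>\<zeta>\<close>, whose coefficients are the parts with a fixed exponent in that variable.\<close>

lemma power_series_zero:
  fixes c :: "'d::finite multi_index \<Rightarrow> complex"
  assumes c: "\<And>z. z \<in> ball 0 1 \<Longrightarrow> ((\<lambda>\<alpha>. monomial z \<alpha> * c \<alpha>) has_sum 0) UNIV"
  shows "c \<gamma> = 0"
proof -
  have *: "((\<lambda>\<alpha>. monomial z \<alpha> * c \<alpha>) has_sum 0) {\<alpha>. \<forall>i\<in>S. \<alpha> i = \<gamma> i}"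
    if z: "z \<in> ball 0 1" and "finite S" for S z
    using that(2,1)
  proof (induction S arbitrary: z rule: finite_induct)
    case empty
    then show ?case using c by simp
  next
    case (insert i S)
    let ?A = "{\<alpha>. \<forall>i\<in>S. \<alpha> i = \<gamma> i}"
    let ?B = "\<lambda>k. {\<alpha>\<in>?A. \<alpha> i = k}"
    let ?C = "\<lambda>k. \<Sum>\<^sub>\<infinity>\<alpha>\<in>?B k. monomial z \<alpha> * c \<alpha>"
    have sB: "((\<lambda>\<alpha>. monomial z \<alpha> * c \<alpha>) has_sum ?C k) (?B k)" for k
    proof (rule has_sum_infsum, rule summable_on_subset_banach)
      show "(\<lambda>\<alpha>. monomial z \<alpha> * c \<alpha>) summable_on ?A"
        using insert.IH[OF insert.prems] by (rule has_sum_imp_summable)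
    qed auto
    have "(\<lambda>k. ?C k * \<zeta> ^ k) sums 0" if \<zeta>: "cmod \<zeta> < 1" for \<zeta>
    proof -
      let ?z = "\<chi> j. if j = i then \<zeta> * z $ i else z $ j"
      have "norm ?z \<le> norm z"
        unfolding norm_vec_def
        by (rule L2_set_mono) (use \<zeta> in \<open>auto simp: norm_mult intro!: mult_left_le_one_le\<close>)
      then have "?z \<in> ball 0 1" using insert.prems by simp
      then have "((\<lambda>\<alpha>. \<zeta> ^ \<alpha> i * monomial z \<alpha> * c \<alpha>) has_sum 0) ?A"
        using insert.IH[of ?z] by (simp only: monomial_scale_coordinate)
      moreover have "bij_betw snd (Sigma UNIV ?B) ?A"
        by (rule bij_betwI[of _ _ _ "\<lambda>\<alpha>. (\<alpha> i, \<alpha>)"]) auto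
      ultimately have "((\<lambda>x. \<zeta> ^ snd x i * monomial z (snd x) * c (snd x)) has_sum 0) (Sigma UNIV ?B)"
        by (simp add: has_sum_reindex_bij_betw[of snd _ _ "\<lambda>\<alpha>. \<zeta> ^ \<alpha> i * monomial z \<alpha> * c \<alpha>"])
      then have "((\<lambda>k. ?C k * \<zeta> ^ k) has_sum 0) UNIV"
      proof (rule has_sum_SigmaD)
        fix k
        have "((\<lambda>\<alpha>. monomial z \<alpha> * c \<alpha> * \<zeta> ^ k) has_sum ?C k * \<zeta> ^ k) (?B k)"
          by (rule has_sum_cmult_left[OF sB])
        then show "((\<lambda>\<alpha>. \<zeta> ^ snd (k, \<alpha>) i * monomial z (snd (k, \<alpha>)) * c (snd (k, \<alpha>))) has_sum ?C k * \<zeta> ^ k) (?B k)"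
          by (rule has_sum_cong[THEN iffD1, rotated]) (auto simp: mult_ac)
      qed
      then show ?thesis by (rule has_sum_imp_sums)
    qed
    then have "?C (\<gamma> i) = 0" by (rule power_series_zero_1)
    moreover have "?B (\<gamma> i) = {\<alpha>. \<forall>i\<in>insert i S. \<alpha> i = \<gamma> i}" by auto
    ultimately show ?case using sB[of "\<gamma> i"] by simp
  qed
  \<comment> \<open>any point of the ball off the coordinate hyperplanes\<close>
  define z :: "complex ^ 'd" where "z = (\<chi> i. of_real (1 / (real CARD('d) + 1)))"
  have "norm z \<le> (\<Sum>i\<in>UNIV. norm (z $ i))"
    unfolding norm_vec_def by (rule L2_set_le_sum) auto
  also have "\<dots> = (\<Sum>i\<in>(UNIV :: 'd set). 1 / (real CARD('d) + 1))"
    unfolding z_def vec_lambda_beta norm_of_real by simp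
  also have "\<dots> < 1" by simp
  finally have "((\<lambda>\<alpha>. monomial z \<alpha> * c \<alpha>) has_sum 0) {\<alpha>. \<forall>i\<in>UNIV. \<alpha> i = \<gamma> i}"
    by (intro *) auto
  moreover have "{\<alpha>. \<forall>i\<in>UNIV. \<alpha> i = \<gamma> i} = {\<gamma>}" by auto
  ultimately have "monomial z \<gamma> * c \<gamma> = 0"
    by (metis (no_types, lifting) finite.emptyI finite.insertI has_sum_finiteI has_sum_unique sum.empty sum.insert
        empty_iff add.right_neutral)
  moreover have "monomial z \<gamma> \<noteq> 0"
    by (simp add: monomial_def z_def of_nat_eq_0_iff flip: of_nat_Suc of_real_add)
  ultimately show ?thesis by simp
qed

lemma power_series_unique:
  fixes c :: "'d::finite multi_index \<Rightarrow> 'e::chilbert_space"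
  assumes "\<And>z. z \<in> ball 0 1 \<Longrightarrow> ((\<lambda>\<alpha>. monomial z \<alpha> *\<^sub>C c \<alpha>) has_sum f z) UNIV"
    and "\<And>z. z \<in> ball 0 1 \<Longrightarrow> ((\<lambda>\<alpha>. monomial z \<alpha> *\<^sub>C c' \<alpha>) has_sum f z) UNIV"
  shows "c = c'"
proof
  fix \<gamma>
  have "cinner (c \<gamma> - c' \<gamma>) (c \<gamma> - c' \<gamma>) = 0"
  proof (rule power_series_zero[of "\<lambda>\<alpha>. cinner (c \<alpha> - c' \<alpha>) (c \<gamma> - c' \<gamma>)"])
    fix z :: "complex ^ 'd" assume z: "z \<in> ball 0 1"
    have "((\<lambda>\<alpha>. cinner (monomial z \<alpha> *\<^sub>C c \<alpha> - monomial z \<alpha> *\<^sub>C c' \<alpha>) (c \<gamma> - c' \<gamma>))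
        has_sum cinner (f z - f z) (c \<gamma> - c' \<gamma>)) UNIV"
      by (rule has_sum_bounded_linear[OF cinner.bounded_linear_left has_sum_diff[OF assms(1)[OF z] assms(2)[OF z]]])
    then show "((\<lambda>\<alpha>. monomial z \<alpha> * cinner (c \<alpha> - c' \<alpha>) (c \<gamma> - c' \<gamma>)) has_sum 0) UNIV"
      by (simp add: cinner_scaleC_left flip: scaleC.diff_right)
  qed
  then show "c \<gamma> = c' \<gamma>" by (simp add: cinner_self)
qed

section \<open>The spaces $H_s \otimes E$ as direct sums\<close>

definition (in invariant_kernel) eval_row :: "complex ^ 'd::finite \<Rightarrow> 'd multi_index \<Rightarrow> complex" where
  "eval_row z \<alpha> = complex_of_real (sqrt (multi_coeff a \<alpha>)) * monomial z \<alpha>"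

text \<open>Vectors of the direct sum are coordinates with respect to the orthonormal basis $a_\alpha^{1/2} z^\alpha$ of \<open>H\<^sub>s\<close>, so
  that the norm of $H_s \otimes E$ becomes that of the direct sum and evaluation at \<open>z\<close> a \<open>row_sum\<close>.\<close>

definition (in invariant_kernel) hs_fun ::
    "('d::finite multi_index, 'e::chilbert_space) hsum \<Rightarrow> complex ^ 'd \<Rightarrow> 'e" where
  "hs_fun F z = (if z \<in> ball 0 1 then row_sum (eval_row z) F else 0)"

definition (in invariant_kernel) kernel :: "complex ^ 'd::finite \<Rightarrow> complex ^ 'd \<Rightarrow> complex" where
  "kernel z w = (\<Sum>\<^sub>\<infinity>\<alpha>. complex_of_real (multi_coeff a \<alpha>) * (monomial z \<alpha> * cnj (monomial w \<alpha>)))"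

definition hs_vectors :: "'e::chilbert_space set \<Rightarrow> ('d::finite multi_index, 'e) hsum set" where
  "hs_vectors E = {F. \<forall>\<alpha>. hsum_nth F \<alpha> \<in> E}"

lemma hs_vectors_subspace:
  assumes E: "closed_csubspace E"
  shows "closed_csubspace (hs_vectors E :: ('d::finite multi_index, 'e::chilbert_space) hsum set)"
proof -
  have "(hs_vectors E :: ('d multi_index, 'e) hsum set) = (\<Inter>\<alpha>. (\<lambda>F. hsum_nth F \<alpha>) -` E)"
    by (auto simp: hs_vectors_def)
  moreover have "closed ((\<lambda>F :: ('d multi_index, 'e) hsum. hsum_nth F \<alpha>) -` E)" for \<alpha>
    by (rule continuous_closed_vimage)
      (auto intro: closed_csubspaceD[OF E] linear_continuous_at bounded_clinear_linear bounded_clinear_hsum_nth)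
  ultimately have "closed (hs_vectors E :: ('d multi_index, 'e) hsum set)" by (simp add: closed_INT)
  then show ?thesis
    by (auto simp: closed_csubspace_def hs_vectors_def hsum_nth_simps hsum_nth_scaleC closed_csubspaceD[OF E])
qed

context invariant_kernel
begin

lemma eval_row_summable: "z \<in> ball 0 1 \<Longrightarrow> (\<lambda>\<alpha>. (cmod (eval_row z \<alpha>))\<^sup>2) summable_on UNIV"
  using kernel_summable[of z]
  by (simp add: eval_row_def norm_mult power_mult_distrib real_sqrt_pow2 less_imp_le[OF multi_coeff_pos])

lemma eval_row_mult_cnj:
  "eval_row z \<alpha> * cnj (eval_row w \<alpha>) = complex_of_real (multi_coeff a \<alpha>) * (monomial z \<alpha> * cnj (monomial w \<alpha>))"
proof -
  have "complex_of_real (sqrt (multi_coeff a \<alpha>)) * complex_of_real (sqrt (multi_coeff a \<alpha>)) = complex_of_real (multi_coeff a \<alpha>)"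
    using less_imp_le[OF multi_coeff_pos[of \<alpha>]] by (simp flip: of_real_mult)
  then show ?thesis by (simp add: eval_row_def mult_ac)
qed

lemma hs_fun_has_sum:
  assumes "z \<in> ball 0 1"
  shows "((\<lambda>\<alpha>. monomial z \<alpha> *\<^sub>C sqrt (multi_coeff a \<alpha>) *\<^sub>R hsum_nth F \<alpha>) has_sum hs_fun F z) UNIV"
  using row_sum_has_sum[OF eval_row_summable[OF assms], of F] assms
  by (simp add: hs_fun_def eval_row_def[abs_def] scaleC_scaleR scaleR_scaleC)

lemma hs_fun_linear:
  "hs_fun (F + G) z = hs_fun F z + hs_fun G z"
  "hs_fun (F - G) z = hs_fun F z - hs_fun G z"
  "hs_fun (k *\<^sub>C F) z = k *\<^sub>C hs_fun F z"
  "hs_fun (\<Sum>i\<in>I. FF i) z = (\<Sum>i\<in>I. hs_fun (FF i) z)"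
  using clinear[OF row_sum_bounded[OF eval_row_summable[of z]]]
    linear_sum[OF bounded_linear.linear[OF bounded_clinear_linear[OF row_sum_bounded[OF eval_row_summable[of z]]]]]
  by (auto simp: hs_fun_def scaleC.zero_right)

lemma hs_expansion_hs_fun: "hs_expansion a (hs_fun F) (\<lambda>\<alpha>. sqrt (multi_coeff a \<alpha>) *\<^sub>R hsum_nth F \<alpha>)"
proof -
  have "(\<lambda>\<alpha>. (norm (sqrt (multi_coeff a \<alpha>) *\<^sub>R hsum_nth F \<alpha>))\<^sup>2 / multi_coeff a \<alpha>) = (\<lambda>\<alpha>. (norm (hsum_nth F \<alpha>))\<^sup>2)"
  proof
    fix \<alpha>
    show "(norm (sqrt (multi_coeff a \<alpha>) *\<^sub>R hsum_nth F \<alpha>))\<^sup>2 / multi_coeff a \<alpha> = (norm (hsum_nth F \<alpha>))\<^sup>2"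
      using multi_coeff_pos[of \<alpha>] by (simp add: power_mult_distrib)
  qed
  then show ?thesis
    using hsum_summable[of F] hs_fun_has_sum[of _ F] by (auto simp: hs_expansion_def hs_fun_def)
qed

lemma hs_expansion_imp_hs_fun:
  assumes "hs_expansion a f c"
  obtains F where "f = hs_fun F" "\<And>\<alpha>. c \<alpha> = sqrt (multi_coeff a \<alpha>) *\<^sub>R hsum_nth F \<alpha>"
proof
  let ?F = "Abs_hsum (\<lambda>\<alpha>. (1 / sqrt (multi_coeff a \<alpha>)) *\<^sub>R c \<alpha>)"
  have "(norm ((1 / sqrt (multi_coeff a \<alpha>)) *\<^sub>R c \<alpha>))\<^sup>2 = (norm (c \<alpha>))\<^sup>2 / multi_coeff a \<alpha>" for \<alpha>
    using multi_coeff_pos[of \<alpha>] by (simp add: power_mult_distrib power_divide)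
  then have "hsum_nth ?F \<alpha> = (1 / sqrt (multi_coeff a \<alpha>)) *\<^sub>R c \<alpha>" for \<alpha>
    using assms by (subst hsum_nth_Abs) (simp_all only: hs_expansion_def)
  then show c: "c \<alpha> = sqrt (multi_coeff a \<alpha>) *\<^sub>R hsum_nth ?F \<alpha>" for \<alpha>
    using multi_coeff_pos[of \<alpha>] by simp
  show "f = hs_fun ?F"
  proof
    fix z
    show "f z = hs_fun ?F z"
    proof (cases "z \<in> ball 0 1")
      case True
      then have "((\<lambda>\<alpha>. monomial z \<alpha> *\<^sub>C c \<alpha>) has_sum f z) UNIV"
        using assms by (auto simp: hs_expansion_def)
      then show ?thesis
        using hs_fun_has_sum[OF True, of ?F] unfolding c[symmetric] by (rule has_sum_unique)
    next
      case False
      then show ?thesis using assms by (auto simp: hs_expansion_def hs_fun_def)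
    qed
  qed
qed

lemma hs_coeff_eq: "hs_expansion a f c \<Longrightarrow> hs_coeff a f = c"
  unfolding hs_coeff_def
  by (rule the_equality) (auto simp: hs_expansion_def intro: power_series_unique)

lemma hs_coeff_hs_fun: "hs_coeff a (hs_fun F) = (\<lambda>\<alpha>. sqrt (multi_coeff a \<alpha>) *\<^sub>R hsum_nth F \<alpha>)"
  by (rule hs_coeff_eq[OF hs_expansion_hs_fun])

lemma hs_fun_eq_iff: "hs_fun F = hs_fun G \<longleftrightarrow> F = G"
proof
  assume "hs_fun F = hs_fun G"
  then have "hs_coeff a (hs_fun F) = hs_coeff a (hs_fun G)" by simp
  then have "sqrt (multi_coeff a \<alpha>) *\<^sub>R hsum_nth F \<alpha> = sqrt (multi_coeff a \<alpha>) *\<^sub>R hsum_nth G \<alpha>" for \<alpha>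
    unfolding hs_coeff_hs_fun by metis
  then have "hsum_nth F \<alpha> = hsum_nth G \<alpha>" for \<alpha>
    using multi_coeff_pos[of \<alpha>] by (metis less_irrefl real_sqrt_eq_zero_cancel_iff scaleR_cancel_left)
  then show "F = G" by (rule hsum_eqI)
qed simp

lemma hs_space_eq:
  assumes E: "closed_csubspace E"
  shows "hs_space a E = hs_fun ` hs_vectors E"
proof (intro set_eqI iffI)
  fix f assume "f \<in> hs_space a E"
  then obtain c where c: "range c \<subseteq> E" "hs_expansion a f c" by (auto simp: hs_space_def)
  then obtain F where F: "f = hs_fun F" "\<And>\<alpha>. c \<alpha> = sqrt (multi_coeff a \<alpha>) *\<^sub>R hsum_nth F \<alpha>"
    using hs_expansion_imp_hs_fun by metis
  have "hsum_nth F \<alpha> \<in> E" for \<alpha>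
  proof -
    have "hsum_nth F \<alpha> = (1 / sqrt (multi_coeff a \<alpha>)) *\<^sub>R c \<alpha>"
      using multi_coeff_pos[of \<alpha>] by (simp add: F)
    then show ?thesis using c(1) closed_csubspaceD(5)[OF E] by (metis rangeI subsetD)
  qed
  then show "f \<in> hs_fun ` hs_vectors E" using F(1) by (auto simp: hs_vectors_def)
next
  fix f assume "f \<in> hs_fun ` hs_vectors E"
  then obtain F where F: "f = hs_fun F" "F \<in> hs_vectors E" by blast
  then show "f \<in> hs_space a E"
    unfolding hs_space_def F(1) using closed_csubspaceD(5)[OF E]
    by (intro CollectI exI[of _ "\<lambda>\<alpha>. sqrt (multi_coeff a \<alpha>) *\<^sub>R hsum_nth F \<alpha>"] conjI hs_expansion_hs_fun)
      (auto simp: hs_vectors_def)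
qed

lemma hs_inner_hs_fun: "hs_inner a (hs_fun F) (hs_fun G) = cinner F G"
proof -
  have "cinner (sqrt (multi_coeff a \<alpha>) *\<^sub>R hsum_nth F \<alpha>) (sqrt (multi_coeff a \<alpha>) *\<^sub>R hsum_nth G \<alpha>)
      / complex_of_real (multi_coeff a \<alpha>) = cinner (hsum_nth F \<alpha>) (hsum_nth G \<alpha>)" for \<alpha>
  proof -
    have "complex_of_real (sqrt (multi_coeff a \<alpha>)) * complex_of_real (sqrt (multi_coeff a \<alpha>)) = complex_of_real (multi_coeff a \<alpha>)"
      using less_imp_le[OF multi_coeff_pos[of \<alpha>]] by (simp flip: of_real_mult)
    then show ?thesis
      using multi_coeff_pos[of \<alpha>] by (simp add: cinner_scaleR_left cinner_scaleR_right flip: mult.assoc)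
  qed
  then show ?thesis
    by (simp add: hs_inner_def hs_coeff_hs_fun cinner_hsum_def)
qed

lemma hs_norm_hs_fun: "hs_norm a (hs_fun F) = norm F"
  by (simp add: hs_norm_def hs_inner_hs_fun)

text \<open>The reproducing property: \<open>column (eval_row w) e\<close> is the function \<open>kernel _ w\<close> times \<open>e\<close>.\<close>

lemma cinner_kernel:
  "w \<in> ball 0 1 \<Longrightarrow> cinner F (column (eval_row w) e) = cinner (hs_fun F w) e"
  by (simp add: hs_fun_def cinner_column eval_row_summable)

lemma hs_fun_kernel:
  assumes "z \<in> ball 0 1" "w \<in> ball 0 1"
  shows "hs_fun (column (eval_row w) e) z = kernel z w *\<^sub>C e"
  using assms has_sum_row_column(2)[OF eval_row_summable[OF assms(1)] eval_row_summable[OF assms(2)], of e]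
  by (simp add: hs_fun_def kernel_def eval_row_mult_cnj)

lemma kernel_abs_summable:
  assumes "z \<in> ball 0 1" "w \<in> ball 0 1"
  shows "(\<lambda>\<alpha>. norm (complex_of_real (multi_coeff a \<alpha>) * (monomial z \<alpha> * cnj (monomial w \<alpha>)))) summable_on UNIV"
  using has_sum_row_column(1)[OF eval_row_summable[OF assms(1)] eval_row_summable[OF assms(2)]]
  by (simp only: eval_row_mult_cnj)

end

section \<open>Complete Pick kernels have non-negative coefficients\<close>

lemma coord_space_subspace: "closed_csubspace (coord_space n)"
proof -
  have "coord_space n = (\<Inter>i\<in>{n..}. (\<lambda>x. hsum_nth x i) -` {0})"
    by (auto simp: coord_space_def)
  moreover have "closed ((\<lambda>x :: (nat, complex) hsum. hsum_nth x i) -` {0})" for i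
    by (rule continuous_closed_vimage)
      (auto intro: linear_continuous_at bounded_clinear_linear bounded_clinear_hsum_nth)
  ultimately have "closed (coord_space n)" by (simp add: closed_INT)
  then show ?thesis
    by (auto simp: closed_csubspace_def coord_space_def hsum_nth_simps hsum_nth_scaleC scaleC.zero_right)
qed

lemma coord_space_1: "v \<in> coord_space 1 \<Longrightarrow> v = hsum_single 0 (hsum_nth v 0)"
  by (rule hsum_eqI) (auto simp: hsum_nth_single coord_space_def)

lemma hsum_single_coord_space: "hsum_single 0 c \<in> coord_space 1"
  by (simp add: coord_space_def hsum_nth_single)

lemma norm_axis_eq: "norm (axis i \<zeta> :: complex ^ 'd::finite) = cmod \<zeta>"
proof -
  have "(\<Sum>j\<in>UNIV. (cmod (axis i \<zeta> $ j))\<^sup>2) = (\<Sum>j\<in>(UNIV :: 'd set). if j = i then (cmod \<zeta>)\<^sup>2 else 0)"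
    by (rule sum.cong) (auto simp: axis_def)
  then show ?thesis by (simp add: norm_vec_def L2_set_def)
qed

context invariant_kernel
begin

lemma monomial_0: "monomial 0 \<alpha> = (if \<alpha> = 0 then 1 else 0)"
proof (cases "\<alpha> = 0")
  case False
  then obtain i where "\<alpha> i \<noteq> 0" by (auto simp: fun_eq_iff)
  then have "\<exists>i\<in>UNIV. (0 :: complex ^ 'a) $ i ^ \<alpha> i = 0" by (intro bexI[of _ i]) auto
  then show ?thesis using False unfolding monomial_def by (subst prod_zero) auto
qed (simp add: monomial_def)

lemma kernel_0: "kernel z 0 = 1" "kernel 0 z = 1"
proof -
  have "((\<lambda>\<alpha>. complex_of_real (multi_coeff a \<alpha>) * (monomial z \<alpha> * cnj (monomial 0 \<alpha>))) has_sum 1) UNIV"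
    "((\<lambda>\<alpha>. complex_of_real (multi_coeff a \<alpha>) * (monomial 0 \<alpha> * cnj (monomial z \<alpha>))) has_sum 1) UNIV"
    by (rule has_sum_finite_neutralI[of "{0}"]; auto simp: monomial_0 multi_coeff_0 monomial_def)+
  then show "kernel z 0 = 1" "kernel 0 z = 1"
    unfolding kernel_def by (auto intro: infsumI)
qed

text \<open>On a coordinate axis only the multiples of one unit index contribute, and there \<open>a\<^sub>\<alpha> = a\<^bsub>|\<alpha>|\<^esub>\<close>.\<close>

lemma kernel_axis:
  fixes i :: "'d::finite"
  assumes "cmod \<zeta> < 1" "cmod \<xi> < 1"
  shows "(\<lambda>n. complex_of_real (a n) * (\<zeta> * cnj \<xi>) ^ n) sums kernel (axis i \<zeta>) (axis i \<xi>)"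
proof -
  let ?e = "\<lambda>n j. if j = i then n else (0 :: nat)"
  let ?f = "\<lambda>\<alpha>. complex_of_real (multi_coeff a \<alpha>) * (monomial (axis i \<zeta>) \<alpha> * cnj (monomial (axis i \<xi>) \<alpha>))"
  have ball: "axis i \<zeta> \<in> ball 0 1" "axis i \<xi> \<in> ball 0 1"
    using assms by (simp_all add: norm_axis_eq)
  have mon: "monomial (axis i z) (?e n) = z ^ n" for z n
  proof -
    have "monomial (axis i z) (?e n) = (\<Prod>j\<in>UNIV. if j = i then z ^ n else 1)"
      unfolding monomial_def by (rule prod.cong) (auto simp: axis_def)
    then show ?thesis by simp
  qed
  have mon0: "monomial (axis i z) \<alpha> = 0" if "\<alpha> \<notin> range ?e" for z \<alpha>
  proof -
    have "\<alpha> \<noteq> ?e (\<alpha> i)" using that by blast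
    then obtain j where "j \<noteq> i" "\<alpha> j \<noteq> 0" by (auto simp: fun_eq_iff split: if_splits)
    then have "\<exists>j\<in>UNIV. axis i z $ j ^ \<alpha> j = 0" by (intro bexI[of _ j]) (auto simp: axis_def)
    then show ?thesis unfolding monomial_def by (subst prod_zero) auto
  qed
  have mc: "multi_coeff a (?e n) = a n" for n
  proof -
    have "(\<Prod>j\<in>UNIV. fact (?e n j) :: real) = (\<Prod>j\<in>UNIV. if j = i then fact n else 1)"
      by (rule prod.cong) auto
    then show ?thesis by (simp add: multi_coeff_def)
  qed
  have "(?f has_sum kernel (axis i \<zeta>) (axis i \<xi>)) UNIV"
    unfolding kernel_def
    by (rule abs_summable_has_sum, rule kernel_abs_summable[OF ball])
  moreover have f0: "?f \<alpha> = 0" if "\<alpha> \<notin> range ?e" for \<alpha>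
    by (simp only: mon0[OF that] mult_zero_left mult_zero_right)
  moreover have "(?f has_sum kernel (axis i \<zeta>) (axis i \<xi>)) (range ?e) \<longleftrightarrow> (?f has_sum kernel (axis i \<zeta>) (axis i \<xi>)) UNIV"
  proof (rule has_sum_cong_neutral)
    fix \<alpha> assume "\<alpha> \<in> UNIV - range ?e"
    then have "\<alpha> \<notin> range ?e" unfolding Diff_iff by (rule conjunct2)
    then show "?f \<alpha> = 0" by (rule f0)
  next
    fix \<alpha> assume "\<alpha> \<in> range ?e - UNIV"
    then show "?f \<alpha> = 0" by (rule DiffE) (erule notE, rule UNIV_I)
  qed (rule refl)
  ultimately have "(?f has_sum kernel (axis i \<zeta>) (axis i \<xi>)) (range ?e)" by blast
  moreover have "inj ?e" by (auto simp: inj_def fun_eq_iff)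
  ultimately have "((?f \<circ> ?e) has_sum kernel (axis i \<zeta>) (axis i \<xi>)) UNIV"
    by (simp add: has_sum_reindex)
  then show ?thesis
    by (intro has_sum_imp_sums) (simp add: comp_def mon mc power_mult_distrib)
qed

text \<open>A contractive row multiplier \<open>\<phi>\<close> with $\varphi(x_j) = \langle\cdot, w_j\rangle$ is tested on the function
  $f = \sum_j (s(\cdot,x_j)-1) w_j$, which vanishes at the origin, and on $g = \sum_j (s(\cdot,x_j) - 1)$: since
  $\langle\varphi f, g\rangle = \|f\|^2$, the norm of $f$ is at most that of $g$.\<close>

lemma contractive_row_multiplier:
  fixes x :: "nat \<Rightarrow> complex ^ 'd::finite" and w :: "nat \<Rightarrow> (nat, complex) hsum"
  assumes x: "\<And>j. j < N \<Longrightarrow> x j \<in> ball 0 1" and w: "\<And>j. j < N \<Longrightarrow> w j \<in> coord_space n"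
    and mult: "multiplier a (coord_space n) (coord_space 1) \<phi>"
    and contr: "mult_contractive a (coord_space n) \<phi>"
    and interp: "\<And>j e. j < N \<Longrightarrow> e \<in> coord_space n \<Longrightarrow> \<phi> (x j) e = hsum_single 0 (cinner e (w j))"
  shows "Re (\<Sum>j<N. \<Sum>i<N. (kernel (x j) (x i) - 1) * cinner (w i) (w j))
    \<le> Re (\<Sum>j<N. \<Sum>i<N. kernel (x j) (x i) - 1)"
proof -
  define G :: "(nat \<Rightarrow> (nat, complex) hsum) \<Rightarrow> ('d multi_index, (nat, complex) hsum) hsum" where
    "G v = (\<Sum>j<N. column (eval_row (x j)) (v j) - column (eval_row 0) (v j))" for v
  have G_fun: "hs_fun (G v) z = (\<Sum>i<N. (kernel z (x i) - 1) *\<^sub>C v i)" if "z \<in> ball 0 1" for v z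
    using that x by (auto simp: G_def hs_fun_linear hs_fun_kernel kernel_0 scaleC.diff_left intro!: sum.cong)
  have G_fun_0: "hs_fun (G v) 0 = 0" for v
    by (subst G_fun) (simp_all add: kernel_0)
  have G_inner: "cinner H (G v) = (\<Sum>j<N. cinner (hs_fun H (x j)) (v j) - cinner (hs_fun H 0) (v j))" for H v
    using x by (auto simp: G_def cinner.sum_right cinner.diff_right cinner_kernel intro!: sum.cong)
  have G_norm: "cinner (G v) (G v) = (\<Sum>j<N. \<Sum>i<N. (kernel (x j) (x i) - 1) * cinner (v i) (v j))" for v
    unfolding G_inner G_fun_0 using x
    by (auto simp: G_fun cinner.sum_left cinner_scaleC_left intro!: sum.cong)
  note cs = closed_csubspaceD[OF coord_space_subspace]
  let ?F = "G w" and ?G = "G (\<lambda>_. hsum_single 0 1)"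
  have "hsum_nth (column (eval_row z) (w j)) \<alpha> \<in> coord_space n" if "j < N" "z \<in> ball 0 1" for z j \<alpha>
    by (simp only: hsum_nth_column[OF eval_row_summable[OF that(2)]]) (intro cs w that)
  then have "hsum_nth ?F \<alpha> \<in> coord_space n" for \<alpha>
  proof -
    have "hsum_nth ?F \<alpha> = (\<Sum>j<N. hsum_nth (column (eval_row (x j)) (w j)) \<alpha> - hsum_nth (column (eval_row 0) (w j)) \<alpha>)"
      unfolding G_def
      by (subst linear_sum[OF bounded_linear.linear[OF bounded_clinear_linear[OF bounded_clinear_hsum_nth]]])
        (simp add: hsum_nth_simps)
    also have "\<dots> \<in> coord_space n"
      using \<open>\<And>z j \<alpha>. _ \<Longrightarrow> _ \<Longrightarrow> hsum_nth (column (eval_row z) (w j)) \<alpha> \<in> coord_space n\<close> x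
      by (intro closed_csubspace_sum[OF coord_space_subspace] cs) auto
    finally show ?thesis .
  qed
  then have F: "?F \<in> hs_vectors (coord_space n)" by (simp add: hs_vectors_def)
  then have Fs: "hs_fun ?F \<in> hs_space a (coord_space n)"
    using hs_space_eq[OF coord_space_subspace, of n] by blast
  then have "mult_op \<phi> (hs_fun ?F) \<in> hs_space a (coord_space 1)"
    using mult by (simp add: multiplier_def)
  then obtain M where M: "mult_op \<phi> (hs_fun ?F) = hs_fun M"
    using hs_space_eq[OF coord_space_subspace, of 1] by blast
  have "bounded_op (coord_space n) (coord_space 1) (\<phi> 0)"
    using mult by (auto simp: multiplier_def)
  then have "\<phi> 0 (0 *\<^sub>C 0) = 0 *\<^sub>C \<phi> 0 0"
    using cs(2) unfolding bounded_op_def by blast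
  then have phi0: "\<phi> 0 0 = 0" by simp
  have M0: "hs_fun M 0 = 0"
    using fun_cong[OF M, of 0] by (simp add: mult_op_def G_fun_0 phi0)
  have Fx: "hs_fun ?F (x j) \<in> coord_space n" if "j < N" for j
    unfolding G_fun[OF x[OF that]] by (intro closed_csubspace_sum[OF coord_space_subspace] cs w) auto
  have Mx: "hs_fun M (x j) = hsum_single 0 (cinner (hs_fun ?F (x j)) (w j))" if "j < N" for j
    using fun_cong[OF M, of "x j"] x[OF that] interp[OF that Fx[OF that]] by (simp add: mult_op_def)
  have "cinner M ?G = (\<Sum>j<N. cinner (hs_fun ?F (x j)) (w j))"
    unfolding G_inner M0 by (auto simp: Mx cinner_hsum_single hsum_nth_single cinner_complex_def hsum_nth_zero intro!: sum.cong)
  also have "\<dots> = cinner ?F ?F"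
    unfolding G_inner[of ?F w] G_fun_0 by simp
  finally have "cinner M ?G = cinner ?F ?F" .
  then have "(norm ?F)\<^sup>2 \<le> norm M * norm ?G"
    using cauchy_schwarz[of M ?G] by (simp add: cinner_self norm_power)
  also have "norm M \<le> norm ?F"
    using contr Fs by (auto simp: mult_contractive_def M hs_norm_hs_fun dest!: bspec[OF _ Fs])
  then have "norm M * norm ?G \<le> norm ?F * norm ?G" by (rule mult_right_mono) simp
  finally have "norm ?F \<le> norm ?G"
    by (cases "norm ?F = 0") (auto simp: power2_eq_square)
  then have "(norm ?F)\<^sup>2 \<le> (norm ?G)\<^sup>2" by (intro power_mono) auto
  then have "Re (cinner ?F ?F) \<le> Re (cinner ?G ?G)" by simp
  then show ?thesis
    unfolding G_norm by (simp add: cinner_hsum_single hsum_nth_single cinner_complex_def)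
qed

end

subsection \<open>Circulant forms\<close>

definition unity_root :: "nat \<Rightarrow> nat \<Rightarrow> complex" where
  "unity_root N j = cis (2 * pi * real j / real N)"

definition fourier_sq :: "nat \<Rightarrow> (nat \<Rightarrow> complex) \<Rightarrow> nat \<Rightarrow> real" where
  "fourier_sq N v l = (cmod (\<Sum>j<N. cnj (unity_root N j) ^ l * v j))\<^sup>2"

definition matrix_form :: "nat \<Rightarrow> (nat \<Rightarrow> nat \<Rightarrow> complex) \<Rightarrow> (nat \<Rightarrow> complex) \<Rightarrow> complex" where
  "matrix_form N C v = (\<Sum>i<N. \<Sum>j<N. C i j * (v j * cnj (v i)))"

text \<open>A power series evaluated at the products $x_i \overline{x_j}$ of points on a circle is diagonalized by the
  discrete Fourier transform.\<close>

lemma circulant_form_sums: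
  fixes f :: "nat \<Rightarrow> real"
  assumes x: "\<And>j. x j = complex_of_real r * unity_root N j"
    and C: "\<And>i j. (\<lambda>l. complex_of_real (f l) * (x i * cnj (x j)) ^ l) sums C i j"
  shows "(\<lambda>l. f l * (r\<^sup>2) ^ l * fourier_sq N v l) sums Re (matrix_form N C v)" "Im (matrix_form N C v) = 0"
proof -
  have "(\<lambda>l. \<Sum>i<N. \<Sum>j<N. complex_of_real (f l) * (x i * cnj (x j)) ^ l * (v j * cnj (v i))) sums matrix_form N C v"
    unfolding matrix_form_def by (intro sums_sum sums_mult2 C)
  moreover have "(\<Sum>i<N. \<Sum>j<N. complex_of_real (f l) * (x i * cnj (x j)) ^ l * (v j * cnj (v i)))
      = complex_of_real (f l * (r\<^sup>2) ^ l * fourier_sq N v l)" for l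
  proof -
    let ?S = "\<Sum>j<N. cnj (unity_root N j) ^ l * v j"
    have "(\<Sum>i<N. \<Sum>j<N. complex_of_real (f l) * (x i * cnj (x j)) ^ l * (v j * cnj (v i)))
        = complex_of_real (f l * (r\<^sup>2) ^ l) * ((\<Sum>i<N. unity_root N i ^ l * cnj (v i)) * ?S)"
      by (simp add: x sum_product sum_distrib_left power_mult_distrib power2_eq_square mult_ac)
    also have "(\<Sum>i<N. unity_root N i ^ l * cnj (v i)) = cnj ?S" by simp
    also have "cnj ?S * ?S = complex_of_real ((cmod ?S)\<^sup>2)"
      by (subst complex_norm_square) (simp add: mult.commute)
    finally show ?thesis by (simp add: fourier_sq_def)
  qed
  ultimately have *: "(\<lambda>l. complex_of_real (f l * (r\<^sup>2) ^ l * fourier_sq N v l)) sums matrix_form N C v" by simp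
  show "(\<lambda>l. f l * (r\<^sup>2) ^ l * fourier_sq N v l) sums Re (matrix_form N C v)"
    using sums_Re[OF *] by simp
  show "Im (matrix_form N C v) = 0"
    using sums_Im[OF *] by (auto dest: sums_unique2[OF sums_zero])
qed

lemma unity_root_power:
  assumes "N > 0"
  shows "unity_root N j ^ N = 1"
proof -
  have "unity_root N j ^ N = cis (2 * pi * real j)"
    unfolding unity_root_def Complex.DeMoivre using assms by simp
  then show ?thesis by (simp add: cis_multiple_2pi)
qed

lemma inj_unity_root: "N > 0 \<Longrightarrow> inj_on (unity_root N) {..<N}"
  using Complex.bij_betw_roots_unity unfolding bij_betw_def unity_root_def[abs_def] by blast

lemma fourier_sq_nonneg: "0 \<le> fourier_sq N v l"
  by (simp add: fourier_sq_def)

lemma fourier_sq_le: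
  assumes N: "N > 0"
  shows "fourier_sq N v l \<le> (\<Sum>k<N. fourier_sq N v k)"
proof -
  have "cnj (unity_root N j) ^ l = cnj (unity_root N j) ^ (l mod N)" for j
  proof -
    have "unity_root N j ^ l = (unity_root N j ^ N) ^ (l div N) * unity_root N j ^ (l mod N)"
      by (simp flip: power_mult power_add)
    then show ?thesis by (simp add: unity_root_power[OF N] flip: complex_cnj_power)
  qed
  then have "fourier_sq N v l = fourier_sq N v (l mod N)" by (simp add: fourier_sq_def)
  also have "\<dots> \<le> (\<Sum>k<N. fourier_sq N v k)"
    using N by (intro member_le_sum) (auto simp: fourier_sq_nonneg)
  finally show ?thesis .
qed

lemma fourier_sq_1:
  assumes N: "N > 0"
  shows "0 < l \<Longrightarrow> l < N \<Longrightarrow> fourier_sq N (\<lambda>_. 1) l = 0"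
    and "fourier_sq N (\<lambda>_. 1) N = (real N)\<^sup>2" and "fourier_sq N (\<lambda>_. 1) l \<le> (real N)\<^sup>2"
proof -
  show "fourier_sq N (\<lambda>_. 1) N = (real N)\<^sup>2"
    by (simp add: fourier_sq_def unity_root_power[OF N] flip: complex_cnj_power)
  have "cmod (\<Sum>j<N. cnj (unity_root N j) ^ l * 1) \<le> (\<Sum>j<N. 1)"
    by (rule sum_norm_le) (simp add: norm_power unity_root_def)
  then show "fourier_sq N (\<lambda>_. 1) l \<le> (real N)\<^sup>2"
    unfolding fourier_sq_def by (intro power_mono) auto
  assume l: "0 < l" "l < N"
  have eq: "unity_root N j ^ l = unity_root N l ^ j" for j
    unfolding unity_root_def Complex.DeMoivre by (simp add: mult_ac)
  have "unity_root N l \<noteq> 1"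
  proof
    assume "unity_root N l = 1"
    then have "unity_root N l = unity_root N 0" by (simp add: unity_root_def)
    then have "l = 0" using inj_unity_root[OF N] l N unfolding inj_on_def by blast
    then show False using l by simp
  qed
  then have "(\<Sum>j<N. unity_root N j ^ l) = 0"
    unfolding eq by (simp add: geometric_sum unity_root_power[OF N])
  then have "cnj (\<Sum>j<N. unity_root N j ^ l) = 0" by simp
  then show "fourier_sq N (\<lambda>_. 1) l = 0" by (simp add: fourier_sq_def)
qed

text \<open>Beyond degree \<open>N\<close> a power series with radius of convergence above \<open>1/2\<close> is \<open>O(t\<^sup>N)\<close>, uniformly over bounded
  weights \<open>g\<close>.\<close>

lemma power_series_tail:
  fixes c :: "nat \<Rightarrow> real"
  assumes c: "summable (\<lambda>l. c l * (3/4) ^ l)"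
  obtains K where "0 \<le> K"
    "\<And>t g B S. 0 < t \<Longrightarrow> t \<le> 1/2 \<Longrightarrow> (\<And>l. 0 \<le> g l) \<Longrightarrow> (\<And>l. g l \<le> B) \<Longrightarrow> (\<lambda>l. c l * t ^ l * g l) sums S \<Longrightarrow>
      \<bar>S - (\<Sum>l<N. c l * t ^ l * g l)\<bar> \<le> B * K * t ^ N"
proof
  let ?K = "\<Sum>l. \<bar>c (l + N)\<bar> * (1/2) ^ l"
  have "summable (\<lambda>l. \<bar>c l\<bar> * (1/2) ^ l)"
    using powser_insidea[OF c, of "1/2"] by (simp add: abs_mult)
  then have "summable (\<lambda>l. \<bar>c (l + N)\<bar> * (1/2) ^ (l + N))"
    by (rule summable_ignore_initial_segment)
  also have "(\<lambda>l. \<bar>c (l + N)\<bar> * (1/2) ^ (l + N)) = (\<lambda>l. (1/2) ^ N * (\<bar>c (l + N)\<bar> * (1/2) ^ l))"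
    by (simp add: fun_eq_iff power_add)
  finally have sN: "summable (\<lambda>l. \<bar>c (l + N)\<bar> * (1/2) ^ l)"
    by (subst (asm) summable_cmult_iff) auto
  show "0 \<le> ?K" by (intro suminf_nonneg sN) simp
  fix t B S :: real and g :: "nat \<Rightarrow> real"
  assume t: "0 < t" "t \<le> 1/2" and g: "\<And>l. 0 \<le> g l" "\<And>l. g l \<le> B" and S: "(\<lambda>l. c l * t ^ l * g l) sums S"
  have B: "0 \<le> B" using g(1)[of 0] g(2)[of 0] by linarith
  have tail: "(\<lambda>l. c (l + N) * t ^ (l + N) * g (l + N)) sums (S - (\<Sum>l<N. c l * t ^ l * g l))"
    using S by (subst sums_iff_shift) simp
  have le: "norm (c (l + N) * t ^ (l + N) * g (l + N)) \<le> (B * t ^ N) * (\<bar>c (l + N)\<bar> * (1/2) ^ l)" for l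
  proof -
    have "norm (c (l + N) * t ^ (l + N) * g (l + N)) = \<bar>c (l + N)\<bar> * (t ^ l * t ^ N) * g (l + N)"
      using t g(1) by (simp add: abs_mult power_add)
    also have "\<dots> \<le> \<bar>c (l + N)\<bar> * ((1/2) ^ l * t ^ N) * B"
      using t g by (intro mult_mono power_mono mult_nonneg_nonneg) auto
    finally show ?thesis by (simp add: mult_ac)
  qed
  have "\<bar>S - (\<Sum>l<N. c l * t ^ l * g l)\<bar> = norm (\<Sum>l. c (l + N) * t ^ (l + N) * g (l + N))"
    using tail by (simp add: sums_unique[symmetric])
  also have "\<dots> \<le> (\<Sum>l. (B * t ^ N) * (\<bar>c (l + N)\<bar> * (1/2) ^ l))"
    by (rule norm_suminf_le[OF le]) (intro summable_mult sN)
  also have "\<dots> = (B * t ^ N) * ?K" by (rule suminf_mult[OF sN])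
  finally show "\<bar>S - (\<Sum>l<N. c l * t ^ l * g l)\<bar> \<le> B * ?K * t ^ N" by (simp add: mult_ac)
qed

text \<open>On a circle of small radius, \<open>N\<close> positive leading coefficients make the circulant matrix of size \<open>N\<close> positive:
  the term of degree \<open>l < N\<close> dominates everything that is aliased with it.\<close>

lemma circulant_form_nonneg:
  assumes c: "summable (\<lambda>l. c l * (3/4) ^ l)" and pos: "\<And>l. l < N \<Longrightarrow> 0 < c l" and N: "N > 0"
  obtains t\<^sub>0 where "0 < t\<^sub>0" "t\<^sub>0 \<le> 1/2"
    "\<And>t v S. 0 < t \<Longrightarrow> t \<le> t\<^sub>0 \<Longrightarrow> (\<lambda>l. c l * t ^ l * fourier_sq N v l) sums S \<Longrightarrow> 0 \<le> S"
proof -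
  obtain K where K: "0 \<le> K" "\<And>t g B S. 0 < t \<Longrightarrow> t \<le> 1/2 \<Longrightarrow> (\<And>l. 0 \<le> g l) \<Longrightarrow> (\<And>l. g l \<le> B) \<Longrightarrow>
      (\<lambda>l. c l * t ^ l * g l) sums S \<Longrightarrow> \<bar>S - (\<Sum>l<N. c l * t ^ l * g l)\<bar> \<le> B * K * t ^ N"
    using power_series_tail[OF c, of N] by blast
  define m where "m = Min (c ` {..<N})"
  have m: "m > 0" "\<And>l. l < N \<Longrightarrow> m \<le> c l"
    using pos N by (auto simp: m_def Min_gr_iff[of "c ` {..<N}"] lessThan_empty_iff)
  have q: "0 < m / (K + 1)" by (rule divide_pos_pos) (use m(1) K(1) in simp_all)
  have "0 \<le> S" if t: "0 < t" "t \<le> 1/2" "t \<le> m / (K + 1)" and S: "(\<lambda>l. c l * t ^ l * fourier_sq N v l) sums S" for t v S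
  proof -
    let ?B = "\<Sum>k<N. fourier_sq N v k"
    have 1: "S \<ge> (\<Sum>l<N. c l * t ^ l * fourier_sq N v l) - ?B * K * t ^ N"
      using K(2)[OF t(1,2) fourier_sq_nonneg fourier_sq_le[OF N] S] by argo
    have "m * t ^ (N - 1) * fourier_sq N v l \<le> c l * t ^ l * fourier_sq N v l" if "l < N" for l
      using m(2)[OF that] less_imp_le[OF pos[OF that]] that t
      by (intro mult_right_mono mult_mono power_decreasing fourier_sq_nonneg) auto
    then have "(\<Sum>l<N. m * t ^ (N - 1) * fourier_sq N v l) \<le> (\<Sum>l<N. c l * t ^ l * fourier_sq N v l)"
      by (intro sum_mono) auto
    then have 2: "m * t ^ (N - 1) * ?B \<le> (\<Sum>l<N. c l * t ^ l * fourier_sq N v l)"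
      by (simp add: sum_distrib_left)
    have "t * K \<le> t * (K + 1)" using t by (simp add: mult_left_mono)
    also have "\<dots> \<le> m" using t(3) K(1) by (simp add: pos_le_divide_eq)
    finally have "0 \<le> ?B * t ^ (N - 1) * (m - t * K)"
      using t by (intro mult_nonneg_nonneg sum_nonneg) (auto simp: fourier_sq_nonneg)
    also have "\<dots> = m * t ^ (N - 1) * ?B - ?B * K * t ^ N"
      using power_minus_mult[OF N, of t] by (simp add: algebra_simps) 
    finally show ?thesis using 1 2 by linarith
  qed
  note nonneg = this
  show thesis
  proof (rule that)
    show "0 < min (1/2) (m / (K + 1))" using q by (simp only: min_less_iff_conj) simp
    show "min (1/2) (m / (K + 1)) \<le> 1/2" by (rule min.cobounded1)
    fix t v S assume "0 < t" "t \<le> min (1/2) (m / (K + 1))" "(\<lambda>l. c l * t ^ l * fourier_sq N v l) sums S"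
    then show "0 \<le> S" by (intro nonneg) (simp_all only: min.bounded_iff)
  qed
qed

text \<open>The constant vector only sees the degrees divisible by \<open>N\<close>.\<close>

lemma circulant_form_leading:
  assumes d: "summable (\<lambda>l. d l * (3/4) ^ l)" and d0: "d 0 = 0" and N: "N > 0" and t\<^sub>0: "0 < t\<^sub>0"
    and form: "\<And>t. 0 < t \<Longrightarrow> t \<le> t\<^sub>0 \<Longrightarrow> \<exists>S\<ge>0. (\<lambda>l. d l * t ^ l * fourier_sq N (\<lambda>_. 1) l) sums S"
  shows "0 \<le> d N"
proof (rule ccontr)
  assume neg: "\<not> 0 \<le> d N"
  let ?g = "fourier_sq N (\<lambda>_. 1)"
  obtain K where K: "0 \<le> K" "\<And>t g B S. 0 < t \<Longrightarrow> t \<le> 1/2 \<Longrightarrow> (\<And>l. 0 \<le> g l) \<Longrightarrow> (\<And>l. g l \<le> B) \<Longrightarrow>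
      (\<lambda>l. d l * t ^ l * g l) sums S \<Longrightarrow> \<bar>S - (\<Sum>l<Suc N. d l * t ^ l * g l)\<bar> \<le> B * K * t ^ Suc N"
    using power_series_tail[OF d, of "Suc N"] by blast
  define q where "q = - d N / (2 * (K + 1))"
  \<comment> \<open>small enough for the tail \<open>K t\<^bsup>N+1\<^esup>\<close> to stay below half of the leading term\<close>
  define t where "t = min t\<^sub>0 (min (1/2) q)"
  have "0 < - d N" using neg by linarith
  moreover have "0 < 2 * (K + 1)" using K(1) by simp
  ultimately have "0 < q" unfolding q_def by (rule divide_pos_pos)
  then have t: "0 < t" "t \<le> 1/2" "t \<le> t\<^sub>0" "t \<le> q" using t\<^sub>0 by (auto simp: t_def)
  obtain S where S: "0 \<le> S" "(\<lambda>l. d l * t ^ l * ?g l) sums S" using form[OF t(1,3)] by blast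
  have "\<bar>S - (\<Sum>l<Suc N. d l * t ^ l * ?g l)\<bar> \<le> (real N)\<^sup>2 * K * t ^ Suc N"
    by (rule K(2)[OF t(1,2) fourier_sq_nonneg fourier_sq_1(3)[OF N] S(2)])
  moreover have "(\<Sum>l<N. d l * t ^ l * ?g l) = 0"
  proof (rule sum.neutral, rule ballI)
    fix l assume "l \<in> {..<N}"
    then show "d l * t ^ l * ?g l = 0"
      using d0 fourier_sq_1(1)[OF N, of l] by (cases "l = 0") auto
  qed
  ultimately have "0 \<le> d N * t ^ N * (real N)\<^sup>2 + (real N)\<^sup>2 * K * t ^ Suc N"
    using S(1) fourier_sq_1(2)[OF N] by simp
  also have "\<dots> = (t ^ N * (real N)\<^sup>2) * (d N + K * t)"
    by (simp add: algebra_simps)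
  finally have nonneg: "0 \<le> (t ^ N * (real N)\<^sup>2) * (d N + K * t)" .
  have "0 < t ^ N * (real N)\<^sup>2" using t N by simp
  then have "0 \<le> d N + K * t"
    using nonneg mult_pos_neg[of "t ^ N * (real N)\<^sup>2" "d N + K * t"] by argo
  moreover have "K * t \<le> (K + 1) * q" using t K(1) by (intro mult_mono) auto
  moreover have "(K + 1) * q = - d N / 2" using K(1) by (simp add: q_def field_simps)
  ultimately show False using neg by argo
qed

lemma sums_shift:
  fixes f :: "nat \<Rightarrow> 'a::real_normed_vector"
  assumes "f sums s"
  shows "(\<lambda>l. if k \<le> l then f (l - k) else 0) sums s"
proof -
  have "(\<Sum>i<k. if k \<le> i then f (i - k) else 0) = 0" by (intro sum.neutral) auto
  then show ?thesis
    using assms sums_iff_shift[of "\<lambda>l. if k \<le> l then f (l - k) else 0" k s] by simp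
qed

lemma sums_times_one_minus_poly:
  fixes u K :: "'a::real_normed_field"
  assumes "(\<lambda>l. of_real (f l) * u ^ l) sums K"
  shows "(\<lambda>l. of_real (f l - (\<Sum>k\<in>{1..n}. if k \<le> l then \<beta> k * f (l - k) else 0)) * u ^ l) sums
    (K * (1 - (\<Sum>k\<in>{1..n}. of_real (\<beta> k) * u ^ k)))"
proof -
  have "(\<lambda>l. of_real (f l) * u ^ l - (\<Sum>k\<in>{1..n}. of_real (\<beta> k) * u ^ k * (if k \<le> l then of_real (f (l - k)) * u ^ (l - k) else 0)))
      sums (K - (\<Sum>k\<in>{1..n}. of_real (\<beta> k) * u ^ k * K))"
    by (intro sums_diff assms sums_sum sums_mult sums_shift)
  moreover have "of_real (f l) * u ^ l - (\<Sum>k\<in>{1..n}. of_real (\<beta> k) * u ^ k * (if k \<le> l then of_real (f (l - k)) * u ^ (l - k) else 0))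
      = of_real (f l - (\<Sum>k\<in>{1..n}. if k \<le> l then \<beta> k * f (l - k) else 0)) * u ^ l" for l
  proof -
    have "of_real (\<beta> k) * u ^ k * (if k \<le> l then of_real (f (l - k)) * u ^ (l - k) else 0)
        = of_real (if k \<le> l then \<beta> k * f (l - k) else 0) * u ^ l" for k
      using power_add[of u k "l - k"] by (auto simp: mult_ac)
    then show ?thesis by (simp add: left_diff_distrib sum_distrib_right)
  qed
  ultimately show ?thesis by (simp add: right_diff_distrib sum_distrib_left mult.commute)
qed

context invariant_kernel
begin

context
  fixes s :: "complex ^ 'd::finite \<Rightarrow> complex ^ 'd \<Rightarrow> complex"
  assumes s: "\<And>z w. z \<in> ball 0 1 \<Longrightarrow> w \<in> ball 0 1 \<Longrightarrow>
      (\<lambda>n. complex_of_real (a n) * (\<Sum>i\<in>UNIV. z $ i * cnj (w $ i)) ^ n) sums s z w"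
    and pick: "complete_pick s a"
begin

text \<open>The row $\varphi(x_j) = (\sqrt{(1-\delta) b_k}\, x_j^k)_{1\le k\le n}$ is prescribed at the points
  $x_j = r e^{2\pi i j/N}$ of a coordinate axis, with $N = n + 1$. The Pick matrix is circulant; for small $r$ its eigenvalues
  are governed by the coefficients \<open>c\<^sub>0, \<dots>, c\<^sub>n\<close> of $s(1-\varphi\varphi^*)$. For \<open>\<delta> = 0\<close> these would be
  $1, 0, \dots, 0$ by the renewal equation, so \<open>\<delta> > 0\<close> makes them positive. The inequality for contractive multipliers
  concerns the constant vector and $(s-1)(1-\varphi\varphi^*)$; the leading term there has degree \<open>N\<close>, and its coefficient
  is the right-hand side.\<close>

lemma pick_step:
  assumes b: "\<And>k. 1 \<le> k \<Longrightarrow> k \<le> n \<Longrightarrow> 0 \<le> cnp_coeff a k" and \<delta>: "0 < \<delta>" "\<delta> < 1"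
  shows "0 \<le> \<delta> * a (Suc n) + (1 - \<delta>) * cnp_coeff a (Suc n)"
proof -
  define N where "N = Suc n"
  define \<beta> where "\<beta> k = (if 1 \<le> k \<and> k \<le> n then (1 - \<delta>) * cnp_coeff a k else 0)" for k
  \<comment> \<open>the coefficients of $s (1 - \varphi\varphi^*)$\<close>
  define c where "c l = a l - (\<Sum>k\<in>{1..n}. if k \<le> l then \<beta> k * a (l - k) else 0)" for l
  \<comment> \<open>the coefficients of $(s - 1)(1 - \varphi\varphi^*)$\<close>
  define d where "d l = c l - (if l = 0 then 1 else 0) + \<beta> l" for l
  have \<beta>0: "0 \<le> \<beta> k" for k using b \<delta> by (auto simp: \<beta>_def)
  have N0: "N > 0" by (simp add: N_def)
  have ren: "(\<Sum>k\<in>{1..l}. cnp_coeff a k * a (l - k)) = a l" if "l > 0" for l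
  proof -
    have "a l = (\<Sum>k\<in>insert 0 {1..l}. cnp_coeff a k * a (l - k))"
      unfolding renewal[OF that] by (rule sum.cong) auto
    then show ?thesis by (simp add: cnp_coeff_0)
  qed
  have c0: "c 0 = 1" by (simp add: c_def a_0)
  have cm: "c l = \<delta> * a l" if "0 < l" "l \<le> n" for l
  proof -
    have "(\<Sum>k\<in>{1..n}. if k \<le> l then \<beta> k * a (l - k) else 0) = (\<Sum>k\<in>{1..l}. (1 - \<delta>) * (cnp_coeff a k * a (l - k)))"
      using that by (intro sum.mono_neutral_cong_right) (auto simp: \<beta>_def)
    also have "\<dots> = (1 - \<delta>) * a l" by (simp only: ren[OF that(1)] flip: sum_distrib_left)
    finally show ?thesis by (simp add: c_def algebra_simps)
  qed
  have cN: "c N = \<delta> * a N + (1 - \<delta>) * cnp_coeff a N"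
  proof -
    have "(\<Sum>k\<in>{1..n}. if k \<le> N then \<beta> k * a (N - k) else 0) = (\<Sum>k\<in>{1..n}. (1 - \<delta>) * (cnp_coeff a k * a (N - k)))"
      by (intro sum.cong) (auto simp: \<beta>_def N_def)
    also have "\<dots> = (1 - \<delta>) * (\<Sum>k\<in>{1..n}. cnp_coeff a k * a (N - k))" by (simp flip: sum_distrib_left)
    also have "(\<Sum>k\<in>{1..n}. cnp_coeff a k * a (N - k)) = a N - cnp_coeff a N"
      using ren[OF N0] by (simp add: N_def a_0)
    finally show ?thesis by (simp add: c_def algebra_simps)
  qed
  have dN: "d N = c N" by (simp add: d_def N_def \<beta>_def)
  have d0: "d 0 = 0" by (simp add: d_def c0 \<beta>_def)
  have c_pos: "c l > 0" if "l < N" for l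
    using that c0 cm[of l] a_pos[of l] \<delta> by (cases "l = 0") (auto simp: N_def)
  have "summable (\<lambda>l. a l * (3/4) ^ l)" by (rule radius) auto
  then have c34: "summable (\<lambda>l. c l * (3/4) ^ l)"
    using sums_times_one_minus_poly[where f = a and u = "3/4 :: real" and n = n and \<beta> = \<beta>] by (auto simp: c_def summable_def)
  have "(\<lambda>l. (\<beta> l - (if l = 0 then 1 else 0)) * (3/4) ^ l) sums (\<Sum>l\<in>{..n}. (\<beta> l - (if l = 0 then 1 else 0)) * (3/4) ^ l)"
    by (rule sums_finite) (auto simp: \<beta>_def)
  then have "summable (\<lambda>l. c l * (3/4) ^ l + (\<beta> l - (if l = 0 then 1 else 0)) * (3/4) ^ l)"
    using c34 by (intro summable_add) (auto simp: summable_def)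
  then have d34: "summable (\<lambda>l. d l * (3/4) ^ l)"
    by (rule summable_cong[THEN iffD1, rotated]) (auto simp: d_def algebra_simps)
  obtain t\<^sub>0 where t\<^sub>0: "0 < t\<^sub>0" "t\<^sub>0 \<le> 1/2"
      "\<And>t v S. 0 < t \<Longrightarrow> t \<le> t\<^sub>0 \<Longrightarrow> (\<lambda>l. c l * t ^ l * fourier_sq N v l) sums S \<Longrightarrow> 0 \<le> S"
    using circulant_form_nonneg[OF c34 c_pos N0] by blast
  have "\<exists>S\<ge>0. (\<lambda>l. d l * t ^ l * fourier_sq N (\<lambda>_. 1) l) sums S" if t: "0 < t" "t \<le> t\<^sub>0" for t
  proof -
    define r where "r = sqrt t"
    define \<xi> where "\<xi> j = complex_of_real r * unity_root N j" for j
    define i0 :: 'd where "i0 = undefined"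
    define x where "x j = (axis i0 (\<xi> j) :: complex ^ 'd)" for j
    define w where "w j = Abs_hsum (\<lambda>k. if k < n then cnj (complex_of_real (sqrt (\<beta> (Suc k))) * \<xi> j ^ Suc k) else 0)" for j
    define p where "p u = (\<Sum>k\<in>{1..n}. complex_of_real (\<beta> k) * u ^ k)" for u
    define W where "W j e = hsum_single (0 :: nat) (cinner e (w j))" for j e
    have r: "0 < r" "r < 1" "r\<^sup>2 = t"
      using t t\<^sub>0(2) by (auto simp: r_def real_sqrt_lt_1_iff)
    have \<xi>: "cmod (\<xi> j) < 1" for j using r by (simp add: \<xi>_def norm_mult unity_root_def)
    have xb: "x j \<in> ball 0 1" for j using \<xi> by (simp add: x_def norm_axis_eq)
    have Ks: "(\<lambda>l. complex_of_real (a l) * (\<xi> i * cnj (\<xi> j)) ^ l) sums kernel (x i) (x j)" for i j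
      unfolding x_def by (rule kernel_axis[OF \<xi> \<xi>])
    have sK: "s (x i) (x j) = kernel (x i) (x j)" for i j
    proof -
      have "(\<Sum>k\<in>UNIV. x i $ k * cnj (x j $ k)) = \<xi> i * cnj (\<xi> j)"
      proof -
        have "(\<Sum>k\<in>UNIV. x i $ k * cnj (x j $ k)) = (\<Sum>k\<in>UNIV. if k = i0 then \<xi> i * cnj (\<xi> j) else 0)"
          by (rule sum.cong) (auto simp: x_def axis_def)
        then show ?thesis by simp
      qed
      then show ?thesis using s[OF xb xb, of i j] Ks[of i j] sums_unique2 by metis
    qed
    have w_nth: "hsum_nth (w j) k = (if k < n then cnj (complex_of_real (sqrt (\<beta> (Suc k))) * \<xi> j ^ Suc k) else 0)" for j k
      unfolding w_def
      by (rule hsum_nth_Abs, rule finite_nonzero_values_imp_summable_on, rule finite_subset[of _ "{..<n}"]) auto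
    have wC: "w j \<in> coord_space n" for j by (simp add: coord_space_def w_nth)
    have ww: "cinner (w j) (w i) = p (\<xi> i * cnj (\<xi> j))" for i j
    proof -
      have nth_prod: "cinner (hsum_nth (w j) k) (hsum_nth (w i) k)
          = (if k < n then complex_of_real (\<beta> (Suc k)) * (\<xi> i * cnj (\<xi> j)) ^ Suc k else 0)" for k
      proof -
        have "complex_of_real (sqrt (\<beta> (Suc k))) * complex_of_real (sqrt (\<beta> (Suc k))) = complex_of_real (\<beta> (Suc k))"
          using \<beta>0[of "Suc k"] by (simp flip: of_real_mult)
        moreover have "cnj (q * \<xi> j ^ Suc k) * cnj (cnj (q * \<xi> i ^ Suc k)) = (q * cnj q) * (\<xi> i * cnj (\<xi> j)) ^ Suc k" for q
          by (simp only: power_mult_distrib complex_cnj_mult complex_cnj_cnj complex_cnj_power mult_ac)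
        ultimately show ?thesis
          by (simp only: w_nth cinner_complex_def complex_cnj_complex_of_real if_True if_False split: if_split)
            (simp add: cinner_complex_def)
      qed
      have "((\<lambda>k. cinner (hsum_nth (w j) k) (hsum_nth (w i) k)) has_sum
          (\<Sum>k<n. complex_of_real (\<beta> (Suc k)) * (\<xi> i * cnj (\<xi> j)) ^ Suc k)) UNIV"
        unfolding nth_prod by (rule has_sum_finite_neutralI[of "{..<n}"]) auto
      with cinner_hsum_has_sum have "cinner (w j) (w i) = (\<Sum>k<n. complex_of_real (\<beta> (Suc k)) * (\<xi> i * cnj (\<xi> j)) ^ Suc k)"
        by (rule has_sum_unique)
      also have "\<dots> = p (\<xi> i * cnj (\<xi> j))"
        unfolding p_def by (rule sum.reindex_bij_witness[of _ "\<lambda>k. k - 1" Suc]) auto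
      finally show ?thesis .
    qed
    have adj: "adjoint_on (coord_space n) cinner cinner (W j) v = hsum_nth v 0 *\<^sub>C w j" for j v
      unfolding adjoint_on_def
    proof (rule the_equality)
      have W: "cinner (W j u) v = cinner u (hsum_nth v 0 *\<^sub>C w j)" for u
        using cinner_hsum_single[of v 0 "cinner u (w j)"] cinner_commute[of "W j u" v]
        by (simp add: W_def cinner_complex_def cinner_scaleC_right)
      show "hsum_nth v 0 *\<^sub>C w j \<in> coord_space n \<and> (\<forall>u\<in>coord_space n. cinner (W j u) v = cinner u (hsum_nth v 0 *\<^sub>C w j))"
        by (intro conjI ballI W closed_csubspaceD(4)[OF coord_space_subspace] wC)
      fix y assume y: "y \<in> coord_space n \<and> (\<forall>u\<in>coord_space n. cinner (W j u) v = cinner u y)"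
      let ?e = "y - hsum_nth v 0 *\<^sub>C w j"
      have "?e \<in> coord_space n"
        using y by (intro closed_csubspaceD(7)[OF coord_space_subspace] closed_csubspaceD(4)[OF coord_space_subspace] wC) blast
      then have "cinner ?e y = cinner ?e (hsum_nth v 0 *\<^sub>C w j)" using y by (simp only: W[symmetric])
      then have "cinner ?e ?e = 0" by (simp add: cinner.diff_right)
      then show "y = hsum_nth v 0 *\<^sub>C w j" by (simp add: cinner_self)
    qed
    define C where "C i j = kernel (x i) (x j) * (1 - p (\<xi> i * cnj (\<xi> j)))" for i j
    define E where "E i j = (kernel (x i) (x j) - 1) * (1 - p (\<xi> i * cnj (\<xi> j)))" for i j
    have Cs: "(\<lambda>l. complex_of_real (c l) * (\<xi> i * cnj (\<xi> j)) ^ l) sums C i j" for i j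
      unfolding c_def p_def C_def by (rule sums_times_one_minus_poly[OF Ks])
    note C_form = circulant_form_sums[where x = \<xi> and f = c and r = r and N = N and C = C, OF \<xi>_def Cs, unfolded r(3)]
    have psd: "matrix_form N C v \<in> \<real>\<^sub>\<ge>\<^sub>0" for v
      unfolding complex_nonneg_Reals_iff using C_form(2) t\<^sub>0(3)[OF t C_form(1)] by blast
    have "\<exists>\<phi>. multiplier a (coord_space n) (coord_space 1) \<phi> \<and> mult_contractive a (coord_space n) \<phi> \<and>
        (\<forall>i<N. \<forall>e\<in>coord_space n. \<phi> (x i) e = W i e)"
    proof (rule pick[unfolded complete_pick_def, rule_format, of x N n 1 W])
      show "x ` {..<N} \<subseteq> ball 0 1" using xb by auto
      show "inj_on x {..<N}"
        using r inj_unity_root[OF N0] by (auto simp: inj_on_def x_def axis_eq_axis \<xi>_def)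
      show "bounded_op (coord_space n) (coord_space 1) (W j)" for j
        unfolding bounded_op_def
      proof (intro conjI ballI allI)
        show "\<exists>K. \<forall>u\<in>coord_space n. norm (W j u) \<le> K * norm u"
        proof (intro exI ballI)
          fix u
          have "cinner (W j u) (W j u) = cinner (cinner u (w j)) (cinner u (w j))"
            by (simp add: W_def cinner_hsum_single hsum_nth_single)
          then have "norm (W j u) = cmod (cinner u (w j))"
            by (simp add: cinner_self flip: of_real_power)
          then show "norm (W j u) \<le> norm (w j) * norm u"
            using cauchy_schwarz[of u "w j"] by (simp add: mult.commute)
        qed
      qed (auto simp: W_def hsum_single_coord_space[unfolded One_nat_def] cinner_add_left cinner_scaleC_left hsum_nth_single hsum_nth_simps hsum_nth_scaleC scaleC_complex_def scaleC.zero_right intro!: hsum_eqI)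
      fix v :: "nat \<Rightarrow> (nat, complex) hsum" assume v: "\<And>i. i < N \<Longrightarrow> v i \<in> coord_space 1"
      let ?v = "\<lambda>j. hsum_nth (v j) 0"
      have "(\<Sum>i<N. \<Sum>j<N. s (x i) (x j) * cinner (v j - W i (adjoint_on (coord_space n) cinner cinner (W j) (v j))) (v i))
          = matrix_form N C ?v"
        unfolding matrix_form_def
      proof (intro sum.cong refl)
        fix i j assume "i \<in> {..<N}" "j \<in> {..<N}"
        then have "v i = hsum_single 0 (?v i)" using v coord_space_1 by auto
        then have "cinner y (v i) = hsum_nth y 0 * cnj (?v i)" for y
          using cinner_hsum_single[of y 0 "?v i"] by (simp add: cinner_complex_def)
        then show "s (x i) (x j) * cinner (v j - W i (adjoint_on (coord_space n) cinner cinner (W j) (v j))) (v i)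
            = C i j * (?v j * cnj (?v i))"
          by (simp add: C_def sK adj W_def hsum_nth_simps hsum_nth_single cinner_scaleC_left ww algebra_simps)
      qed
      then show "(\<Sum>i<N. \<Sum>j<N. s (x i) (x j) * cinner (v j - W i (adjoint_on (coord_space n) cinner cinner (W j) (v j))) (v i)) \<in> \<real>\<^sub>\<ge>\<^sub>0"
        using psd[of ?v] by (simp only:)
    qed
    then obtain \<phi> where \<phi>: "multiplier a (coord_space n) (coord_space 1) \<phi>" "mult_contractive a (coord_space n) \<phi>"
        "\<And>i e. i < N \<Longrightarrow> e \<in> coord_space n \<Longrightarrow> \<phi> (x i) e = W i e"
      by blast
    have "Re (\<Sum>j<N. \<Sum>i<N. (kernel (x j) (x i) - 1) * cinner (w i) (w j)) \<le> Re (\<Sum>j<N. \<Sum>i<N. kernel (x j) (x i) - 1)"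
      by (rule contractive_row_multiplier[OF xb wC \<phi>(1,2)]) (use \<phi>(3) in \<open>auto simp: W_def\<close>)
    moreover have "matrix_form N E (\<lambda>_. 1)
        = (\<Sum>i<N. \<Sum>j<N. kernel (x i) (x j) - 1) - (\<Sum>i<N. \<Sum>j<N. (kernel (x i) (x j) - 1) * p (\<xi> i * cnj (\<xi> j)))"
      unfolding matrix_form_def E_def sum_subtractf[symmetric] by (intro sum.cong refl) (simp add: right_diff_distrib)
    ultimately have E0: "0 \<le> Re (matrix_form N E (\<lambda>_. 1))" unfolding ww by simp
    have Ds: "(\<lambda>l. complex_of_real (d l) * (\<xi> i * cnj (\<xi> j)) ^ l) sums E i j" for i j
    proof -
      let ?u = "\<xi> i * cnj (\<xi> j)"
      have "(\<lambda>l. complex_of_real (\<beta> l - (if l = 0 then 1 else 0)) * ?u ^ l) sums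
          (\<Sum>l\<in>{..n}. complex_of_real (\<beta> l - (if l = 0 then 1 else 0)) * ?u ^ l)"
        by (rule sums_finite) (auto simp: \<beta>_def)
      also have "(\<Sum>l\<in>{..n}. complex_of_real (\<beta> l - (if l = 0 then 1 else 0)) * ?u ^ l) = p ?u - 1"
      proof -
        have "{..n} = insert 0 {1..n}" by auto
        then show ?thesis by (simp add: p_def \<beta>_def)
      qed
      finally have "(\<lambda>l. complex_of_real (c l) * ?u ^ l + complex_of_real (\<beta> l - (if l = 0 then 1 else 0)) * ?u ^ l) sums
          (C i j + (p ?u - 1))"
        by (intro sums_add Cs)
      moreover have "complex_of_real (c l) * ?u ^ l + complex_of_real (\<beta> l - (if l = 0 then 1 else 0)) * ?u ^ l = complex_of_real (d l) * ?u ^ l" for l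
        by (simp add: d_def algebra_simps)
      ultimately show ?thesis by (simp add: C_def E_def algebra_simps)
    qed
    show ?thesis
      using E0 circulant_form_sums(1)[where x = \<xi> and f = d and r = r and N = N and C = E, OF \<xi>_def Ds, unfolded r(3)] by blast
  qed
  then have "0 \<le> d N" by (rule circulant_form_leading[OF d34 d0 N0 t\<^sub>0(1)])
  then show ?thesis unfolding dN cN unfolding N_def .
qed

text \<open>If \<open>b\<^sub>n\<close> were negative, a small \<open>\<delta>\<close> would contradict the previous lemma; the one chosen makes its right-hand side
  \<open>b\<^sub>n / 2\<close>.\<close>

theorem cnp_coeff_nonneg: "0 \<le> cnp_coeff a n"
proof (induction n rule: less_induct)
  case (less n)
  show ?case
  proof (cases n)
    case (Suc k)
    show ?thesis
    proof (rule ccontr)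
      assume neg: "\<not> 0 \<le> cnp_coeff a n"
      define \<delta> where "\<delta> = - cnp_coeff a n / (2 * (a n - cnp_coeff a n))"
      have pos: "a n - cnp_coeff a n > 0" using neg a_pos[of n] by linarith
      have \<delta>: "0 < \<delta>" "\<delta> < 1" using neg pos a_pos[of n] by (auto simp: \<delta>_def divide_simps)
      have "0 \<le> \<delta> * a n + (1 - \<delta>) * cnp_coeff a n"
        unfolding Suc by (rule pick_step[OF _ \<delta>]) (use less Suc in auto)
      also have "\<dots> = cnp_coeff a n + \<delta> * (a n - cnp_coeff a n)" by (simp add: algebra_simps)
      also have "\<delta> * (a n - cnp_coeff a n) = - cnp_coeff a n / 2"
      proof -
        have "(- y / (2 * D)) * D = - y / 2" if "D > 0" for y D :: real using that by (simp add: field_simps)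
        then show ?thesis using pos unfolding \<delta>_def by blast
      qed
      finally show False using neg by argo
    qed
  qed (simp add: cnp_coeff_0)
qed

end

end

section \<open>The strict row contraction \<open>Z\<close>\<close>

locale cnp_kernel = invariant_kernel +
  assumes b_nonneg: "0 \<le> cnp_coeff a n"
begin

lemma b_coeff_nonneg: "0 \<le> b_coeff a \<alpha>"
  by (simp add: multi_coeff_def b_nonneg prod_nonneg)

text \<open>One term of the renewal equation is \<open>b\<^sub>\<alpha> a\<^sub>0\<close>.\<close>

lemma b_le_a:
  assumes "\<alpha> \<noteq> 0"
  shows "b_coeff a \<alpha> \<le> multi_coeff a \<alpha>"
proof -
  obtain \<beta> where \<beta>: "index_of \<beta> = \<alpha>" using index_of_surj[OF assms] by blast
  have "\<alpha> - \<alpha> = 0" by (simp add: fun_eq_iff)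
  then have "b_coeff a \<alpha> = b_coeff a (index_of \<beta>) * multi_coeff a (\<alpha> - index_of \<beta>)"
    by (simp only: \<beta> multi_coeff_0 mult_1_right)
  also have "\<dots> \<le> multi_coeff a \<alpha>"
    unfolding multi_renewal[OF assms]
  proof (rule member_le_sum[where f = "\<lambda>\<beta>. b_coeff a (index_of \<beta>) * multi_coeff a (\<alpha> - index_of \<beta>)"])
    show "\<beta> \<in> below \<alpha>" by (simp add: below_def \<beta>)
  qed (auto simp: finite_below intro!: mult_nonneg_nonneg b_coeff_nonneg less_imp_le[OF multi_coeff_pos])
  finally show ?thesis .
qed

definition Z_row :: "complex ^ 'd::finite \<Rightarrow> 'd nonzero_index \<Rightarrow> complex" where
  "Z_row z \<beta> = complex_of_real (sqrt (b_coeff a (index_of \<beta>))) * monomial z (index_of \<beta>)"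

lemma Z_op_eq: "Z_op a z = row_sum (Z_row z)"
  by (simp add: fun_eq_iff Z_op_def row_sum_def Z_row_def)

lemma cmod_Z_row_sq: "(cmod (Z_row z \<beta>))\<^sup>2 = b_coeff a (index_of \<beta>) * (cmod (monomial z (index_of \<beta>)))\<^sup>2"
  by (simp add: Z_row_def norm_mult power_mult_distrib b_coeff_nonneg)

lemma Z_row_mult_cnj:
  "Z_row z \<beta> * cnj (Z_row w \<beta>)
    = complex_of_real (b_coeff a (index_of \<beta>)) * (monomial z (index_of \<beta>) * cnj (monomial w (index_of \<beta>)))"
proof -
  have "complex_of_real (sqrt (b_coeff a (index_of \<beta>))) * complex_of_real (sqrt (b_coeff a (index_of \<beta>)))
      = complex_of_real (b_coeff a (index_of \<beta>))"
    using b_coeff_nonneg[of "index_of \<beta>"] by (simp flip: of_real_mult)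
  then show ?thesis by (simp add: Z_row_def mult_ac)
qed

lemma Z_row_summable:
  assumes "z \<in> ball 0 1"
  shows "(\<lambda>\<beta>. (cmod (Z_row z \<beta>))\<^sup>2) summable_on UNIV"
proof (rule summable_on_comparison_test)
  have "(\<lambda>\<alpha>. multi_coeff a \<alpha> * (cmod (monomial z \<alpha>))\<^sup>2) summable_on range index_of"
    by (rule summable_on_subset_banach[OF kernel_summable[OF assms]]) simp
  then show "(\<lambda>\<beta>. multi_coeff a (index_of \<beta>) * (cmod (monomial z (index_of \<beta>)))\<^sup>2) summable_on UNIV"
    by (simp add: summable_on_reindex[OF inj_index_of] comp_def)
qed (auto simp: cmod_Z_row_sq b_coeff_nonneg intro!: mult_right_mono b_le_a index_of_nonzero)

lemma monomial_add: "monomial z (\<alpha> + \<beta>) = monomial z \<alpha> * monomial z \<beta>"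
  by (simp add: monomial_def power_add prod.distrib)

lemma monomial_below:
  assumes "\<beta> \<in> below \<alpha>"
  shows "monomial z (index_of \<beta>) * monomial z (\<alpha> - index_of \<beta>) = monomial z \<alpha>"
  using assms index_diff_add[of "index_of \<beta>" \<alpha>] monomial_add[of z "\<alpha> - index_of \<beta>" "index_of \<beta>"]
  by (simp only: below_def mem_Collect_eq mult.commute)

lemma kernel_has_sum:
  assumes "z \<in> ball 0 1" "w \<in> ball 0 1"
  shows "((\<lambda>\<alpha>. complex_of_real (multi_coeff a \<alpha>) * (monomial z \<alpha> * cnj (monomial w \<alpha>))) has_sum kernel z w) UNIV"
  unfolding kernel_def
  by (rule abs_summable_has_sum, rule kernel_abs_summable[OF assms])

text \<open>The function $1 - 1/s$ is the series of the \<open>b\<^sub>\<beta>\<close>, by the renewal equation.\<close>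

definition one_minus_inverse :: "complex ^ 'd::finite \<Rightarrow> complex ^ 'd \<Rightarrow> complex" where
  "one_minus_inverse z w = (\<Sum>\<^sub>\<infinity>\<beta>. Z_row z \<beta> * cnj (Z_row w \<beta>))"

lemma kernel_one_minus_inverse:
  fixes z w :: "complex ^ 'd::finite"
  assumes z: "z \<in> ball 0 1" and w: "w \<in> ball 0 1"
  shows "kernel z w * one_minus_inverse z w = kernel z w - 1"
proof -
  let ?a = "\<lambda>\<alpha>. complex_of_real (multi_coeff a \<alpha>) * (monomial z \<alpha> * cnj (monomial w \<alpha>))"
  let ?b = "\<lambda>\<beta>. Z_row z \<beta> * cnj (Z_row w \<beta>)"
  have sb: "(\<lambda>\<beta>. norm (?b \<beta>)) summable_on UNIV"
    by (rule has_sum_row_column(1)[OF Z_row_summable[OF z] Z_row_summable[OF w]])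
  have hb: "(?b has_sum one_minus_inverse z w) UNIV"
    unfolding one_minus_inverse_def by (rule abs_summable_has_sum, rule sb)
  have "(\<lambda>(\<beta>, \<gamma>). norm (?b \<beta>) * norm (?a \<gamma>)) summable_on UNIV"
    by (rule summable_on_times[OF sb kernel_abs_summable[OF z w]]) auto
  then have "(\<lambda>x. norm ((\<lambda>(\<beta>, \<gamma>). ?b \<beta> * ?a \<gamma>) x)) summable_on UNIV"
    by (simp only: case_prod_unfold norm_mult)
  then have "(\<lambda>(\<beta>, \<gamma>). ?b \<beta> * ?a \<gamma>) summable_on UNIV"
    by (rule Infinite_Sum.abs_summable_summable)
  then obtain S where S: "((\<lambda>(\<beta>, \<gamma>). ?b \<beta> * ?a \<gamma>) has_sum S) UNIV"
    by (auto simp: summable_on_def)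
  have "((\<lambda>(\<beta>, \<gamma>). ?b \<beta> * ?a \<gamma>) has_sum S) (Sigma UNIV (\<lambda>_. UNIV))" using S by simp
  then have "((\<lambda>\<beta>. ?b \<beta> * kernel z w) has_sum S) UNIV"
  proof (rule has_sum_SigmaD)
    fix \<beta>
    show "((\<lambda>\<gamma>. (\<lambda>(\<beta>, \<gamma>). ?b \<beta> * ?a \<gamma>) (\<beta>, \<gamma>)) has_sum ?b \<beta> * kernel z w) UNIV"
      unfolding split by (rule has_sum_cmult_right[OF kernel_has_sum[OF z w]])
  qed
  with has_sum_cmult_left[OF hb, of "kernel z w"] have S1: "S = one_minus_inverse z w * kernel z w"
    by (rule has_sum_unique[symmetric])
  have "((\<lambda>\<alpha>. \<Sum>\<beta>\<in>below \<alpha>. ?b \<beta> * ?a (\<alpha> - index_of \<beta>)) has_sum S) UNIV"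
    by (rule has_sum_cauchy_below[OF S])
  moreover have "(\<Sum>\<beta>\<in>below \<alpha>. ?b \<beta> * ?a (\<alpha> - index_of \<beta>)) = ?a \<alpha> - (if \<alpha> = 0 then 1 else 0)" for \<alpha>
  proof (cases "\<alpha> = 0")
    case True
    then show ?thesis by (simp add: below_0 multi_coeff_0 monomial_def)
  next
    case False
    have "?b \<beta> * ?a (\<alpha> - index_of \<beta>)
        = complex_of_real (b_coeff a (index_of \<beta>) * multi_coeff a (\<alpha> - index_of \<beta>)) * (monomial z \<alpha> * cnj (monomial w \<alpha>))"
      if "\<beta> \<in> below \<alpha>" for \<beta>
      by (simp only: monomial_below[OF that, symmetric, of z] monomial_below[OF that, symmetric, of w]
          Z_row_mult_cnj of_real_mult complex_cnj_mult mult_ac)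
    then have "(\<Sum>\<beta>\<in>below \<alpha>. ?b \<beta> * ?a (\<alpha> - index_of \<beta>))
        = (\<Sum>\<beta>\<in>below \<alpha>. complex_of_real (b_coeff a (index_of \<beta>) * multi_coeff a (\<alpha> - index_of \<beta>)) * (monomial z \<alpha> * cnj (monomial w \<alpha>)))"
      by (rule sum.cong[OF refl])
    also have "\<dots> = ?a \<alpha>"
      unfolding multi_renewal[OF False] of_real_sum by (rule sum_distrib_right[symmetric])
    finally show ?thesis using False by simp
  qed
  ultimately have "((\<lambda>\<alpha>. ?a \<alpha> - (if \<alpha> = 0 then 1 else 0)) has_sum S) UNIV" by simp
  moreover have "((\<lambda>\<alpha>. ?a \<alpha> - (if \<alpha> = 0 then 1 else 0)) has_sum kernel z w - 1) UNIV"
    by (rule has_sum_diff[OF kernel_has_sum[OF z w]]) (rule has_sum_finite_neutralI[of "{0}"], auto)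
  ultimately have "S = kernel z w - 1" by (rule has_sum_unique)
  then show ?thesis using S1 by (simp add: mult.commute)
qed

text \<open>The sum is $1 - 1/s(z,z)$, where $s(z,z)$ is a finite non-negative number.\<close>

lemma Z_row_norm_less_1:
  assumes z: "z \<in> ball 0 1"
  shows "(\<Sum>\<^sub>\<infinity>\<beta>. (cmod (Z_row z \<beta>))\<^sup>2) < 1"
proof -
  let ?q = "\<Sum>\<^sub>\<infinity>\<beta>. (cmod (Z_row z \<beta>))\<^sup>2" and ?K = "\<Sum>\<^sub>\<infinity>\<alpha>. multi_coeff a \<alpha> * (cmod (monomial z \<alpha>))\<^sup>2"
  have "((\<lambda>\<alpha>. complex_of_real (multi_coeff a \<alpha> * (cmod (monomial z \<alpha>))\<^sup>2)) has_sum complex_of_real ?K) UNIV"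
    by (rule has_sum_of_real[OF has_sum_infsum[OF kernel_summable[OF z]]])
  then have "((\<lambda>\<alpha>. complex_of_real (multi_coeff a \<alpha>) * (monomial z \<alpha> * cnj (monomial z \<alpha>))) has_sum complex_of_real ?K) UNIV"
    by (simp only: of_real_mult complex_norm_square)
  with kernel_has_sum[OF z z] have K: "kernel z z = complex_of_real ?K" by (rule has_sum_unique)
  have "((\<lambda>\<beta>. complex_of_real ((cmod (Z_row z \<beta>))\<^sup>2)) has_sum complex_of_real ?q) UNIV"
    by (rule has_sum_of_real[OF has_sum_infsum[OF Z_row_summable[OF z]]])
  then have q: "one_minus_inverse z z = complex_of_real ?q"
    unfolding one_minus_inverse_def complex_norm_square by (rule infsumI)
  have "complex_of_real (?K * ?q) = complex_of_real (?K - 1)"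
    using kernel_one_minus_inverse[OF z z] by (simp add: K q)
  then have Kq: "?K * ?q = ?K - 1" by (simp only: of_real_eq_iff)
  have q0: "0 \<le> ?q" by (rule infsum_nonneg) simp
  show ?thesis
  proof (rule ccontr)
    assume "\<not> ?q < 1"
    then have "1 \<le> ?q" by simp
    moreover have "0 \<le> ?K"
      by (rule infsum_nonneg) (simp add: less_imp_le[OF multi_coeff_pos])
    ultimately have "?K * 1 \<le> ?K * ?q" by (rule mult_left_mono)
    then show False using Kq by simp
  qed
qed

lemma Z_bounded: "z \<in> ball 0 1 \<Longrightarrow> bounded_clinear (row_sum (Z_row z))"
  by (rule row_sum_bounded[OF Z_row_summable])

lemma Z_contraction:
  fixes z :: "complex ^ 'd::finite"
  assumes "z \<in> ball 0 1"
  obtains q where "0 \<le> q" "q < 1"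
    "\<And>F :: ('d nonzero_index, 'h::chilbert_space) hsum. norm (row_sum (Z_row z) F) \<le> q * norm F"
proof
  let ?q = "sqrt (\<Sum>\<^sub>\<infinity>\<beta>. (cmod (Z_row z \<beta>))\<^sup>2)"
  show "0 \<le> ?q" by (simp add: infsum_nonneg)
  show "?q < 1" using Z_row_norm_less_1[OF assms] by simp
  show "norm (row_sum (Z_row z) F) \<le> ?q * norm F" for F :: "('d nonzero_index, 'h) hsum"
    by (rule norm_row_sum[OF Z_row_summable[OF assms]])
qed

lemma Z_column: "z \<in> ball 0 1 \<Longrightarrow> w \<in> ball 0 1 \<Longrightarrow>
    row_sum (Z_row z) (column (Z_row w) y) = one_minus_inverse z w *\<^sub>C y"
  unfolding one_minus_inverse_def by (rule has_sum_row_column(2)[OF Z_row_summable Z_row_summable])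

end

section \<open>Monomials in a commuting tuple\<close>

locale commuting_tuple =
  fixes T :: "'d::finite \<Rightarrow> 'h::chilbert_space \<Rightarrow> 'h"
  assumes T_bounded: "bounded_clinear (T i)" and T_commute: "T i \<circ> T j = T j \<circ> T i"
begin

lemma T_funpow_commute: "(T i ^^ m) ((T j ^^ n) h) = (T j ^^ n) ((T i ^^ m) h)"
proof -
  have 1: "T i ((T j ^^ n) h) = (T j ^^ n) (T i h)" for h
    by (induction n) (use T_commute[of i j] in \<open>auto simp: fun_eq_iff\<close>)
  show ?thesis by (induction m) (auto simp: 1)
qed

text \<open>The fold over part of the variables, as needed for induction.\<close>

definition partial_monomial :: "'d multi_index \<Rightarrow> 'd set \<Rightarrow> 'h \<Rightarrow> 'h" where
  "partial_monomial \<alpha> F = Finite_Set.fold (\<lambda>i A. (T i ^^ \<alpha> i) \<circ> A) id F"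

lemma partial_monomial_insert:
  assumes "i \<notin> F"
  shows "partial_monomial \<alpha> (insert i F) = (T i ^^ \<alpha> i) \<circ> partial_monomial \<alpha> F"
proof -
  interpret comp_fun_commute "\<lambda>i A. (T i ^^ \<alpha> i) \<circ> A"
    by standard (auto simp: fun_eq_iff intro: T_funpow_commute)
  show ?thesis
    unfolding partial_monomial_def by (rule fold_insert) (use assms in auto)
qed

lemma partial_monomial_empty: "partial_monomial \<alpha> {} = id"
  by (simp add: partial_monomial_def)

lemma op_monomial_eq: "op_monomial T \<alpha> = partial_monomial \<alpha> UNIV"
  by (simp add: op_monomial_def partial_monomial_def)

lemma partial_monomial_commute:
  "finite F \<Longrightarrow> (T i ^^ n) (partial_monomial \<alpha> F h) = partial_monomial \<alpha> F ((T i ^^ n) h)"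
proof (induction F rule: finite_induct)
  case (insert j F)
  then show ?case
    using T_funpow_commute[where i = i and m = n and j = j and n = "\<alpha> j" and h = "partial_monomial \<alpha> F h"] by (simp add: partial_monomial_insert)
qed (simp add: partial_monomial_empty)

lemma op_monomial_add: "op_monomial T (\<alpha> + \<beta>) h = op_monomial T \<alpha> (op_monomial T \<beta> h)"
proof -
  have "partial_monomial (\<alpha> + \<beta>) F h = partial_monomial \<alpha> F (partial_monomial \<beta> F h)" if "finite F" for F h
    using that
    by (induction F arbitrary: h rule: finite_induct)
      (simp_all add: partial_monomial_empty partial_monomial_insert funpow_add partial_monomial_commute)
  then show ?thesis by (simp add: op_monomial_eq)
qed

lemma op_monomial_0: "op_monomial T 0 = id"
proof -
  have "partial_monomial 0 F = id" if "finite F" for F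
    using that by (induction F rule: finite_induct) (simp_all add: partial_monomial_empty partial_monomial_insert)
  then show ?thesis by (simp add: op_monomial_eq)
qed

lemma op_monomial_bounded: "bounded_clinear (op_monomial T \<alpha>)"
proof -
  have "bounded_clinear (partial_monomial \<alpha> F)" if "finite F" for F
    using that
  proof (induction F rule: finite_induct)
    case (insert i F)
    then show ?case
      using bounded_clinear_comp[OF bounded_clinear_funpow[OF T_bounded] insert.IH]
      by (simp add: partial_monomial_insert comp_def)
  qed (simp add: partial_monomial_empty bounded_clinear_id)
  then show ?thesis by (simp add: op_monomial_eq)
qed

abbreviation T_adj :: "'d multi_index \<Rightarrow> 'h \<Rightarrow> 'h" where
  "T_adj \<alpha> \<equiv> cadjoint (op_monomial T \<alpha>)"

lemma T_adj_bounded: "bounded_clinear (T_adj \<alpha>)"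
  by (rule bounded_clinear_cadjoint[OF op_monomial_bounded])

lemma T_adj_0: "T_adj 0 y = y"
  by (rule cadjoint_eqI) (simp add: op_monomial_0)

lemma T_adj_add: "T_adj (\<alpha> + \<beta>) y = T_adj \<alpha> (T_adj \<beta> y)"
  by (rule cadjoint_eqI)
    (simp add: op_monomial_add[of \<beta> \<alpha>] add.commute[of \<alpha> \<beta>] cinner_cadjoint[OF op_monomial_bounded])

end

section \<open>The colligation of a $1/s$-contraction\<close>

locale contraction_setting = cnp_kernel a for a +
  fixes T :: "'d::finite \<Rightarrow> 'h::chilbert_space \<Rightarrow> 'h"
  assumes s_contraction: "s_contraction a T"
begin

sublocale commuting_tuple T
  by unfold_locales (use s_contraction in \<open>auto simp: s_contraction_def\<close>)

lemma row_term_has_sum: "(row_term a T h has_sum (h - one_minus_row a T h)) UNIV"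
  using s_contraction by (simp add: s_contraction_def one_minus_row_def)

lemma one_minus_row_positive: "positive_op (one_minus_row a T)"
  using s_contraction by (simp add: s_contraction_def)

text \<open>The adjoint of $\tilde T$, written down directly: its boundedness is what the hypothesis on \<open>T\<close> provides, and that of
  $\tilde T$ follows by duality.\<close>

definition col :: "'h \<Rightarrow> ('d nonzero_index, 'h) hsum" where
  "col y = Abs_hsum (\<lambda>\<beta>. sqrt (b_coeff a (index_of \<beta>)) *\<^sub>R T_adj (index_of \<beta>) y)"

text \<open>Pairing the strongly convergent series $\sum_\beta b_\beta T^\beta T^{\beta *} y$ with \<open>y\<close>.\<close>

lemma col_has_sum:
  "((\<lambda>\<beta>. (norm (sqrt (b_coeff a (index_of \<beta>)) *\<^sub>R T_adj (index_of \<beta>) y))\<^sup>2) has_sum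
    ((norm y)\<^sup>2 - Re (cinner (one_minus_row a T y) y))) UNIV"
proof -
  have "((\<lambda>\<beta>. Re (cinner (row_term a T y \<beta>) y)) has_sum Re (cinner (y - one_minus_row a T y) y)) UNIV"
    by (intro has_sum_Re has_sum_bounded_linear[OF cinner.bounded_linear_left row_term_has_sum])
  moreover have "Re (cinner (row_term a T y \<beta>) y) = (norm (sqrt (b_coeff a (index_of \<beta>)) *\<^sub>R T_adj (index_of \<beta>) y))\<^sup>2" for \<beta>
  proof -
    let ?y = "T_adj (index_of \<beta>) y" and ?b = "b_coeff a (index_of \<beta>)"
    have "cinner (op_monomial T (index_of \<beta>) ?y) y = cinner ?y ?y"
      by (rule cinner_cadjoint[OF op_monomial_bounded])
    then have "cinner (row_term a T y \<beta>) y = complex_of_real (?b * (norm ?y)\<^sup>2)"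
      by (simp only: row_term_def cinner_scaleR_left cinner_self of_real_mult)
    moreover have "(norm (sqrt ?b *\<^sub>R ?y))\<^sup>2 = ?b * (norm ?y)\<^sup>2"
      using b_coeff_nonneg[of "index_of \<beta>"] by (simp only: norm_scaleR power_mult_distrib power2_abs real_sqrt_pow2)
    ultimately show ?thesis by (simp only: Re_complex_of_real)
  qed
  ultimately show ?thesis by (simp add: cinner.diff_left)
qed

lemma hsum_nth_col: "hsum_nth (col y) \<beta> = sqrt (b_coeff a (index_of \<beta>)) *\<^sub>R T_adj (index_of \<beta>) y"
  unfolding col_def by (rule hsum_nth_Abs) (rule has_sum_imp_summable[OF col_has_sum])

lemma norm_col_le: "norm (col y) \<le> norm y"
proof -
  have "(norm (col y))\<^sup>2 = (norm y)\<^sup>2 - Re (cinner (one_minus_row a T y) y)"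
    using hsum_norm_has_sum[of "col y"] col_has_sum[of y] unfolding hsum_nth_col by (rule has_sum_unique)
  then have "(norm (col y))\<^sup>2 \<le> (norm y)\<^sup>2"
    using positive_op_Re_nonneg[OF one_minus_row_positive, of y] by simp
  then show ?thesis by (rule power2_le_imp_le) (rule norm_ge_zero)
qed

lemma col_bounded: "bounded_clinear col"
  unfolding bounded_op_def
proof (intro conjI ballI allI)
  note lin = clinear[OF T_adj_bounded]
  show "col (x + y) = col x + col y" for x y
    by (rule hsum_eqI) (simp add: hsum_nth_col hsum_nth_simps lin scaleR_add_right)
  show "col (c *\<^sub>C x) = c *\<^sub>C col x" for c x
    by (rule hsum_eqI) (simp add: hsum_nth_col hsum_nth_scaleC lin scaleC_scaleR)
  show "\<exists>K. \<forall>x\<in>UNIV. norm (col x) \<le> K * norm x"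
    using norm_col_le by (intro exI[of _ 1]) auto
qed auto

text \<open>Both operators agree on single components, and the adjoint is continuous.\<close>

lemma T_tilde_eq: "T_tilde a T = cadjoint col"
proof
  fix x
  note R = bounded_clinear_cadjoint[OF col_bounded]
  have "cadjoint col (hsum_single \<beta> v) = sqrt (b_coeff a (index_of \<beta>)) *\<^sub>R op_monomial T (index_of \<beta>) v" for \<beta> v
    by (rule cadjoint_eqI)
      (simp add: cinner_hsum_single hsum_nth_col cinner_scaleR_left cinner_scaleR_right cinner_cadjoint_left[OF op_monomial_bounded])
  then have "((\<lambda>\<beta>. sqrt (b_coeff a (index_of \<beta>)) *\<^sub>R op_monomial T (index_of \<beta>) (hsum_nth x \<beta>)) has_sum cadjoint col x) UNIV"
    using has_sum_clinear[OF R hsum_has_sum_single[of x]] by simp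
  then show "T_tilde a T x = cadjoint col x"
    unfolding T_tilde_def by (rule infsumI)
qed

abbreviation row :: "('d nonzero_index, 'h) hsum \<Rightarrow> 'h" where "row \<equiv> T_tilde a T"

lemma row_bounded: "bounded_clinear row"
  unfolding T_tilde_eq by (rule bounded_clinear_cadjoint[OF col_bounded])

lemma cinner_col: "cinner (col y) x = cinner y (row x)"
  unfolding T_tilde_eq by (rule cinner_cadjoint[OF col_bounded])

lemma cinner_row: "cinner (row x) y = cinner x (col y)"
  by (metis cinner_col cinner_commute)

lemma cadjoint_row: "cadjoint row = col"
  by (rule ext, rule cadjoint_eqI) (rule cinner_row)

lemma norm_row_le: "norm (row x) \<le> norm x"
  unfolding T_tilde_eq using norm_cadjoint_le[OF col_bounded, of 1 x] norm_col_le by simp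

lemma row_col: "row (col y) = y - one_minus_row a T y"
proof -
  have "((\<lambda>\<beta>. row (hsum_single \<beta> (hsum_nth (col y) \<beta>))) has_sum row (col y)) UNIV"
    by (rule has_sum_clinear[OF row_bounded hsum_has_sum_single])
  moreover have "row (hsum_single \<beta> (hsum_nth (col y) \<beta>)) = row_term a T y \<beta>" for \<beta>
  proof (rule cinner_eq_0_all[of "_ - _", THEN eq_iff_diff_eq_0[THEN iffD2]])
    fix u
    have "cinner u (row (hsum_single \<beta> (hsum_nth (col y) \<beta>))) = cinner u (row_term a T y \<beta>)"
      unfolding cinner_col[symmetric]
      by (simp add: cinner_hsum_single hsum_nth_col cinner_scaleR_left cinner_scaleR_right row_term_def
          cinner_cadjoint_left[OF op_monomial_bounded] b_coeff_nonneg flip: mult.assoc of_real_mult)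
    then show "cinner u (row (hsum_single \<beta> (hsum_nth (col y) \<beta>)) - row_term a T y \<beta>) = 0"
      by (simp add: cinner.diff_right)
  qed
  ultimately have "(row_term a T y has_sum row (col y)) UNIV" by simp
  then show ?thesis using row_term_has_sum by (rule has_sum_unique)
qed

abbreviation \<Delta> :: "'h \<Rightarrow> 'h" where "\<Delta> \<equiv> defect a T"
abbreviation D :: "('d nonzero_index, 'h) hsum \<Rightarrow> ('d nonzero_index, 'h) hsum" where "D \<equiv> D_tilde a T"

lemma norm_row_col: "norm (row (col h)) \<le> norm h"
  using norm_row_le[of "col h"] norm_col_le[of h] by simp

lemma norm_col_row: "norm (col (row x)) \<le> norm x"
  using norm_col_le[of "row x"] norm_row_le[of x] by simp

lemmas row_col_bounded = bounded_clinear_comp[OF row_bounded col_bounded]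
lemmas col_row_bounded = bounded_clinear_comp[OF col_bounded row_bounded]

lemma defect_eq: "\<Delta> = sqrt_one_minus (\<lambda>h. row (col h))"
proof -
  have "one_minus_row a T = (\<lambda>h. h - row (col h))" by (simp add: row_col fun_eq_iff)
  then show ?thesis
    unfolding defect_def
    by (simp only:) (rule positive_sqrt_one_minus, auto simp: norm_row_col row_col_bounded cinner_row cinner_col)
qed

lemma D_eq: "D = sqrt_one_minus (\<lambda>x. col (row x))"
  unfolding D_tilde_def cadjoint_row
  by (rule positive_sqrt_one_minus) (auto simp: norm_col_row col_row_bounded cinner_row cinner_col)

lemma defect_bounded: "bounded_clinear \<Delta>"
  unfolding defect_eq by (rule sqrt_one_minus_bounded[OF norm_row_col row_col_bounded])

lemma D_bounded: "bounded_clinear D"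
  unfolding D_eq by (rule sqrt_one_minus_bounded[OF norm_col_row col_row_bounded])

lemma defect_square: "\<Delta> (\<Delta> h) = h - row (col h)"
  unfolding defect_eq by (rule sqrt_one_minus_square[OF norm_row_col row_col_bounded])

lemma D_square: "D (D x) = x - col (row x)"
  unfolding D_eq by (rule sqrt_one_minus_square[OF norm_col_row col_row_bounded])

lemma defect_selfadjoint: "cinner (\<Delta> x) y = cinner x (\<Delta> y)"
  by (rule positive_op_selfadjoint)
    (unfold defect_eq, rule sqrt_one_minus_positive, auto simp: norm_row_col row_col_bounded cinner_row cinner_col)

lemma D_selfadjoint: "cinner (D x) y = cinner x (D y)"
  by (rule positive_op_selfadjoint)
    (unfold D_eq, rule sqrt_one_minus_positive, auto simp: norm_col_row col_row_bounded cinner_row cinner_col)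

text \<open>Both defect operators are power series, in $\tilde T^* \tilde T$ and in $\tilde T \tilde T^*$.\<close>

lemma row_D: "row (D x) = \<Delta> (row x)"
  unfolding defect_eq D_eq
  by (rule sqrt_one_minus_intertwine[OF norm_col_row norm_row_col bounded_clinear_linear[OF row_bounded]]) simp

lemma D_col: "D (col y) = col (\<Delta> y)"
  unfolding defect_eq D_eq
  by (rule sqrt_one_minus_intertwine[OF norm_row_col norm_col_row bounded_clinear_linear[OF col_bounded], symmetric]) simp

lemmas row_lin = clinear[OF row_bounded]
lemmas col_lin = clinear[OF col_bounded]
lemmas defect_lin = clinear[OF defect_bounded]
lemmas D_lin = clinear[OF D_bounded]

text \<open>The operator matrix with rows \<open>(col, D)\<close> and \<open>(\<Delta>, -row)\<close> is the Halmos unitary of \<open>row\<close>.\<close>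

lemma colligation_isometry:
  "(norm (\<Delta> u - row f))\<^sup>2 + (norm (col u + D f))\<^sup>2 = (norm u)\<^sup>2 + (norm f)\<^sup>2"
proof -
  have "Re (cinner (\<Delta> u) (\<Delta> u)) + Re (cinner (col u) (col u)) = Re (cinner u u)"
    unfolding defect_selfadjoint defect_square cinner_col by (simp add: cinner.diff_right cinner_col)
  then have 1: "(norm (\<Delta> u))\<^sup>2 + (norm (col u))\<^sup>2 = (norm u)\<^sup>2" by simp
  have "Re (cinner (row f) (row f)) + Re (cinner (D f) (D f)) = Re (cinner f f)"
    unfolding D_selfadjoint D_square cinner_row by (simp add: cinner.diff_right)
  then have 2: "(norm (row f))\<^sup>2 + (norm (D f))\<^sup>2 = (norm f)\<^sup>2" by simp
  have "cinner (col u) (D f) = cinner (\<Delta> u) (row f)"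
    by (simp add: cinner_col row_D defect_selfadjoint)
  then show ?thesis
    using 1 2 by (simp add: norm_add_sq norm_diff_sq)
qed

lemma D_space_subspace: "closed_csubspace (D_tilde_space a T)"
  unfolding D_tilde_space_def by (rule closure_range_subspace[OF D_bounded])

lemma defect_space_subspace: "closed_csubspace (defect_space a T)"
  unfolding defect_space_def by (rule closure_range_subspace[OF defect_bounded])

lemma D_in_space: "D x \<in> D_tilde_space a T"
  unfolding D_tilde_space_def by (rule subsetD[OF closure_subset], rule rangeI)

lemma defect_in_space: "\<Delta> h \<in> defect_space a T"
  unfolding defect_space_def by (rule subsetD[OF closure_subset], rule rangeI)

lemma row_in_space:
  assumes "x \<in> D_tilde_space a T"
  shows "row x \<in> defect_space a T"
proof (rule bounded_linear_closure_range[where A = D])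
  show "bounded_linear row" by (rule bounded_clinear_linear[OF row_bounded])
  show "row (D h) \<in> defect_space a T" for h unfolding row_D by (rule defect_in_space)
  show "closed (defect_space a T)" by (rule closed_csubspaceD(1)[OF defect_space_subspace])
  show "x \<in> closure (range D)" using assms unfolding D_tilde_space_def .
qed

lemma col_in_space:
  assumes "y \<in> defect_space a T"
  shows "col y \<in> D_tilde_space a T"
proof (rule bounded_linear_closure_range[where A = \<Delta>])
  show "bounded_linear col" by (rule bounded_clinear_linear[OF col_bounded])
  show "col (\<Delta> h) \<in> D_tilde_space a T" for h unfolding D_col[symmetric] by (rule D_in_space)
  show "closed (D_tilde_space a T)" by (rule closed_csubspaceD(1)[OF D_space_subspace])
  show "y \<in> closure (range \<Delta>)" using assms unfolding defect_space_def .
qed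

end

section \<open>The linear system with input $(h, f)$\<close>

lemma monomial_scaleR:
  fixes z :: "complex ^ 'd::finite"
  shows "monomial (r *\<^sub>R z) \<alpha> = complex_of_real (r ^ multi_degree \<alpha>) * monomial z \<alpha>"
proof -
  have "monomial (r *\<^sub>R z) \<alpha> = (\<Prod>i\<in>UNIV. complex_of_real r ^ \<alpha> i * (z $ i) ^ \<alpha> i)"
    unfolding monomial_def by (rule prod.cong) (auto simp: vector_scaleR_component scaleR_conv_of_real[where 'a = complex] power_mult_distrib)
  also have "\<dots> = complex_of_real (r ^ multi_degree \<alpha>) * monomial z \<alpha>"
    by (simp add: prod.distrib monomial_def power_sum)
  finally show ?thesis .
qed

context contraction_setting
begin

text \<open>Coefficientwise, the system reads $u = h + Z x$, $x = \tilde T^* u + D f$, $g = \Delta u - \tilde T f$: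
  solving for the state \<open>u\<close> gives $g = V h + \theta f$.\<close>

definition system ::
    "'h \<Rightarrow> ('d multi_index \<Rightarrow> ('d nonzero_index, 'h) hsum) \<Rightarrow> ('d multi_index \<Rightarrow> 'h) \<Rightarrow> bool" where
  "system h f u \<longleftrightarrow> (\<forall>\<alpha>. u \<alpha> = (if \<alpha> = 0 then h else 0) +
     (\<Sum>\<beta>\<in>below \<alpha>. sqrt (b_coeff a (index_of \<beta>)) *\<^sub>R
        hsum_nth (col (u (\<alpha> - index_of \<beta>)) + D (f (\<alpha> - index_of \<beta>))) \<beta>))"

text \<open>The coefficient at \<open>\<alpha>\<close> only depends on coefficients of lower degree.\<close>

lemma system_ex: "\<exists>u. system h f u"
proof -
  let ?R = "Wellfounded.measure (multi_degree :: 'd multi_index \<Rightarrow> nat)"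
  define H where "H u \<alpha> = (if \<alpha> = 0 then h else 0) +
     (\<Sum>\<beta>\<in>below \<alpha>. sqrt (b_coeff a (index_of \<beta>)) *\<^sub>R
        hsum_nth (col (u (\<alpha> - index_of \<beta>)) + D (f (\<alpha> - index_of \<beta>))) \<beta>)" for u and \<alpha> :: "'d multi_index"
  have "wfrec ?R H \<alpha> = H (wfrec ?R H) \<alpha>" for \<alpha>
  proof -
    have eq: "cut (wfrec ?R H) ?R \<alpha> (\<alpha> - index_of \<beta>) = wfrec ?R H (\<alpha> - index_of \<beta>)" if "\<beta> \<in> below \<alpha>" for \<beta>
      by (rule cut_apply) (unfold in_measure, rule degree_diff_below[OF that])
    have "wfrec ?R H \<alpha> = H (cut (wfrec ?R H) ?R \<alpha>) \<alpha>" by (rule wfrec) simp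
    also have "\<dots> = H (wfrec ?R H) \<alpha>"
      by (simp only: H_def eq cong: sum.cong)
    finally show ?thesis .
  qed
  then have "system h f (wfrec ?R H)" unfolding system_def H_def by blast
  then show ?thesis by blast
qed

definition weighted_sum :: "real \<Rightarrow> nat \<Rightarrow> ('d multi_index \<Rightarrow> 'e::real_normed_vector) \<Rightarrow> real" where
  "weighted_sum \<rho> n p =
    (\<Sum>\<alpha> | multi_degree \<alpha> \<le> n. \<rho> ^ (2 * multi_degree \<alpha>) * ((norm (p \<alpha>))\<^sup>2 / multi_coeff a \<alpha>))"

lemma weighted_sum_nonneg: "0 < \<rho> \<Longrightarrow> 0 \<le> weighted_sum \<rho> n p"
  unfolding weighted_sum_def
  by (intro sum_nonneg mult_nonneg_nonneg divide_nonneg_pos multi_coeff_pos) auto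

text \<open>The rescaling turns coordinates into coefficients of an element of $H_s \otimes E$; weights below 1 only decrease its
  norm.\<close>

lemma weighted_sum_le_norm:
  assumes "0 < \<rho>" "\<rho> \<le> 1"
  shows "weighted_sum \<rho> n (\<lambda>\<alpha>. sqrt (multi_coeff a \<alpha>) *\<^sub>R hsum_nth F \<alpha>) \<le> (norm F)\<^sup>2"
proof -
  have "weighted_sum \<rho> n (\<lambda>\<alpha>. sqrt (multi_coeff a \<alpha>) *\<^sub>R hsum_nth F \<alpha>)
      \<le> (\<Sum>\<alpha> | multi_degree \<alpha> \<le> n. (norm (hsum_nth F \<alpha>))\<^sup>2)"
    unfolding weighted_sum_def
  proof (rule sum_mono)
    fix \<alpha> :: "'d multi_index"
    have "(norm (sqrt (multi_coeff a \<alpha>) *\<^sub>R hsum_nth F \<alpha>))\<^sup>2 / multi_coeff a \<alpha> = (norm (hsum_nth F \<alpha>))\<^sup>2"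
      using multi_coeff_pos[of \<alpha>] by (simp add: power_mult_distrib)
    then show "\<rho> ^ (2 * multi_degree \<alpha>) * ((norm (sqrt (multi_coeff a \<alpha>) *\<^sub>R hsum_nth F \<alpha>))\<^sup>2 / multi_coeff a \<alpha>)
        \<le> (norm (hsum_nth F \<alpha>))\<^sup>2"
      using assms by (simp only:) (intro mult_left_le_one_le power_le_one; simp)
  qed
  also have "\<dots> \<le> (norm F)\<^sup>2"
    unfolding norm_hsum_sq[of F] by (rule finite_sum_le_infsum[OF hsum_summable finite_indices_degree_le]) auto
  finally show ?thesis .
qed

lemma weighted_sum_bounded:
  fixes p :: "'d multi_index \<Rightarrow> 'e::chilbert_space"
  assumes "0 < \<rho>" and B: "\<And>n. weighted_sum \<rho> n p \<le> B"
  obtains P where "\<And>\<alpha>. hsum_nth P \<alpha> = (\<rho> ^ multi_degree \<alpha> / sqrt (multi_coeff a \<alpha>)) *\<^sub>R p \<alpha>" "(norm P)\<^sup>2 \<le> B"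
proof -
  let ?P = "\<lambda>\<alpha>. (\<rho> ^ multi_degree \<alpha> / sqrt (multi_coeff a \<alpha>)) *\<^sub>R p \<alpha>"
  have P: "(norm (?P \<alpha>))\<^sup>2 = \<rho> ^ (2 * multi_degree \<alpha>) * ((norm (p \<alpha>))\<^sup>2 / multi_coeff a \<alpha>)" for \<alpha>
    using multi_coeff_pos[of \<alpha>] by (simp add: power_mult_distrib power_divide flip: power_mult) (simp add: mult.commute)
  have fin: "(\<Sum>\<alpha>\<in>K. (norm (?P \<alpha>))\<^sup>2) \<le> B" if K: "finite K" for K
  proof -
    define n where "n = Max (insert 0 (multi_degree ` K))"
    have "(\<Sum>\<alpha>\<in>K. (norm (?P \<alpha>))\<^sup>2) \<le> (\<Sum>\<alpha> | multi_degree \<alpha> \<le> n. (norm (?P \<alpha>))\<^sup>2)"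
      using K by (intro sum_mono2 finite_indices_degree_le) (auto simp: n_def)
    also have "\<dots> \<le> B" unfolding P by (rule B[unfolded weighted_sum_def])
    finally show ?thesis .
  qed
  have nth: "hsum_nth (Abs_hsum ?P) \<alpha> = ?P \<alpha>" for \<alpha>
    by (rule hsum_nth_Abs) (rule square_summableI(1)[OF fin])
  moreover have "(norm (Abs_hsum ?P))\<^sup>2 \<le> B"
    unfolding norm_hsum_sq[of "Abs_hsum ?P"] nth by (rule square_summableI(2)[OF fin])
  ultimately show thesis by (rule that)
qed

text \<open>Such a family has an absolutely convergent power series on the ball of radius \<open>\<rho>\<close>.\<close>

lemma weighted_abs_summable:
  fixes p :: "'d multi_index \<Rightarrow> 'e::chilbert_space"
  assumes \<rho>: "0 < \<rho>" and z: "norm z < \<rho>" and B: "\<And>n. weighted_sum \<rho> n p \<le> B"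
  shows "(\<lambda>\<alpha>. norm (monomial z \<alpha> *\<^sub>C p \<alpha>)) summable_on UNIV"
proof -
  obtain P where P: "\<And>\<alpha>. hsum_nth P \<alpha> = (\<rho> ^ multi_degree \<alpha> / sqrt (multi_coeff a \<alpha>)) *\<^sub>R p \<alpha>"
    using weighted_sum_bounded[OF \<rho> B] by blast
  let ?z = "(1 / \<rho>) *\<^sub>R z"
  have "?z \<in> ball 0 1" using \<rho> z by simp
  then have "(\<lambda>\<alpha>. norm (eval_row ?z \<alpha> *\<^sub>C hsum_nth P \<alpha>)) summable_on UNIV"
    by (intro l2_row eval_row_summable)
  moreover have "eval_row ?z \<alpha> *\<^sub>C hsum_nth P \<alpha> = monomial z \<alpha> *\<^sub>C p \<alpha>" for \<alpha>
  proof -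
    have "complex_of_real (sqrt (multi_coeff a \<alpha>)) * (complex_of_real ((1 / \<rho>) ^ multi_degree \<alpha>) * monomial z \<alpha>)
        * complex_of_real (\<rho> ^ multi_degree \<alpha> / sqrt (multi_coeff a \<alpha>)) = monomial z \<alpha>"
      using \<rho> multi_coeff_pos[of \<alpha>] by (simp add: power_divide)
    then show ?thesis
      unfolding P unfolding eval_row_def monomial_scaleR scaleC_of_real[symmetric] scaleC_scaleC by (simp only:)
  qed
  ultimately show ?thesis by simp
qed

context
  fixes h f u
  assumes sys: "system h f u"
begin

abbreviation (input) "state_out \<alpha> \<equiv> col (u \<alpha>) + D (f \<alpha>)"
abbreviation (input) "output \<alpha> \<equiv> \<Delta> (u \<alpha>) - row (f \<alpha>)"

lemma state_0: "u 0 = h"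
  using sys[unfolded system_def, rule_format, of 0] by (simp add: below_0)

text \<open>By the Cauchy-Schwarz inequality and the renewal equation \<open>a\<^sub>\<alpha> = \<Sum> b\<^sub>\<beta> a\<^bsub>\<alpha>-\<beta>\<^esub>\<close>.\<close>

lemma state_bound:
  assumes "\<alpha> \<noteq> 0"
  shows "(norm (u \<alpha>))\<^sup>2 / multi_coeff a \<alpha>
    \<le> (\<Sum>\<beta>\<in>below \<alpha>. (norm (hsum_nth (state_out (\<alpha> - index_of \<beta>)) \<beta>))\<^sup>2 / multi_coeff a (\<alpha> - index_of \<beta>))"
proof -
  let ?x = "\<lambda>\<beta>. norm (hsum_nth (state_out (\<alpha> - index_of \<beta>)) \<beta>)" and ?a = "\<lambda>\<beta>. multi_coeff a (\<alpha> - index_of \<beta>)"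
    and ?b = "\<lambda>\<beta>. b_coeff a (index_of \<beta>)"
  let ?S = "\<Sum>\<beta>\<in>below \<alpha>. (?x \<beta>)\<^sup>2 / ?a \<beta>"
  have "norm (u \<alpha>) = norm (\<Sum>\<beta>\<in>below \<alpha>. sqrt (?b \<beta>) *\<^sub>R hsum_nth (state_out (\<alpha> - index_of \<beta>)) \<beta>)"
    using sys[unfolded system_def, rule_format, of \<alpha>] assms by simp
  also have "\<dots> \<le> (\<Sum>\<beta>\<in>below \<alpha>. \<bar>sqrt (?b \<beta> * ?a \<beta>)\<bar> * \<bar>?x \<beta> / sqrt (?a \<beta>)\<bar>)"
  proof (rule sum_norm_le)
    fix \<beta> assume "\<beta> \<in> below \<alpha>"
    have "?a \<beta> > 0" by (rule multi_coeff_pos)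
    then show "norm (sqrt (?b \<beta>) *\<^sub>R hsum_nth (state_out (\<alpha> - index_of \<beta>)) \<beta>) \<le> \<bar>sqrt (?b \<beta> * ?a \<beta>)\<bar> * \<bar>?x \<beta> / sqrt (?a \<beta>)\<bar>"
      by (simp add: real_sqrt_mult abs_mult)
  qed
  also have "\<dots> \<le> L2_set (\<lambda>\<beta>. sqrt (?b \<beta> * ?a \<beta>)) (below \<alpha>) * L2_set (\<lambda>\<beta>. ?x \<beta> / sqrt (?a \<beta>)) (below \<alpha>)"
    by (rule L2_set_mult_ineq)
  also have "L2_set (\<lambda>\<beta>. sqrt (?b \<beta> * ?a \<beta>)) (below \<alpha>) = sqrt (multi_coeff a \<alpha>)"
    unfolding L2_set_def multi_renewal[OF assms]
    by (simp add: real_sqrt_pow2 b_coeff_nonneg less_imp_le[OF multi_coeff_pos])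
  also have "L2_set (\<lambda>\<beta>. ?x \<beta> / sqrt (?a \<beta>)) (below \<alpha>) = sqrt ?S"
    unfolding L2_set_def by (simp add: power_divide real_sqrt_pow2 less_imp_le[OF multi_coeff_pos])
  finally have "(norm (u \<alpha>))\<^sup>2 \<le> (sqrt (multi_coeff a \<alpha>) * sqrt ?S)\<^sup>2"
    by (rule power_mono) simp
  also have "\<dots> = multi_coeff a \<alpha> * ?S"
    using multi_coeff_pos
    by (simp add: power_mult_distrib real_sqrt_pow2 less_imp_le[OF multi_coeff_pos] sum_nonneg)
  finally show ?thesis
    using multi_coeff_pos[of \<alpha>] by (simp add: pos_divide_le_eq mult.commute)
qed

text \<open>Since \<open>Z\<close> raises the degree, passing through it gains a factor \<open>\<rho>\<close> in the norm with weights
  \<open>\<rho>\<^sup>2\<^sup>|\<^sup>\<alpha>\<^sup>|\<close>, so that no convergence is presupposed: all sums are over \<open>|\<alpha>| \<le> n\<close>.\<close>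

lemma weighted_state_bound:
  assumes \<rho>: "0 < \<rho>" "\<rho> \<le> 1"
  shows "weighted_sum \<rho> n u \<le> (norm h)\<^sup>2 + \<rho>\<^sup>2 * weighted_sum \<rho> n (\<lambda>\<alpha>. state_out \<alpha>)"
proof -
  let ?A = "{\<alpha> :: 'd multi_index. multi_degree \<alpha> \<le> n}"
  let ?y = "\<lambda>\<gamma> \<beta>. \<rho> ^ (2 * multi_degree \<gamma>) * ((norm (hsum_nth (state_out \<gamma>) \<beta>))\<^sup>2 / multi_coeff a \<gamma>)"
  let ?B = "\<Union>\<alpha>\<in>?A. below \<alpha>"
  have finA: "finite ?A" by (rule finite_indices_degree_le)
  have finB: "finite ?B" using finA finite_below by blast
  have y0: "0 \<le> ?y \<gamma> \<beta>" for \<gamma> \<beta>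
    using \<rho> multi_coeff_pos[of \<gamma>] by simp
  have step: "\<rho> ^ (2 * multi_degree \<alpha>) * ((norm (u \<alpha>))\<^sup>2 / multi_coeff a \<alpha>) \<le> (\<Sum>\<beta>\<in>below \<alpha>. \<rho>\<^sup>2 * ?y (\<alpha> - index_of \<beta>) \<beta>)"
    if "\<alpha> \<noteq> 0" for \<alpha>
  proof -
    have "\<rho> ^ (2 * multi_degree \<alpha>) * ((norm (u \<alpha>))\<^sup>2 / multi_coeff a \<alpha>)
      \<le> \<rho> ^ (2 * multi_degree \<alpha>) * (\<Sum>\<beta>\<in>below \<alpha>. (norm (hsum_nth (state_out (\<alpha> - index_of \<beta>)) \<beta>))\<^sup>2 / multi_coeff a (\<alpha> - index_of \<beta>))"
      using \<rho> by (intro mult_left_mono state_bound that) simp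
    also have "\<dots> = (\<Sum>\<beta>\<in>below \<alpha>. \<rho> ^ (2 * multi_degree \<alpha>) * ((norm (hsum_nth (state_out (\<alpha> - index_of \<beta>)) \<beta>))\<^sup>2 / multi_coeff a (\<alpha> - index_of \<beta>)))"
      by (rule sum_distrib_left)
    also have "\<dots> \<le> (\<Sum>\<beta>\<in>below \<alpha>. \<rho>\<^sup>2 * ?y (\<alpha> - index_of \<beta>) \<beta>)"
    proof (rule sum_mono)
      fix \<beta> assume "\<beta> \<in> below \<alpha>"
      then have "2 * multi_degree \<alpha> \<ge> 2 + 2 * multi_degree (\<alpha> - index_of \<beta>)"
        using degree_diff_below[of \<beta> \<alpha>] by linarith
      then have "\<rho> ^ (2 * multi_degree \<alpha>) \<le> \<rho>\<^sup>2 * \<rho> ^ (2 * multi_degree (\<alpha> - index_of \<beta>))"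
        unfolding power_add[symmetric] using \<rho> by (intro power_decreasing) auto
      then have "\<rho> ^ (2 * multi_degree \<alpha>) * ((norm (hsum_nth (state_out (\<alpha> - index_of \<beta>)) \<beta>))\<^sup>2 / multi_coeff a (\<alpha> - index_of \<beta>))
          \<le> (\<rho>\<^sup>2 * \<rho> ^ (2 * multi_degree (\<alpha> - index_of \<beta>))) * ((norm (hsum_nth (state_out (\<alpha> - index_of \<beta>)) \<beta>))\<^sup>2 / multi_coeff a (\<alpha> - index_of \<beta>))"
        by (rule mult_right_mono) (intro divide_nonneg_pos multi_coeff_pos zero_le_power2)
      then show "\<rho> ^ (2 * multi_degree \<alpha>) * ((norm (hsum_nth (state_out (\<alpha> - index_of \<beta>)) \<beta>))\<^sup>2 / multi_coeff a (\<alpha> - index_of \<beta>))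
          \<le> \<rho>\<^sup>2 * ?y (\<alpha> - index_of \<beta>) \<beta>"
        by (simp only: mult.assoc)
    qed
    finally show ?thesis .
  qed
  have split_0: "(\<Sum>\<alpha>\<in>?A. \<rho> ^ (2 * multi_degree \<alpha>) * ((norm (u \<alpha>))\<^sup>2 / multi_coeff a \<alpha>))
      = (norm h)\<^sup>2 + (\<Sum>\<alpha>\<in>?A - {0}. \<rho> ^ (2 * multi_degree \<alpha>) * ((norm (u \<alpha>))\<^sup>2 / multi_coeff a \<alpha>))"
    by (subst sum.remove[OF finA, of 0]) (simp_all add: state_0 multi_coeff_0)
  have "(\<Sum>\<alpha>\<in>?A - {0}. \<rho> ^ (2 * multi_degree \<alpha>) * ((norm (u \<alpha>))\<^sup>2 / multi_coeff a \<alpha>))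
      \<le> (\<Sum>\<alpha>\<in>?A - {0}. \<Sum>\<beta>\<in>below \<alpha>. \<rho>\<^sup>2 * ?y (\<alpha> - index_of \<beta>) \<beta>)"
    by (rule sum_mono) (rule step, simp)
  also have "\<dots> = (\<Sum>(\<alpha>, \<beta>)\<in>Sigma (?A - {0}) below. \<rho>\<^sup>2 * ?y (\<alpha> - index_of \<beta>) \<beta>)"
    by (rule sum.Sigma) (use finA finite_below in auto)
  also have "\<dots> = (\<Sum>(\<gamma>, \<beta>)\<in>(\<lambda>(\<alpha>, \<beta>). (\<alpha> - index_of \<beta>, \<beta>)) ` Sigma (?A - {0}) below. \<rho>\<^sup>2 * ?y \<gamma> \<beta>)"
  proof (subst sum.reindex)
    show "inj_on (\<lambda>(\<alpha>, \<beta>). (\<alpha> - index_of \<beta>, \<beta>)) (Sigma (?A - {0}) below)"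
    proof (rule inj_onI)
      fix p p' assume p: "p \<in> Sigma (?A - {0}) below" "p' \<in> Sigma (?A - {0}) below"
        and eq: "(\<lambda>(\<alpha>, \<beta>). (\<alpha> - index_of \<beta>, \<beta>)) p = (\<lambda>(\<alpha>, \<beta>). (\<alpha> - index_of \<beta>, \<beta>)) p'"
      obtain \<alpha> \<beta> \<alpha>' where pp: "p = (\<alpha>, \<beta>)" "p' = (\<alpha>', \<beta>)"
        using eq by (cases p; cases p') simp
      have "\<beta> \<in> below \<alpha>" "\<beta> \<in> below \<alpha>'" "\<alpha> - index_of \<beta> = \<alpha>' - index_of \<beta>"
        using p eq unfolding pp by (simp_all only: mem_Sigma_iff split prod.inject)
      then have le: "index_of \<beta> \<le> \<alpha>" "index_of \<beta> \<le> \<alpha>'" and eq: "\<alpha> - index_of \<beta> = \<alpha>' - index_of \<beta>"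
        by (simp_all only: below_def mem_Collect_eq)
      have "\<alpha> = \<alpha> - index_of \<beta> + index_of \<beta>" by (rule index_diff_add[OF le(1), symmetric])
      also have "\<dots> = \<alpha>'" unfolding eq by (rule index_diff_add[OF le(2)])
      finally show "p = p'" unfolding pp by (simp only:)
    qed
  qed (simp only: comp_def case_prod_unfold fst_conv snd_conv)
  also have "\<dots> \<le> (\<Sum>(\<gamma>, \<beta>)\<in>?A \<times> ?B. \<rho>\<^sup>2 * ?y \<gamma> \<beta>)"
  proof (rule sum_mono2)
    show "(\<lambda>(\<alpha>, \<beta>). (\<alpha> - index_of \<beta>, \<beta>)) ` Sigma (?A - {0}) below \<subseteq> ?A \<times> ?B"
    proof (rule subsetI)
      fix p assume "p \<in> (\<lambda>(\<alpha>, \<beta>). (\<alpha> - index_of \<beta>, \<beta>)) ` Sigma (?A - {0}) below"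
      then obtain \<alpha> \<beta> where p: "p = (\<alpha> - index_of \<beta>, \<beta>)" "multi_degree \<alpha> \<le> n" "\<beta> \<in> below \<alpha>"
        by auto
      have "multi_degree (\<alpha> - index_of \<beta>) \<le> n"
        using degree_diff_below[OF p(3)] p(2) by linarith
      moreover have "\<beta> \<in> ?B" using p(2,3) by blast
      ultimately show "p \<in> ?A \<times> ?B" unfolding p(1) by (simp only: mem_Sigma_iff mem_Collect_eq simp_thms)
    qed
    show "\<And>b. b \<in> ?A \<times> ?B - (\<lambda>(\<alpha>, \<beta>). (\<alpha> - index_of \<beta>, \<beta>)) ` Sigma (?A - {0}) below \<Longrightarrow>
        0 \<le> (case b of (\<gamma>, \<beta>) \<Rightarrow> \<rho>\<^sup>2 * ?y \<gamma> \<beta>)"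
      unfolding case_prod_unfold by (intro mult_nonneg_nonneg y0) simp
  qed (use finA finB in blast)
  also have "\<dots> = \<rho>\<^sup>2 * (\<Sum>\<gamma>\<in>?A. \<Sum>\<beta>\<in>?B. ?y \<gamma> \<beta>)"
    by (simp only: sum.cartesian_product[symmetric] sum_distrib_left)
  also have "\<dots> \<le> \<rho>\<^sup>2 * (\<Sum>\<gamma>\<in>?A. \<rho> ^ (2 * multi_degree \<gamma>) * ((norm (state_out \<gamma>))\<^sup>2 / multi_coeff a \<gamma>))"
  proof (intro mult_left_mono sum_mono)
    fix \<gamma> :: "'d multi_index"
    have "(\<Sum>\<beta>\<in>?B. (norm (hsum_nth (state_out \<gamma>) \<beta>))\<^sup>2) \<le> (norm (state_out \<gamma>))\<^sup>2"
      unfolding norm_hsum_sq by (rule finite_sum_le_infsum[OF hsum_summable finB]) auto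
    then have "\<rho> ^ (2 * multi_degree \<gamma>) * ((\<Sum>\<beta>\<in>?B. (norm (hsum_nth (state_out \<gamma>) \<beta>))\<^sup>2) / multi_coeff a \<gamma>)
        \<le> \<rho> ^ (2 * multi_degree \<gamma>) * ((norm (state_out \<gamma>))\<^sup>2 / multi_coeff a \<gamma>)"
      using \<rho> by (intro mult_left_mono divide_right_mono) (auto intro: less_imp_le[OF multi_coeff_pos])
    then show "(\<Sum>\<beta>\<in>?B. ?y \<gamma> \<beta>) \<le> \<rho> ^ (2 * multi_degree \<gamma>) * ((norm (state_out \<gamma>))\<^sup>2 / multi_coeff a \<gamma>)"
      by (simp only: sum_distrib_left[symmetric] sum_divide_distrib[symmetric])
  qed simp
  finally show ?thesis unfolding weighted_sum_def split_0 by (rule add_left_mono)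
qed

text \<open>The isometry of the colligation and \<open>weighted_state_bound\<close>; for \<open>\<rho> < 1\<close> part of the energy of \<open>x\<close> remains on the
  left, which bounds it.\<close>

lemma system_energy:
  assumes \<rho>: "0 < \<rho>" "\<rho> \<le> 1"
  shows "weighted_sum \<rho> n (\<lambda>\<alpha>. output \<alpha>) + (1 - \<rho>\<^sup>2) * weighted_sum \<rho> n (\<lambda>\<alpha>. state_out \<alpha>)
    \<le> (norm h)\<^sup>2 + weighted_sum \<rho> n f"
proof -
  have "weighted_sum \<rho> n (\<lambda>\<alpha>. output \<alpha>) + weighted_sum \<rho> n (\<lambda>\<alpha>. state_out \<alpha>) = weighted_sum \<rho> n u + weighted_sum \<rho> n f"
    unfolding weighted_sum_def sum.distrib[symmetric] distrib_left[symmetric] add_divide_distrib[symmetric] colligation_isometry ..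
  then show ?thesis
    using weighted_state_bound[OF \<rho>, of n] by (simp add: left_diff_distrib)
qed

lemma system_output_norm:
  assumes F: "f = (\<lambda>\<alpha>. sqrt (multi_coeff a \<alpha>) *\<^sub>R hsum_nth F \<alpha>)"
  obtains G where "\<And>\<alpha>. output \<alpha> = sqrt (multi_coeff a \<alpha>) *\<^sub>R hsum_nth G \<alpha>"
    "(norm G)\<^sup>2 \<le> (norm h)\<^sup>2 + (norm F)\<^sup>2"
proof -
  have "weighted_sum 1 n (\<lambda>\<alpha>. output \<alpha>) \<le> (norm h)\<^sup>2 + (norm F)\<^sup>2" for n
    using system_energy[of 1 n] weighted_sum_le_norm[of 1 n F] by (simp add: F)
  from weighted_sum_bounded[OF zero_less_one this] obtain G
    where G: "\<And>\<alpha>. hsum_nth G \<alpha> = (1 ^ multi_degree \<alpha> / sqrt (multi_coeff a \<alpha>)) *\<^sub>R output \<alpha>"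
      "(norm G)\<^sup>2 \<le> (norm h)\<^sup>2 + (norm F)\<^sup>2" by blast
  have "output \<alpha> = sqrt (multi_coeff a \<alpha>) *\<^sub>R hsum_nth G \<alpha>" for \<alpha>
    using multi_coeff_pos[of \<alpha>] by (simp add: G(1))
  then show thesis using that G(2) by blast
qed

text \<open>The weighted bounds make the series of \<open>u\<close> and \<open>x\<close> converge absolutely at \<open>z\<close>. The coefficients of \<open>u\<close> are those of
  the Cauchy product of the row \<open>Z\<close> with \<open>x\<close>, so the system can be summed.\<close>

lemma system_point:
  assumes F: "f = (\<lambda>\<alpha>. sqrt (multi_coeff a \<alpha>) *\<^sub>R hsum_nth F \<alpha>)" and z: "z \<in> ball 0 1"
  obtains v where "((\<lambda>\<alpha>. monomial z \<alpha> *\<^sub>C u \<alpha>) has_sum v) UNIV"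
    "v = h + row_sum (Z_row z) (col v + D (hs_fun F z))"
    "((\<lambda>\<alpha>. monomial z \<alpha> *\<^sub>C output \<alpha>) has_sum (\<Delta> v - row (hs_fun F z))) UNIV"
proof -
  \<comment> \<open>a radius strictly between the norm of \<open>z\<close> and 1\<close>
  define \<rho> where "\<rho> = (1 + norm z) / 2"
  have "norm z < 1" using z by simp
  then have \<rho>: "0 < \<rho>" "\<rho> < 1" "norm z < \<rho>"
    unfolding \<rho>_def using norm_ge_zero[of z] by argo+
  have \<rho>2: "0 < 1 - \<rho>\<^sup>2" using \<rho> by (simp add: power_less_one_iff)
  let ?B = "((norm h)\<^sup>2 + (norm F)\<^sup>2) / (1 - \<rho>\<^sup>2)"
  have x_le: "weighted_sum \<rho> n (\<lambda>\<alpha>. state_out \<alpha>) \<le> ?B" for n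
  proof -
    have "(1 - \<rho>\<^sup>2) * weighted_sum \<rho> n (\<lambda>\<alpha>. state_out \<alpha>) \<le> (norm h)\<^sup>2 + (norm F)\<^sup>2"
      using system_energy[of \<rho> n] \<rho> weighted_sum_le_norm[of \<rho> n F, folded F]
        weighted_sum_nonneg[OF \<rho>(1), of n "\<lambda>\<alpha>. output \<alpha>"] by linarith
    then show ?thesis using \<rho>2 by (simp add: pos_le_divide_eq mult.commute)
  qed
  have u_le: "weighted_sum \<rho> n u \<le> (norm h)\<^sup>2 + \<rho>\<^sup>2 * ?B" for n
  proof -
    have "\<rho>\<^sup>2 * weighted_sum \<rho> n (\<lambda>\<alpha>. state_out \<alpha>) \<le> \<rho>\<^sup>2 * ?B"
      by (intro mult_left_mono x_le) simp
    then show ?thesis using weighted_state_bound[of \<rho> n] \<rho> by linarith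
  qed
  define v where "v = (\<Sum>\<^sub>\<infinity>\<alpha>. monomial z \<alpha> *\<^sub>C u \<alpha>)"
  have v: "((\<lambda>\<alpha>. monomial z \<alpha> *\<^sub>C u \<alpha>) has_sum v) UNIV"
    unfolding v_def
    by (rule abs_summable_has_sum, rule weighted_abs_summable[OF \<rho>(1,3) u_le])
  have fz: "((\<lambda>\<alpha>. monomial z \<alpha> *\<^sub>C f \<alpha>) has_sum hs_fun F z) UNIV"
    using hs_fun_has_sum[OF z, of F] by (simp only: F)
  have op: "((\<lambda>\<alpha>. monomial z \<alpha> *\<^sub>C A (p \<alpha>)) has_sum A q) UNIV"
    if "bounded_clinear A" "((\<lambda>\<alpha>. monomial z \<alpha> *\<^sub>C p \<alpha>) has_sum q) UNIV"
    for A :: "'x::chilbert_space \<Rightarrow> 'y::chilbert_space" and p q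
    using has_sum_clinear[OF that(1) that(2)]
    by (simp only: bounded_clinear_scaleC[OF that(1)])
  have x: "((\<lambda>\<alpha>. monomial z \<alpha> *\<^sub>C state_out \<alpha>) has_sum (col v + D (hs_fun F z))) UNIV"
    unfolding scaleC_add_right
    by (rule has_sum_add[OF op[OF col_bounded v] op[OF D_bounded fz]])
  have g: "((\<lambda>\<alpha>. monomial z \<alpha> *\<^sub>C output \<alpha>) has_sum (\<Delta> v - row (hs_fun F z))) UNIV"
    unfolding scaleC.diff_right
    by (rule has_sum_diff[OF op[OF defect_bounded v] op[OF row_bounded fz]])
  have Zx: "((\<lambda>\<gamma>. monomial z \<gamma> *\<^sub>C row_sum (Z_row z) (state_out \<gamma>)) has_sum row_sum (Z_row z) (col v + D (hs_fun F z))) UNIV"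
    by (rule op[OF Z_bounded[OF z] x])
  let ?t = "\<lambda>\<beta> \<gamma>. (monomial z \<gamma> * Z_row z \<beta>) *\<^sub>C hsum_nth (state_out \<gamma>) \<beta>"
  have t_abs: "(\<lambda>(\<gamma>, \<beta>). norm (?t \<beta> \<gamma>)) summable_on Sigma UNIV (\<lambda>_. UNIV)"
  proof (rule summable_on_SigmaI)
    fix \<gamma>
    have s: "(\<lambda>\<beta>. norm (Z_row z \<beta> *\<^sub>C hsum_nth (state_out \<gamma>) \<beta>)) summable_on UNIV"
      by (rule l2_row(1)[OF Z_row_summable[OF z]])
    have "((\<lambda>\<beta>. cmod (monomial z \<gamma>) * norm (Z_row z \<beta> *\<^sub>C hsum_nth (state_out \<gamma>) \<beta>)) has_sum
        cmod (monomial z \<gamma>) * (\<Sum>\<^sub>\<infinity>\<beta>. norm (Z_row z \<beta> *\<^sub>C hsum_nth (state_out \<gamma>) \<beta>))) UNIV"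
      by (rule has_sum_cmult_right[OF has_sum_infsum[OF s]])
    then show "((\<lambda>\<beta>. case (\<gamma>, \<beta>) of (\<gamma>, \<beta>) \<Rightarrow> norm (?t \<beta> \<gamma>)) has_sum
        cmod (monomial z \<gamma>) * (\<Sum>\<^sub>\<infinity>\<beta>. norm (Z_row z \<beta> *\<^sub>C hsum_nth (state_out \<gamma>) \<beta>))) UNIV"
      by (simp only: split norm_scaleC norm_mult mult.assoc)
  next
    let ?q = "sqrt (\<Sum>\<^sub>\<infinity>\<beta>. (cmod (Z_row z \<beta>))\<^sup>2)"
    show "(\<lambda>\<gamma>. cmod (monomial z \<gamma>) * (\<Sum>\<^sub>\<infinity>\<beta>. norm (Z_row z \<beta> *\<^sub>C hsum_nth (state_out \<gamma>) \<beta>))) summable_on UNIV"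
    proof (rule summable_on_comparison_test)
      show "(\<lambda>\<gamma>. ?q * norm (monomial z \<gamma> *\<^sub>C state_out \<gamma>)) summable_on UNIV"
        by (rule summable_on_cmult_right[OF weighted_abs_summable[OF \<rho>(1,3) x_le]])
      fix \<gamma>
      have "(\<Sum>\<^sub>\<infinity>\<beta>. norm (Z_row z \<beta> *\<^sub>C hsum_nth (state_out \<gamma>) \<beta>)) \<le> ?q * norm (state_out \<gamma>)"
        by (rule l2_row(2)[OF Z_row_summable[OF z]])
      then have "cmod (monomial z \<gamma>) * (\<Sum>\<^sub>\<infinity>\<beta>. norm (Z_row z \<beta> *\<^sub>C hsum_nth (state_out \<gamma>) \<beta>))
          \<le> cmod (monomial z \<gamma>) * (?q * norm (state_out \<gamma>))"
        by (rule mult_left_mono) simp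
      then show "cmod (monomial z \<gamma>) * (\<Sum>\<^sub>\<infinity>\<beta>. norm (Z_row z \<beta> *\<^sub>C hsum_nth (state_out \<gamma>) \<beta>))
          \<le> ?q * norm (monomial z \<gamma> *\<^sub>C state_out \<gamma>)"
        by (simp only: norm_scaleC mult.left_commute)
      show "0 \<le> cmod (monomial z \<gamma>) * (\<Sum>\<^sub>\<infinity>\<beta>. norm (Z_row z \<beta> *\<^sub>C hsum_nth (state_out \<gamma>) \<beta>))"
        by (intro mult_nonneg_nonneg infsum_nonneg) auto
    qed
  qed auto
  then have "(\<lambda>p. norm ((\<lambda>(\<gamma>, \<beta>). ?t \<beta> \<gamma>) p)) summable_on UNIV"
    by (simp add: case_prod_unfold)
  then have "(\<lambda>(\<gamma>, \<beta>). ?t \<beta> \<gamma>) summable_on UNIV" by (rule Infinite_Sum.abs_summable_summable)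
  then obtain S where S: "((\<lambda>(\<gamma>, \<beta>). ?t \<beta> \<gamma>) has_sum S) (UNIV \<times> UNIV)"
    by (auto simp: summable_on_def)
  then have "((\<lambda>\<gamma>. monomial z \<gamma> *\<^sub>C row_sum (Z_row z) (state_out \<gamma>)) has_sum S) UNIV"
  proof (rule has_sum_SigmaD)
    fix \<gamma>
    show "((\<lambda>\<beta>. (\<lambda>(\<gamma>, \<beta>). ?t \<beta> \<gamma>) (\<gamma>, \<beta>)) has_sum monomial z \<gamma> *\<^sub>C row_sum (Z_row z) (state_out \<gamma>)) UNIV"
      unfolding split scaleC_scaleC[symmetric]
      by (rule has_sum_bounded_linear[OF scaleC.bounded_linear_right row_sum_has_sum[OF Z_row_summable[OF z]]])
  qed
  then have S_eq: "S = row_sum (Z_row z) (col v + D (hs_fun F z))"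
    using Zx by (rule has_sum_unique)
  have "((\<lambda>(\<beta>, \<gamma>). ?t \<beta> \<gamma>) has_sum S) UNIV"
    using has_sum_swap[THEN iffD1, OF S] by simp
  then have "((\<lambda>\<alpha>. \<Sum>\<beta>\<in>below \<alpha>. ?t \<beta> (\<alpha> - index_of \<beta>)) has_sum S) UNIV"
    by (rule has_sum_cauchy_below)
  moreover have "(\<Sum>\<beta>\<in>below \<alpha>. ?t \<beta> (\<alpha> - index_of \<beta>)) = monomial z \<alpha> *\<^sub>C u \<alpha> - (if \<alpha> = 0 then h else 0)" for \<alpha>
  proof -
    have "(\<Sum>\<beta>\<in>below \<alpha>. ?t \<beta> (\<alpha> - index_of \<beta>))
        = (\<Sum>\<beta>\<in>below \<alpha>. monomial z \<alpha> *\<^sub>C (sqrt (b_coeff a (index_of \<beta>)) *\<^sub>R hsum_nth (state_out (\<alpha> - index_of \<beta>)) \<beta>))"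
    proof (rule sum.cong[OF refl])
      fix \<beta> assume "\<beta> \<in> below \<alpha>"
      then have "monomial z (\<alpha> - index_of \<beta>) * Z_row z \<beta> = monomial z \<alpha> * complex_of_real (sqrt (b_coeff a (index_of \<beta>)))"
        by (simp only: Z_row_def monomial_below[of \<beta> \<alpha> z, symmetric] mult_ac)
      then show "?t \<beta> (\<alpha> - index_of \<beta>) = monomial z \<alpha> *\<^sub>C (sqrt (b_coeff a (index_of \<beta>)) *\<^sub>R hsum_nth (state_out (\<alpha> - index_of \<beta>)) \<beta>)"
        by (simp only: scaleC_of_real[symmetric] scaleC_scaleC)
    qed
    also have "\<dots> = monomial z \<alpha> *\<^sub>C (u \<alpha> - (if \<alpha> = 0 then h else 0))"
      using sys[unfolded system_def, rule_format, of \<alpha>] by (simp only: scaleC.sum_right[symmetric] add_diff_cancel_left')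
    also have "\<dots> = monomial z \<alpha> *\<^sub>C u \<alpha> - (if \<alpha> = 0 then h else 0)"
      by (simp add: scaleC.diff_right scaleC.zero_right monomial_def)
    finally show ?thesis .
  qed
  ultimately have "((\<lambda>\<alpha>. monomial z \<alpha> *\<^sub>C u \<alpha> - (if \<alpha> = 0 then h else 0)) has_sum S) UNIV" by simp
  moreover have "((\<lambda>\<alpha>. monomial z \<alpha> *\<^sub>C u \<alpha> - (if \<alpha> = 0 then h else 0)) has_sum v - h) UNIV"
    by (rule has_sum_diff[OF v]) (rule has_sum_finite_neutralI[of "{0}"], auto)
  ultimately have "S = v - h" by (rule has_sum_unique)
  then have "v = h + row_sum (Z_row z) (col v + D (hs_fun F z))" by (simp add: S_eq)
  then show thesis using that v g by blast
qed

end

end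

section \<open>The characteristic function as a multiplier\<close>

context contraction_setting
begin

abbreviation Z :: "complex ^ 'd \<Rightarrow> ('d nonzero_index, 'h) hsum \<Rightarrow> 'h" where
  "Z z \<equiv> row_sum (Z_row z)"

definition resolvent :: "complex ^ 'd \<Rightarrow> 'h \<Rightarrow> 'h" where
  "resolvent z = inv (\<lambda>h. h - Z z (col h))"

lemma char_fun_eq: "char_fun a T z x = - row x + \<Delta> (resolvent z (Z z (D x)))"
  by (simp only: char_fun_def Z_op_eq cadjoint_row resolvent_def)

lemma one_minus_Z_col_bounded: "z \<in> ball 0 1 \<Longrightarrow> bounded_clinear (\<lambda>h. h - Z z (col h))"
  by (rule bounded_clinear_diff[OF bounded_clinear_id(2) bounded_clinear_comp[OF Z_bounded col_bounded]])

lemma hs_fun_0: "hs_fun 0 z = 0"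
  using hs_fun_linear(3)[of 0 0 z] by simp

text \<open>Injective because \<open>Z\<close> is a strict contraction; onto because the system with input $(r, 0)$ has a solution.\<close>

lemma resolvent_bij:
  assumes z: "z \<in> ball 0 1"
  shows "bij (\<lambda>h. h - Z z (col h))"
proof (rule bijI)
  obtain q where q: "0 \<le> q" "q < 1" "\<And>F :: ('d nonzero_index, 'h) hsum. norm (Z z F) \<le> q * norm F"
    using Z_contraction[OF z] by blast
  have "h = 0" if "h - Z z (col h) = 0" for h
  proof (rule ccontr)
    assume "h \<noteq> 0"
    have "norm h = norm (Z z (col h))" using that by simp
    also have "\<dots> \<le> q * norm (col h)" by (rule q(3))
    also have "\<dots> \<le> q * norm h" by (intro mult_left_mono norm_col_le q)
    also have "\<dots> < 1 * norm h" using q(2) \<open>h \<noteq> 0\<close> by (intro mult_strict_right_mono) auto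
    finally show False by simp
  qed
  then show "inj (\<lambda>h. h - Z z (col h))"
    unfolding linear_injective_0[OF bounded_linear.linear[OF bounded_clinear_linear[OF one_minus_Z_col_bounded[OF z]]]]
    by blast
  show "surj (\<lambda>h. h - Z z (col h))"
  proof (rule surjI)
    fix r :: 'h
    let ?P = "\<lambda>v. v - Z z (col v) = r"
    obtain u where u: "system r (\<lambda>_. 0) u" using system_ex by blast
    obtain v where "v = r + Z z (col v + D (hs_fun 0 z))"
      by (rule system_point[OF u _ z, of 0]) (auto simp: hsum_nth_zero fun_eq_iff)
    then have "?P v" by (simp add: hs_fun_0 D_lin algebra_simps)
    then have "?P (SOME v. ?P v)" by (rule someI)
    then show "(\<lambda>h. h - Z z (col h)) ((\<lambda>r. SOME v. v - Z z (col v) = r) r) = r" .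
  qed
qed

lemma resolvent_eq: "z \<in> ball 0 1 \<Longrightarrow> resolvent z r - Z z (col (resolvent z r)) = r"
  unfolding resolvent_def using surj_f_inv_f[OF bij_is_surj[OF resolvent_bij], of z r] by simp

lemma resolvent_unique: "z \<in> ball 0 1 \<Longrightarrow> v - Z z (col v) = r \<Longrightarrow> resolvent z r = v"
  unfolding resolvent_def using inv_f_f[OF bij_is_inj[OF resolvent_bij], of z v] by simp

lemma resolvent_bounded:
  assumes z: "z \<in> ball 0 1"
  shows "bounded_clinear (resolvent z)"
  unfolding bounded_op_def
proof (intro conjI ballI allI)
  note lin = clinear[OF one_minus_Z_col_bounded[OF z]]
  show "resolvent z (x + y) = resolvent z x + resolvent z y" for x y
    by (rule resolvent_unique[OF z]) (simp only: lin resolvent_eq[OF z])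
  show "resolvent z (c *\<^sub>C x) = c *\<^sub>C resolvent z x" for c x
    by (rule resolvent_unique[OF z]) (simp only: lin resolvent_eq[OF z])
  obtain q where q: "0 \<le> q" "q < 1" "\<And>F :: ('d nonzero_index, 'h) hsum. norm (Z z F) \<le> q * norm F"
    using Z_contraction[OF z] by blast
  show "\<exists>K. \<forall>x\<in>UNIV. norm (resolvent z x) \<le> K * norm x"
  proof (intro exI ballI)
    fix x
    let ?v = "resolvent z x"
    have "?v = x + Z z (col ?v)" using resolvent_eq[OF z, of x] by (simp add: algebra_simps)
    then have "norm ?v \<le> norm x + norm (Z z (col ?v))" by (metis norm_triangle_ineq)
    also have "norm (Z z (col ?v)) \<le> q * norm (col ?v)" by (rule q(3))
    also have "q * norm (col ?v) \<le> q * norm ?v" by (intro mult_left_mono norm_col_le q)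
    finally have "(1 - q) * norm ?v \<le> norm x" by (simp add: left_diff_distrib)
    then show "norm ?v \<le> 1 / (1 - q) * norm x" using q(2) by (simp add: pos_le_divide_eq mult.commute)
  qed
qed auto

lemma char_fun_bounded:
  assumes z: "z \<in> ball 0 1"
  shows "bounded_op (D_tilde_space a T) (defect_space a T) (char_fun a T z)"
proof -
  have 1: "bounded_clinear (\<lambda>x. \<Delta> (resolvent z (Z z (D x))) - row x)"
    by (intro bounded_clinear_diff bounded_clinear_comp[OF defect_bounded]
        bounded_clinear_comp[OF resolvent_bounded[OF z]] bounded_clinear_comp[OF Z_bounded[OF z]] D_bounded row_bounded)
  have 2: "char_fun a T z x \<in> defect_space a T" if "x \<in> D_tilde_space a T" for x
    unfolding char_fun_eq
    by (intro closed_csubspaceD[OF defect_space_subspace] row_in_space that defect_in_space)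
  have "char_fun a T z = (\<lambda>x. \<Delta> (resolvent z (Z z (D x))) - row x)"
    by (simp add: fun_eq_iff char_fun_eq)
  then show ?thesis
    using 1 2 unfolding bounded_op_def by (simp only:) blast
qed

text \<open>The output of the system with input $(h, f)$ is $V h + \theta f$; so $(h, f) \mapsto V h + \theta f$ is a
  contraction.\<close>

lemma system_realization:
  obtains G where "(norm G)\<^sup>2 \<le> (norm h)\<^sup>2 + (norm F)\<^sup>2"
    "\<And>z. z \<in> ball 0 1 \<Longrightarrow> hs_fun G z = \<Delta> (resolvent z h) + char_fun a T z (hs_fun F z)"
    "F \<in> hs_vectors (D_tilde_space a T) \<Longrightarrow> G \<in> hs_vectors (defect_space a T)"
proof -
  let ?f = "\<lambda>\<alpha>. sqrt (multi_coeff a \<alpha>) *\<^sub>R hsum_nth F \<alpha>"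
  obtain u where u: "system h ?f u" using system_ex by blast
  obtain G where G: "\<And>\<alpha>. \<Delta> (u \<alpha>) - row (?f \<alpha>) = sqrt (multi_coeff a \<alpha>) *\<^sub>R hsum_nth G \<alpha>"
      "(norm G)\<^sup>2 \<le> (norm h)\<^sup>2 + (norm F)\<^sup>2"
    using system_output_norm[OF u refl] by blast
  show thesis
  proof (rule that[OF G(2)])
    fix z :: "complex ^ 'd" assume z: "z \<in> ball 0 1"
    obtain v where v: "v = h + Z z (col v + D (hs_fun F z))"
        "((\<lambda>\<alpha>. monomial z \<alpha> *\<^sub>C (\<Delta> (u \<alpha>) - row (?f \<alpha>))) has_sum (\<Delta> v - row (hs_fun F z))) UNIV"
      by (rule system_point[OF u refl z])
    note Zlin = clinear[OF Z_bounded[OF z]]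
    note rlin = clinear[OF resolvent_bounded[OF z]]
    have vz: "v - Z z (col v) = h + Z z (D (hs_fun F z))"
      using v(1) unfolding Zlin by (simp add: algebra_simps)
    have "v = resolvent z h + resolvent z (Z z (D (hs_fun F z)))"
      using resolvent_unique[OF z vz] by (simp add: rlin)
    moreover have "hs_fun G z = \<Delta> v - row (hs_fun F z)"
      using hs_fun_has_sum[OF z, of G] v(2) unfolding G(1) by (rule has_sum_unique)
    ultimately show "hs_fun G z = \<Delta> (resolvent z h) + char_fun a T z (hs_fun F z)"
      by (simp add: char_fun_eq defect_lin)
  next
    assume F: "F \<in> hs_vectors (D_tilde_space a T)"
    have "hsum_nth G \<alpha> \<in> defect_space a T" for \<alpha>
    proof -
      have "hsum_nth G \<alpha> = (1 / sqrt (multi_coeff a \<alpha>)) *\<^sub>R (\<Delta> (u \<alpha>) - row (?f \<alpha>))"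
        using multi_coeff_pos[of \<alpha>] unfolding G(1) by simp
      also have "\<dots> \<in> defect_space a T"
        using F by (intro closed_csubspaceD[OF defect_space_subspace] defect_in_space row_in_space
            closed_csubspaceD(5)[OF D_space_subspace]) (simp add: hs_vectors_def)
      finally show ?thesis .
    qed
    then show "G \<in> hs_vectors (defect_space a T)" by (simp add: hs_vectors_def)
  qed
qed

text \<open>The coefficients $a_\alpha T^{\alpha *} h$ of $V_T$ before applying \<open>\<Delta>\<close> satisfy the recursion of the state, by the
  renewal equation.\<close>

lemma V_system: "system h (\<lambda>_. 0) (\<lambda>\<alpha>. multi_coeff a \<alpha> *\<^sub>R T_adj \<alpha> h)"
  unfolding system_def
proof
  fix \<alpha> :: "'d multi_index"
  show "multi_coeff a \<alpha> *\<^sub>R T_adj \<alpha> h = (if \<alpha> = 0 then h else 0) + (\<Sum>\<beta>\<in>below \<alpha>.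
      sqrt (b_coeff a (index_of \<beta>)) *\<^sub>R
      hsum_nth (col (multi_coeff a (\<alpha> - index_of \<beta>) *\<^sub>R T_adj (\<alpha> - index_of \<beta>) h) + D 0) \<beta>)"
  proof (cases "\<alpha> = 0")
    case True
    then show ?thesis by (simp add: below_0 multi_coeff_0 T_adj_0)
  next
    case False
    have "sqrt (b_coeff a (index_of \<beta>)) *\<^sub>R
        hsum_nth (col (multi_coeff a (\<alpha> - index_of \<beta>) *\<^sub>R T_adj (\<alpha> - index_of \<beta>) h) + D 0) \<beta>
        = (b_coeff a (index_of \<beta>) * multi_coeff a (\<alpha> - index_of \<beta>)) *\<^sub>R T_adj \<alpha> h"
      if "\<beta> \<in> below \<alpha>" for \<beta>
    proof -
      let ?\<gamma> = "\<alpha> - index_of \<beta>" and ?b = "b_coeff a (index_of \<beta>)"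
      have "index_of \<beta> + ?\<gamma> = \<alpha>"
        using that index_diff_add[of "index_of \<beta>" \<alpha>] by (simp only: below_def mem_Collect_eq add.commute)
      then have "T_adj (index_of \<beta>) (T_adj ?\<gamma> h) = T_adj \<alpha> h"
        by (simp only: T_adj_add[symmetric])
      then have "hsum_nth (col (multi_coeff a ?\<gamma> *\<^sub>R T_adj ?\<gamma> h) + D 0) \<beta> = sqrt ?b *\<^sub>R (multi_coeff a ?\<gamma> *\<^sub>R T_adj \<alpha> h)"
        by (simp only: D_lin add_0_right hsum_nth_col clinear[OF T_adj_bounded])
      then have "sqrt ?b *\<^sub>R hsum_nth (col (multi_coeff a ?\<gamma> *\<^sub>R T_adj ?\<gamma> h) + D 0) \<beta>
          = (sqrt ?b * sqrt ?b * multi_coeff a ?\<gamma>) *\<^sub>R T_adj \<alpha> h"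
        by (simp only: scaleR_scaleR mult.assoc)
      moreover have "sqrt ?b * sqrt ?b = ?b" using b_coeff_nonneg[of "index_of \<beta>"] by simp
      ultimately show ?thesis by (simp only:)
    qed
    then have "(\<Sum>\<beta>\<in>below \<alpha>. sqrt (b_coeff a (index_of \<beta>)) *\<^sub>R
        hsum_nth (col (multi_coeff a (\<alpha> - index_of \<beta>) *\<^sub>R T_adj (\<alpha> - index_of \<beta>) h) + D 0) \<beta>)
        = (\<Sum>\<beta>\<in>below \<alpha>. (b_coeff a (index_of \<beta>) * multi_coeff a (\<alpha> - index_of \<beta>)) *\<^sub>R T_adj \<alpha> h)"
      by (rule sum.cong[OF refl])
    also have "\<dots> = multi_coeff a \<alpha> *\<^sub>R T_adj \<alpha> h"
      unfolding multi_renewal[OF False] by (rule scaleR_sum_left[symmetric])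
    finally show ?thesis using False by simp
  qed
qed

lemma V_op_eq:
  assumes z: "z \<in> ball 0 1"
  shows "V_op a T h z = \<Delta> (resolvent z h)"
proof -
  obtain v where v: "v = h + Z z (col v + D (hs_fun 0 z))"
      "((\<lambda>\<alpha>. monomial z \<alpha> *\<^sub>C (\<Delta> (multi_coeff a \<alpha> *\<^sub>R T_adj \<alpha> h) - row 0)) has_sum (\<Delta> v - row (hs_fun 0 z))) UNIV"
    by (rule system_point[OF V_system _ z, of 0]) (auto simp: hsum_nth_zero fun_eq_iff)
  have "v - Z z (col v) = h" using v(1) by (simp add: hs_fun_0 D_lin algebra_simps)
  then have "v = resolvent z h" using resolvent_unique[OF z] by metis
  moreover have "monomial z \<alpha> *\<^sub>C (\<Delta> (multi_coeff a \<alpha> *\<^sub>R T_adj \<alpha> h) - row 0)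
      = (complex_of_real (multi_coeff a \<alpha>) * monomial z \<alpha>) *\<^sub>C \<Delta> (T_adj \<alpha> h)" for \<alpha>
    by (simp add: defect_lin row_lin scaleC_scaleR scaleR_scaleC)
  ultimately have "((\<lambda>\<alpha>. (complex_of_real (multi_coeff a \<alpha>) * monomial z \<alpha>) *\<^sub>C \<Delta> (T_adj \<alpha> h)) has_sum \<Delta> (resolvent z h)) UNIV"
    using v(2) by (simp add: hs_fun_0 row_lin)
  then show ?thesis using z by (simp add: V_op_def infsumI)
qed

section \<open>The identity on kernel functions\<close>

text \<open>With $y = (I - \tilde T Z^*)^{-1} \Delta e$ and $p = \theta(z)^* e = D Z^* y - \tilde T^* e$, the Halmos unitary
  maps $(y, p)$ to $(Z^* y, e)$.\<close>

definition V_adj :: "complex ^ 'd \<Rightarrow> 'h \<Rightarrow> 'h" where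
  "V_adj z e = cadjoint (resolvent z) (\<Delta> e)"

definition theta_adj :: "complex ^ 'd \<Rightarrow> 'h \<Rightarrow> ('d nonzero_index, 'h) hsum" where
  "theta_adj z e = D (column (Z_row z) (V_adj z e)) - col e"

lemma cinner_V_adj:
  "z \<in> ball 0 1 \<Longrightarrow> cinner (\<Delta> (resolvent z h)) e = cinner h (V_adj z e)"
  by (simp only: V_adj_def defect_selfadjoint cinner_cadjoint[OF resolvent_bounded])

lemma V_adj_eq:
  assumes z: "z \<in> ball 0 1"
  shows "V_adj z e = row (column (Z_row z) (V_adj z e)) + \<Delta> e"
proof -
  let ?y = "V_adj z e"
  have "cinner u (?y - row (column (Z_row z) ?y) - \<Delta> e) = 0" for u
  proof -
    have "cinner u (\<Delta> e) = cinner (\<Delta> (resolvent z (u - Z z (col u)))) e"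
      by (simp only: resolvent_unique[OF z refl] defect_selfadjoint)
    also have "\<dots> = cinner (u - Z z (col u)) ?y" by (rule cinner_V_adj[OF z])
    also have "\<dots> = cinner u ?y - cinner u (row (column (Z_row z) ?y))"
      by (simp only: cinner.diff_left cinner_column[OF Z_row_summable[OF z], symmetric] cinner_col)
    finally show ?thesis by (simp add: cinner.diff_right)
  qed
  then have "?y - row (column (Z_row z) ?y) - \<Delta> e = 0" by (rule cinner_eq_0_all)
  then show ?thesis by (simp add: algebra_simps)
qed

lemma cinner_theta_adj:
  assumes z: "z \<in> ball 0 1"
  shows "cinner (char_fun a T z x) e = cinner x (theta_adj z e)"
proof -
  have "cinner (char_fun a T z x) e = cinner (\<Delta> (resolvent z (Z z (D x)))) e - cinner (row x) e"
    unfolding char_fun_eq by (simp add: cinner_add_left cinner.minus_left cinner.diff_left)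
  also have "cinner (\<Delta> (resolvent z (Z z (D x)))) e = cinner x (D (column (Z_row z) (V_adj z e)))"
    by (simp only: cinner_V_adj[OF z] cinner_column[OF Z_row_summable[OF z], symmetric] D_selfadjoint)
  finally show ?thesis by (simp add: theta_adj_def cinner_row cinner.diff_right)
qed

lemma theta_adj_in_space: "e \<in> defect_space a T \<Longrightarrow> theta_adj z e \<in> D_tilde_space a T"
  unfolding theta_adj_def by (intro closed_csubspaceD[OF D_space_subspace] D_in_space col_in_space)

text \<open>The system at the point \<open>w\<close> with initial vector \<open>y\<close> and input $s(w,z) p$ has the state $s(w,z) y$: as $(y, p)$ is
  mapped to $(Z(z)^* y, e)$, this amounts to $s(w,z)\, Z(w) Z(z)^* = s(w,z) - 1$. The output is $s(w,z) e$.\<close>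

lemma kernel_decomposition:
  assumes z: "z \<in> ball 0 1" and w: "w \<in> ball 0 1"
  shows "\<Delta> (resolvent w (V_adj z e)) + char_fun a T w (kernel w z *\<^sub>C theta_adj z e) = kernel w z *\<^sub>C e"
proof -
  let ?y = "V_adj z e" and ?p = "theta_adj z e" and ?c = "column (Z_row z) (V_adj z e)" and ?k = "kernel w z"
  let ?v = "?k *\<^sub>C ?y - resolvent w ?y"
  note Zlin = clinear[OF Z_bounded[OF w]] and lin = row_lin col_lin defect_lin D_lin
  have y: "?y = row ?c + \<Delta> e" by (rule V_adj_eq[OF z])
  have "col ?y + D ?p = ?c"
    by (subst y) (simp add: theta_adj_def lin D_square D_col)
  then have Dp: "D ?p = ?c - col ?y" by (simp add: algebra_simps)
  have e: "\<Delta> ?y - row ?p = e"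
    by (subst y) (simp add: theta_adj_def lin defect_square row_D)
  have "?v - Z w (col ?v) = Z w (D (?k *\<^sub>C ?p))"
  proof -
    have "?v - Z w (col ?v) = ?k *\<^sub>C (?y - Z w (col ?y)) - (resolvent w ?y - Z w (col (resolvent w ?y)))"
      by (simp add: lin Zlin scaleC.diff_right)
    also have "\<dots> = ?k *\<^sub>C ?y - ?y - ?k *\<^sub>C Z w (col ?y)"
      by (simp add: resolvent_eq[OF w] scaleC.diff_right)
    also have "?k *\<^sub>C ?y - ?y = (?k - 1) *\<^sub>C ?y" by (simp add: scaleC.diff_left)
    also have "\<dots> = ?k *\<^sub>C Z w ?c"
      by (simp only: Z_column[OF w z] kernel_one_minus_inverse[OF w z, symmetric] scaleC_scaleC)
    also have "?k *\<^sub>C Z w ?c - ?k *\<^sub>C Z w (col ?y) = Z w (D (?k *\<^sub>C ?p))"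
      by (simp add: lin Zlin Dp scaleC.diff_right)
    finally show ?thesis .
  qed
  then have "resolvent w (Z w (D (?k *\<^sub>C ?p))) = ?v" by (rule resolvent_unique[OF w])
  then have "char_fun a T w (?k *\<^sub>C ?p) = ?k *\<^sub>C (\<Delta> ?y - row ?p) - \<Delta> (resolvent w ?y)"
    by (simp add: char_fun_eq lin scaleC.diff_right)
  then show ?thesis by (simp add: e)
qed

lemma hs_fun_in: "closed_csubspace E \<Longrightarrow> F \<in> hs_vectors E \<Longrightarrow> z \<in> ball 0 1 \<Longrightarrow> hs_fun F z \<in> E"
  by (rule closed_csubspace_has_sum[OF _ _ hs_fun_has_sum])
    (auto simp: hs_vectors_def intro!: closed_csubspaceD)

lemma kernel_vector_in: "closed_csubspace E \<Longrightarrow> e \<in> E \<Longrightarrow> z \<in> ball 0 1 \<Longrightarrow> column (eval_row z) e \<in> hs_vectors E"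
  by (simp add: hs_vectors_def hsum_nth_column[OF eval_row_summable] closed_csubspaceD)

text \<open>The operators are realized on the coordinate space by \<open>V\<close> and \<open>M\<close>. The difference of the two sides of the identity at
  \<open>z\<close> lies in the defect space and is shown to be orthogonal to every \<open>e\<close> in it, by pairing \<open>\<Phi>\<close> with the decomposition of the
  kernel function at \<open>z\<close>.\<close>

lemma char_fun_multiplier:
  fixes E F
  defines "E \<equiv> D_tilde_space a T" and "F \<equiv> defect_space a T"
  shows "multiplier a E F (char_fun a T)" "mult_contractive a E (char_fun a T)"
    "f \<in> hs_space a F \<Longrightarrow>
       V_op a T (adjoint_on UNIV cinner (hs_inner a) (V_op a T) f) z
       + mult_op (char_fun a T) (adjoint_on (hs_space a E) (hs_inner a) (hs_inner a) (mult_op (char_fun a T)) f) z = f z"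
proof -
  let ?\<theta> = "char_fun a T"
  have E: "closed_csubspace E" and F: "closed_csubspace F"
    unfolding E_def F_def by (rule D_space_subspace defect_space_subspace)+
  note hsE = hs_space_eq[OF E] and hsF = hs_space_eq[OF F]
  have \<theta>_lin: "?\<theta> z (x + y) = ?\<theta> z x + ?\<theta> z y" "?\<theta> z (c *\<^sub>C x) = c *\<^sub>C ?\<theta> z x" "?\<theta> z x \<in> F" "?\<theta> z 0 = 0"
    if "z \<in> ball 0 1" "x \<in> E" "y \<in> E" for z x y c
  proof -
    show "?\<theta> z (x + y) = ?\<theta> z x + ?\<theta> z y" and sc: "\<And>c. ?\<theta> z (c *\<^sub>C x) = c *\<^sub>C ?\<theta> z x" and "?\<theta> z x \<in> F"
      using char_fun_bounded[OF that(1)] that unfolding bounded_op_def E_def F_def by blast+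
    show "?\<theta> z 0 = 0" using sc[of 0] by simp
  qed
  have "\<exists>G. (P \<in> hs_vectors E \<longrightarrow> hs_fun G = mult_op ?\<theta> (hs_fun P) \<and> norm G \<le> norm P \<and> G \<in> hs_vectors F)" for P
  proof -
    obtain G where G: "(norm G)\<^sup>2 \<le> (norm (0 :: 'h))\<^sup>2 + (norm P)\<^sup>2"
      "\<And>z. z \<in> ball 0 1 \<Longrightarrow> hs_fun G z = \<Delta> (resolvent z 0) + ?\<theta> z (hs_fun P z)"
      "P \<in> hs_vectors E \<Longrightarrow> G \<in> hs_vectors F"
      unfolding E_def F_def by (rule system_realization[of 0 P]) blast
    have "hs_fun G z = mult_op ?\<theta> (hs_fun P) z" for z
    proof (cases "z \<in> ball 0 1")
      case True
      have "resolvent z 0 = 0"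
        by (rule resolvent_unique[OF True]) (simp add: col_lin clinear[OF Z_bounded[OF True]])
      then show ?thesis using G(2)[OF True] True by (simp add: mult_op_def defect_lin)
    next
      case False
      then show ?thesis by (simp add: hs_fun_def mult_op_def)
    qed
    then have "hs_fun G = mult_op ?\<theta> (hs_fun P)" by (rule ext)
    moreover have "norm G \<le> norm P" using G(1) by (simp add: power2_le_iff_abs_le)
    ultimately show ?thesis using G(3) by blast
  qed
  then obtain M where M: "\<And>P. P \<in> hs_vectors E \<Longrightarrow> hs_fun (M P) = mult_op ?\<theta> (hs_fun P)"
    "\<And>P. P \<in> hs_vectors E \<Longrightarrow> norm (M P) \<le> norm P" "\<And>P. P \<in> hs_vectors E \<Longrightarrow> M P \<in> hs_vectors F"
    by metis
  have "\<exists>G. hs_fun G = V_op a T h \<and> norm G \<le> norm h" for h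
  proof -
    obtain G where G: "(norm G)\<^sup>2 \<le> (norm h)\<^sup>2 + (norm (0 :: ('d multi_index, ('d nonzero_index, 'h) hsum) hsum))\<^sup>2"
      "\<And>z. z \<in> ball 0 1 \<Longrightarrow> hs_fun G z = \<Delta> (resolvent z h) + ?\<theta> z (hs_fun 0 z)"
      by (rule system_realization[of h 0]) blast
    have "hs_fun G z = V_op a T h z" for z
    proof (cases "z \<in> ball 0 1")
      case True
      then show ?thesis
        using G(2)[OF True] \<theta>_lin(4)[OF True closed_csubspaceD(2)[OF E] closed_csubspaceD(2)[OF E]]
        by (simp add: V_op_eq hs_fun_0)
    next
      case False
      then show ?thesis by (simp add: hs_fun_def V_op_def)
    qed
    then have "hs_fun G = V_op a T h" by (rule ext)
    moreover have "norm G \<le> norm h" using G(1) by (simp add: power2_le_iff_abs_le)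
    ultimately show ?thesis by blast
  qed
  then obtain V where V: "\<And>h. hs_fun (V h) = V_op a T h" "\<And>h. norm (V h) \<le> norm h" by metis
  show mult: "multiplier a E F ?\<theta>"
    unfolding multiplier_def
  proof (intro conjI ballI)
    show "bounded_op E F (?\<theta> z)" if "z \<in> ball 0 1" for z
      unfolding E_def F_def by (rule char_fun_bounded[OF that])
    show "mult_op ?\<theta> f \<in> hs_space a F" if "f \<in> hs_space a E" for f
    proof -
      obtain P where P: "f = hs_fun P" "P \<in> hs_vectors E" using \<open>f \<in> hs_space a E\<close> unfolding hsE by blast
      show ?thesis unfolding hsF P(1) M(1)[OF P(2), symmetric] by (intro imageI M(3) P(2))
    qed
  qed
  show "mult_contractive a E ?\<theta>"
    unfolding mult_contractive_def
  proof
    fix f :: "complex ^ 'd \<Rightarrow> ('d nonzero_index, 'h) hsum" assume "f \<in> hs_space a E"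
    then obtain P where P: "f = hs_fun P" "P \<in> hs_vectors E" unfolding hsE by blast
    show "hs_norm a (mult_op ?\<theta> f) \<le> hs_norm a f"
      unfolding P(1) M(1)[OF P(2), symmetric] hs_norm_hs_fun by (rule M(2)[OF P(2)])
  qed
  have V_bounded: "bounded_clinear V"
    unfolding bounded_op_def
  proof (intro conjI ballI allI)
    show "V (x + y) = V x + V y" for x y
    proof (rule hs_fun_eq_iff[THEN iffD1], rule ext)
      fix z
      show "hs_fun (V (x + y)) z = hs_fun (V x + V y) z"
        unfolding hs_fun_linear V(1)
        by (cases "z \<in> ball 0 1") (simp_all add: V_op_eq clinear[OF resolvent_bounded] defect_lin, simp add: V_op_def)
    qed
    show "V (c *\<^sub>C x) = c *\<^sub>C V x" for c x
    proof (rule hs_fun_eq_iff[THEN iffD1], rule ext)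
      fix z
      show "hs_fun (V (c *\<^sub>C x)) z = hs_fun (c *\<^sub>C V x) z"
        unfolding hs_fun_linear V(1)
        by (cases "z \<in> ball 0 1") (simp_all add: V_op_eq clinear[OF resolvent_bounded] defect_lin, simp add: V_op_def scaleC.zero_right)
    qed
    show "\<exists>K. \<forall>x\<in>UNIV. norm (V x) \<le> K * norm x"
      using V(2) by (intro exI[of _ 1]) auto
  qed auto
  note hE = hs_vectors_subspace[OF E]
  have M_bounded: "bounded_op (hs_vectors E) UNIV M"
    unfolding bounded_op_def
  proof (intro conjI ballI allI)
    show "M (x + y) = M x + M y" if xy: "x \<in> hs_vectors E" "y \<in> hs_vectors E" for x y
    proof (rule hs_fun_eq_iff[THEN iffD1], rule ext)
      fix z
      have "x + y \<in> hs_vectors E" by (intro closed_csubspaceD[OF hE] xy)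
      then show "hs_fun (M (x + y)) z = hs_fun (M x + M y) z"
        unfolding hs_fun_linear using xy
        by (simp add: M(1) mult_op_def hs_fun_linear \<theta>_lin(1) hs_fun_in[OF E])
    qed
    show "M (c *\<^sub>C x) = c *\<^sub>C M x" if x: "x \<in> hs_vectors E" for c x
    proof (rule hs_fun_eq_iff[THEN iffD1], rule ext)
      fix z
      have "c *\<^sub>C x \<in> hs_vectors E" by (intro closed_csubspaceD[OF hE] x)
      then show "hs_fun (M (c *\<^sub>C x)) z = hs_fun (c *\<^sub>C M x) z"
        unfolding hs_fun_linear using x \<theta>_lin(2)[of z "hs_fun x z" 0 c] closed_csubspaceD(2)[OF E]
        by (simp add: M(1) mult_op_def hs_fun_linear hs_fun_in[OF E] scaleC.zero_right)
    qed
    show "\<exists>K. \<forall>x\<in>hs_vectors E. norm (M x) \<le> K * norm x"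
      using M(2) by (intro exI[of _ 1]) auto
  qed auto
  assume "f \<in> hs_space a F"
  then obtain \<Phi> where \<Phi>: "f = hs_fun \<Phi>" "\<Phi> \<in> hs_vectors F" unfolding hsF by blast
  obtain h where h: "\<And>u. cinner (V u) \<Phi> = cinner u h"
    by (rule adjoint_ex[OF closed_csubspace_UNIV V_bounded, of \<Phi>]) auto
  obtain P where P: "P \<in> hs_vectors E" "\<And>U. U \<in> hs_vectors E \<Longrightarrow> cinner (M U) \<Phi> = cinner U P"
    by (rule adjoint_ex[OF hE M_bounded, of \<Phi>]) auto
  have adj_V: "adjoint_on UNIV cinner (hs_inner a) (V_op a T) f = h"
    unfolding adjoint_on_def
  proof (rule the_equality)
    show "h \<in> UNIV \<and> (\<forall>u\<in>UNIV. hs_inner a (V_op a T u) f = cinner u h)"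
      by (simp add: \<Phi>(1) hs_inner_hs_fun h flip: V(1))
    fix x assume "x \<in> UNIV \<and> (\<forall>u\<in>UNIV. hs_inner a (V_op a T u) f = cinner u x)"
    then have "cinner u (x - h) = 0" for u
      by (simp add: \<Phi>(1) hs_inner_hs_fun h cinner.diff_right flip: V(1))
    then have "x - h = 0" by (rule cinner_eq_0_all)
    then show "x = h" by simp
  qed
  have adj_M: "adjoint_on (hs_space a E) (hs_inner a) (hs_inner a) (mult_op ?\<theta>) f = hs_fun P"
    unfolding adjoint_on_def
  proof (rule the_equality)
    show "hs_fun P \<in> hs_space a E \<and> (\<forall>u\<in>hs_space a E. hs_inner a (mult_op ?\<theta> u) f = hs_inner a u (hs_fun P))"
      unfolding hsE \<Phi>(1) using P by (auto simp: hs_inner_hs_fun simp flip: M(1))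
    fix x assume x: "x \<in> hs_space a E \<and> (\<forall>u\<in>hs_space a E. hs_inner a (mult_op ?\<theta> u) f = hs_inner a u x)"
    then obtain Q where Q: "x = hs_fun Q" "Q \<in> hs_vectors E" unfolding hsE by blast
    have QP: "Q - P \<in> hs_vectors E" by (intro closed_csubspaceD[OF hE] Q P)
    then have "hs_inner a (mult_op ?\<theta> (hs_fun (Q - P))) f = hs_inner a (hs_fun (Q - P)) x"
      using x unfolding hsE by blast
    then have "cinner (M (Q - P)) \<Phi> = cinner (Q - P) Q"
      unfolding M(1)[OF QP, symmetric] \<Phi>(1) Q(1) hs_inner_hs_fun .
    then have "cinner (Q - P) (Q - P) = 0"
      using P(2)[OF QP] by (simp add: cinner.diff_right)
    then show "x = hs_fun P" by (simp add: Q(1) cinner_self)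
  qed
  show "V_op a T (adjoint_on UNIV cinner (hs_inner a) (V_op a T) f) z
       + mult_op ?\<theta> (adjoint_on (hs_space a E) (hs_inner a) (hs_inner a) (mult_op ?\<theta>) f) z = f z"
  proof (cases "z \<in> ball 0 1")
    case False
    then show ?thesis by (simp add: V_op_def mult_op_def \<Phi>(1) hs_fun_def)
  next
    case z: True
    define \<epsilon> where "\<epsilon> = \<Delta> (resolvent z h) + ?\<theta> z (hs_fun P z) - hs_fun \<Phi> z"
    have \<epsilon>F: "\<epsilon> \<in> F"
      unfolding \<epsilon>_def
    proof (intro closed_csubspaceD[OF F])
      show "\<Delta> (resolvent z h) \<in> F" unfolding F_def by (rule defect_in_space)
      show "?\<theta> z (hs_fun P z) \<in> F"
        by (rule \<theta>_lin(3)[OF z hs_fun_in[OF E P(1) z] closed_csubspaceD(2)[OF E]])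
      show "hs_fun \<Phi> z \<in> F" by (rule hs_fun_in[OF F \<Phi>(2) z])
    qed
    have orth: "cinner \<epsilon> e = 0" if e: "e \<in> F" for e
    proof -
      let ?y = "V_adj z e" and ?p = "theta_adj z e"
      have pE: "?p \<in> E" using theta_adj_in_space e unfolding E_def F_def by blast
      have Kp: "column (eval_row z) ?p \<in> hs_vectors E" by (rule kernel_vector_in[OF E pE z])
      have dec: "column (eval_row z) e = V ?y + M (column (eval_row z) ?p)"
      proof (rule hs_fun_eq_iff[THEN iffD1], rule ext)
        fix w
        show "hs_fun (column (eval_row z) e) w = hs_fun (V ?y + M (column (eval_row z) ?p)) w"
        proof (cases "w \<in> ball 0 1")
          case True
          then show ?thesis
            using kernel_decomposition[OF z True, of e]
            by (simp only: hs_fun_linear V(1) M(1)[OF Kp] mult_op_def if_True V_op_eq hs_fun_kernel[OF True z])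
        qed (simp add: hs_fun_def)
      qed
      have "cinner (hs_fun \<Phi> z) e = cinner \<Phi> (column (eval_row z) e)"
        by (rule cinner_kernel[OF z, symmetric])
      also have "\<dots> = cnj (cinner (V ?y) \<Phi>) + cnj (cinner (M (column (eval_row z) ?p)) \<Phi>)"
        unfolding dec cinner_add_right by (simp only: cinner_commute[symmetric])
      also have "\<dots> = cinner h ?y + cinner P (column (eval_row z) ?p)"
        unfolding h P(2)[OF Kp] by (simp only: cinner_commute[symmetric])
      also have "cinner P (column (eval_row z) ?p) = cinner (hs_fun P z) ?p"
        by (rule cinner_kernel[OF z])
      finally show ?thesis
        by (simp add: \<epsilon>_def cinner.diff_left cinner_add_left cinner_V_adj[OF z] cinner_theta_adj[OF z])
    qed
    have "\<epsilon> = 0" using orth[OF \<epsilon>F] by (simp add: cinner_self)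
    then show ?thesis
      unfolding adj_V adj_M using z by (simp add: \<epsilon>_def V_op_eq mult_op_def \<Phi>(1))
  qed
qed

end

theorem theorem4p11:
  fixes s :: "complex ^ 'd::finite \<Rightarrow> complex ^ 'd \<Rightarrow> complex"
    and a :: "nat \<Rightarrow> real"
    and T :: "'d \<Rightarrow> 'h::chilbert_space \<Rightarrow> 'h"
  assumes "unitarily_invariant_CNP s a"
    and "s_contraction a T"
  shows "multiplier a (D_tilde_space a T) (defect_space a T) (char_fun a T) \<and>
    mult_contractive a (D_tilde_space a T) (char_fun a T) \<and>
    (\<forall>f\<in>hs_space a (defect_space a T). \<forall>z.
           V_op a T (adjoint_on UNIV cinner (hs_inner a) (V_op a T) f) z
           + mult_op (char_fun a T)
               (adjoint_on (hs_space a (D_tilde_space a T)) (hs_inner a) (hs_inner a)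
                 (mult_op (char_fun a T)) f) z
           = f z)"
proof -
  note CNP = assms(1)[unfolded unitarily_invariant_CNP_def]
  have s: "(\<lambda>n. complex_of_real (a n) * (\<Sum>i\<in>UNIV. z $ i * cnj (w $ i)) ^ n) sums s z w"
    if "z \<in> ball 0 1" "w \<in> ball 0 1" for z w
    using CNP that by blast
  interpret invariant_kernel a
  proof
    show "a 0 = 1" "\<And>n. a n > 0" using CNP by blast+
    fix r :: real assume r: "0 \<le> r" "r < 1"
    \<comment> \<open>a point with $\langle z, z\rangle = r$, so that the kernel series at $(z, z)$ is the one in question\<close>
    define z :: "complex ^ 'd" where "z = axis undefined (of_real (sqrt r))"
    have "z \<in> ball 0 1" using r by (simp add: z_def norm_axis_eq)
    moreover have "(\<Sum>i\<in>UNIV. z $ i * cnj (z $ i)) = of_real r"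
    proof -
      have "complex_of_real (sqrt r) * complex_of_real (sqrt r) = of_real r"
        using r by (simp flip: of_real_mult)
      then have "(\<Sum>i\<in>UNIV. z $ i * cnj (z $ i)) = (\<Sum>i\<in>(UNIV :: 'd set). if i = undefined then of_real r else 0)"
        by (intro sum.cong) (auto simp: z_def axis_def)
      then show ?thesis by simp
    qed
    ultimately have "(\<lambda>n. complex_of_real (a n * r ^ n)) sums s z z"
      using s[of z z] by simp
    then show "summable (\<lambda>n. a n * r ^ n)"
      using sums_Re sums_summable by fastforce
  qed
  interpret contraction_setting a T
  proof
    show "0 \<le> cnp_coeff a n" for n
      by (rule cnp_coeff_nonneg[OF s]) (use CNP in blast)+
    show "s_contraction a T" by (rule assms(2))
  qed
  show ?thesis
    using char_fun_multiplier by blast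
qed

end
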